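(* Let $\mathcal A$ be a TSSS cluster algebra having principal coefficients, let $x_{l;t}$ and $x_{l';t'}$ be two non-initial cluster variables of $\mathcal A$, and let $F_{l;t}$, $F_{l';t'}$ be the $F$-polynomials associated to $x_{l;t}$, $x_{l';t'}$ respectively. If $F_{l;t}=F_{l';t'}$, then $x_{l;t}=x_{l';t'}$.
   Context: $[1,n]=\{1,\dots,n\}$; $[x]_+=\max(x,0)$; $\mathrm{sgn}(0)=0$, $\mathrm{sgn}(x)=|x|/x$ otherwise. An integer $n\times n$ matrix $B=(b_{ij})$ is sign-skew-symmetric if for all $i,j$ either $b_{ij}=b_{ji}=0$ or $b_{ij}b_{ji}<0$. Its mutation $\mu_k(B)=(b'_{ij})$ is $b'_{ij}=-b_{ij}$ if $i=k$ or $j=k$, and $b'_{ij}=b_{ij}+\mathrm{sgn}(b_{ik})[b_{ik}b_{kj}]_+$ otherwise. $B$ is totally sign-skew-symmetric (TSSS) if every matrix obtained from it by a sequence of mutations is sign-skew-symmetric. Let $(\mathbb P,\oplus,\cdot)$ be a semifield (free abelian multiplicative group with a commutative, associative addition $\oplus$ over which multiplication distributes), $\mathcal F$ the field of rational functions in $n$ variables over $\mathbb{QP}$. A seed is $(X,Y,B)$, $X=(x_1,\dots,x_n)$ a free generating set of $\mathcal F$, $Y=(y_1,\dots,y_n)\in\mathbb P^n$, $B$ TSSS. Its mutation in direction $k$ is $(X',Y',\mu_k(B))$ with $x'_j=x_j$ ($j\ne k$), $x_k'=\frac{y_k\prod_i x_i^{[b_{ik}]_+}+\prod_i x_i^{[-b_{ik}]_+}}{(y_k\oplus1)x_k}$,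 $y'_k=y_k^{-1}$, $y'_j=y_jy_k^{[b_{kj}]_+}(y_k\oplus1)^{-b_{kj}}$ ($j\neq k$). $\mathbb T_n$ is the $n$-regular tree with edges at each vertex labeled by $[1,n]$; a cluster pattern assigns seeds $\Sigma_t=(X_t,Y_t,B_t)$ to vertices so that seeds joined by an edge labeled $k$ are related by mutation in direction $k$. The cluster algebra $\mathcal A$ is the $\mathbb{ZP}$-subalgebra of $\mathcal F$ generated by all cluster variables $x_{i;t}$. $t_0$ is the initial vertex; omitted $t$ means $t_0$. $\mathrm{Trop}(u_1,\dots,u_l)$ is the free abelian group on $u_i$ with $\prod u_j^{a_j}\oplus\prod u_j^{b_j}=\prod u_j^{\min(a_j,b_j)}$. Principal coefficients (at $t_0$): $\mathbb P=\mathrm{Trop}(y_1,\dots,y_n)$, $Y_{t_0}=(y_1,\dots,y_n)$. Then each $x_{l;t}$ is a Laurent polynomial in $X$ with coefficients in $\mathbb Z[y_1,\dots,y_n]$, and $F_{l;t}=x_{l;t}|_{x_1=\dots=x_n=1}\in\mathbb Z[y_1,\dots,y_n]$ is its $F$-polynomial. A cluster variable is non-initial if it is not one of $x_1,\dots,x_n$. *)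

theory Defs
  imports
    "HOL-Analysis.Finite_Cartesian_Product"
    "HOL-Library.Poly_Mapping"
    "HOL-Computational_Algebra.Polynomial_Factorial"
begin

section \<open>Matrix mutation\<close>

text \<open>
  The index set \<open>[1,n]\<close> is a finite type \<^typ>\<open>'n\<close> with \<open>n = CARD('n)\<close>. Where a linear order
  on \<^typ>\<open>'n\<close> is required, it only serves to obtain the library's integral domain structure on
  polynomial rings; the definitions do not refer to it.
\<close>

definition pos_part :: "'a::{zero,linorder} \<Rightarrow> 'a" where
  "pos_part x = max x 0"

definition sign_skew_symmetric :: "int^'n^'n \<Rightarrow> bool" where
  "sign_skew_symmetric B \<longleftrightarrow>
     (\<forall>i j. (B $ i $ j = 0 \<and> B $ j $ i = 0) \<or> B $ i $ j * B $ j $ i < 0)"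

definition matrix_mutation :: "'n \<Rightarrow> int^'n^'n \<Rightarrow> int^'n^'n" where
  "matrix_mutation k B = (\<chi> i j.
     if i = k \<or> j = k then - B $ i $ j
     else B $ i $ j + sgn (B $ i $ k) * pos_part (B $ i $ k * B $ k $ j))"

definition totally_sign_skew_symmetric :: "int^'n^'n \<Rightarrow> bool" where
  "totally_sign_skew_symmetric B \<longleftrightarrow> (\<forall>ks. sign_skew_symmetric (fold matrix_mutation ks B))"


section \<open>Semifields\<close>

text \<open>
  The abelian group of a semifield is written additively: \<open>+\<close>, \<open>0\<close>, unary minus are its
  multiplication, unit and inverse, and \<open>\<oplus>\<close> is its (auxiliary) addition. This is the
  convention under which \<^typ>\<open>'p \<Rightarrow>\<^sub>0 int\<close> is its integral group ring. The linear order is not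
  part of the structure and is unrelated to \<open>\<oplus>\<close>: a torsion-free abelian group always admits
  one, and the library needs one to know that the group ring is an integral domain.
\<close>

class semifield = linordered_ab_group_add +
  fixes splus :: "'a \<Rightarrow> 'a \<Rightarrow> 'a" (infixl \<open>\<oplus>\<close> 60)
  assumes splus_assoc: "(a \<oplus> b) \<oplus> c = a \<oplus> (b \<oplus> c)"
    and splus_commute: "a \<oplus> b = b \<oplus> a"
    and add_splus_distrib: "a + (b \<oplus> c) = (a + b) \<oplus> (a + c)"

text \<open>The power \<open>a\<^sup>m\<close> in the group, which is a multiple in additive notation.\<close>

definition gpow :: "'a::ab_group_add \<Rightarrow> int \<Rightarrow> 'a" where
  "gpow a m = (if 0 \<le> m then (((+) a) ^^ nat m) 0 else - (((+) a) ^^ nat (- m)) 0)"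

text \<open>
  The tropical semifield \<open>Trop(u\<^sub>i | i)\<close>: a Laurent monomial is its exponent vector, so that the
  group is free abelian on the \<open>u\<^sub>i\<close>, and \<open>\<oplus>\<close> is the componentwise minimum.
\<close>

type_synonym 'n trop = "'n \<Rightarrow>\<^sub>0 int"

instantiation poly_mapping :: (linorder, linordered_ab_group_add) semifield
begin

lift_definition splus_poly_mapping :: "('a \<Rightarrow>\<^sub>0 'b) \<Rightarrow> ('a \<Rightarrow>\<^sub>0 'b) \<Rightarrow> 'a \<Rightarrow>\<^sub>0 'b"
  is "\<lambda>f g i. min (f i) (g i)"
proof -
  fix f g :: "'a \<Rightarrow> 'b"
  assume "finite {i. f i \<noteq> 0}" "finite {i. g i \<noteq> 0}"
  then have "finite ({i. f i \<noteq> 0} \<union> {i. g i \<noteq> 0})" by simp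
  then show "finite {i. min (f i) (g i) \<noteq> 0}"
    by (rule rev_finite_subset) (auto simp: min_def)
qed

instance
proof
  fix a b c :: "'a \<Rightarrow>\<^sub>0 'b"
  show "(a \<oplus> b) \<oplus> c = a \<oplus> (b \<oplus> c)"
    by transfer (simp add: min.assoc)
  show "a \<oplus> b = b \<oplus> a"
    by transfer (simp add: min.commute)
  show "a + (b \<oplus> c) = (a + b) \<oplus> (a + c)"
    by transfer (simp add: min_add_distrib_right)
qed

end

definition trop_gen :: "'n \<Rightarrow> 'n trop" where
  "trop_gen i = Poly_Mapping.single i 1"


section \<open>The ambient field\<close>

text \<open>
  \<open>\<rat>\<P>\<close> is the fraction field of the group ring \<open>\<int>\<P>\<close>; the ambient field is the field of rational
  functions in \<open>n\<close> variables over it.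
\<close>

type_synonym 'p QP = "('p \<Rightarrow>\<^sub>0 int) fract"

type_synonym ('p, 'n) QP_poly = "('n \<Rightarrow>\<^sub>0 nat) \<Rightarrow>\<^sub>0 'p QP"

type_synonym ('p, 'n) ambient = "('p, 'n) QP_poly fract"

definition QP_of :: "'p::semifield \<Rightarrow> 'p QP" where
  "QP_of p = to_fract (Poly_Mapping.single p 1)"

definition scalar :: "'p::semifield QP \<Rightarrow> ('p, 'n::{finite,linorder}) ambient" where
  "scalar c = to_fract (Poly_Mapping.single 0 c)"

definition P_elem :: "'p::semifield \<Rightarrow> ('p, 'n::{finite,linorder}) ambient" where
  "P_elem p = scalar (QP_of p)"

text \<open>Evaluation of a polynomial at \<open>x\<close>, its coefficients being mapped through \<open>h\<close>.\<close>

definition poly_eval ::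
    "('c::zero \<Rightarrow> 'a::comm_semiring_1) \<Rightarrow> ('n::finite \<Rightarrow> 'a) \<Rightarrow> (('n \<Rightarrow>\<^sub>0 nat) \<Rightarrow>\<^sub>0 'c) \<Rightarrow> 'a" where
  "poly_eval h x f = (\<Sum>m\<in>Poly_Mapping.keys f.
     h (Poly_Mapping.lookup f m) * (\<Prod>i\<in>UNIV. x i ^ Poly_Mapping.lookup m i))"

text \<open>
  The \<open>x\<^sub>i\<close> are algebraically independent over \<open>\<rat>\<P>\<close> and generate the ambient field over \<open>\<rat>\<P>\<close>.
\<close>

definition free_generating :: "('n::{finite,linorder} \<Rightarrow> ('p::semifield, 'n) ambient) \<Rightarrow> bool" where
  "free_generating X \<longleftrightarrow>
     (\<forall>f. poly_eval scalar X f = 0 \<longrightarrow> f = 0) \<and>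
     (\<forall>z. \<exists>f g. poly_eval scalar X g \<noteq> 0 \<and> z = poly_eval scalar X f / poly_eval scalar X g)"


section \<open>Seeds and cluster patterns\<close>

record (overloaded) ('p, 'n) seed =
  cluster :: "'n \<Rightarrow> ('p, 'n) ambient"
  coeffs :: "'n \<Rightarrow> 'p"
  exchange_matrix :: "int^'n^'n"

definition is_seed :: "('p::semifield, 'n::{finite,linorder}) seed \<Rightarrow> bool" where
  "is_seed S \<longleftrightarrow> free_generating (cluster S) \<and> totally_sign_skew_symmetric (exchange_matrix S)"

definition cluster_mutation ::
    "'n \<Rightarrow> ('p::semifield, 'n::{finite,linorder}) seed \<Rightarrow> 'n \<Rightarrow> ('p, 'n) ambient" where
  "cluster_mutation k S = (let X = cluster S; Y = coeffs S; B = exchange_matrix S in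
     X(k := (P_elem (Y k) * (\<Prod>i\<in>UNIV. X i ^ nat (pos_part (B $ i $ k)))
             + (\<Prod>i\<in>UNIV. X i ^ nat (pos_part (- B $ i $ k))))
            / (P_elem (Y k \<oplus> 0) * X k)))"

definition coeffs_mutation :: "'n \<Rightarrow> ('p::semifield, 'n::{finite,linorder}) seed \<Rightarrow> 'n \<Rightarrow> 'p" where
  "coeffs_mutation k S = (let Y = coeffs S; B = exchange_matrix S in
     (\<lambda>j. if j = k then - Y k
          else Y j + gpow (Y k) (pos_part (B $ k $ j)) + gpow (Y k \<oplus> 0) (- B $ k $ j)))"

definition seed_mutation ::
    "'n \<Rightarrow> ('p::semifield, 'n::{finite,linorder}) seed \<Rightarrow> ('p, 'n) seed" where
  "seed_mutation k S =
     \<lparr>cluster = cluster_mutation k S,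
      coeffs = coeffs_mutation k S,
      exchange_matrix = matrix_mutation k (exchange_matrix S)\<rparr>"

text \<open>
  The \<open>n\<close>-regular tree with edges labelled by \<^typ>\<open>'n\<close>, such that the \<open>n\<close> edges at each vertex have
  distinct labels: the vertices are the words without equal adjacent letters, and an edge
  labelled \<open>k\<close> joins \<open>w\<close> and \<open>k # w\<close>. The empty word plays no distinguished role.
\<close>

definition tree_vertices :: "'n list set" where
  "tree_vertices = {w. distinct_adj w}"

definition tree_edge :: "'n \<Rightarrow> 'n list \<Rightarrow> 'n list \<Rightarrow> bool" where
  "tree_edge k t t' \<longleftrightarrow> t \<in> tree_vertices \<and> t' \<in> tree_vertices \<and> (t' = k # t \<or> t = k # t')"

text \<open>
  A cluster pattern is indexed by all words; its values outside \<^const>\<open>tree_vertices\<close> are junk.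
\<close>

definition cluster_pattern ::
    "('n list \<Rightarrow> ('p::semifield, 'n::{finite,linorder}) seed) \<Rightarrow> bool" where
  "cluster_pattern S \<longleftrightarrow>
     (\<forall>t\<in>tree_vertices. is_seed (S t)) \<and>
     (\<forall>k t t'. tree_edge k t t' \<longrightarrow> S t' = seed_mutation k (S t))"

definition principal_coefficients ::
    "('n list \<Rightarrow> ('n trop, 'n::{finite,linorder}) seed) \<Rightarrow> 'n list \<Rightarrow> bool" where
  "principal_coefficients S t0 \<longleftrightarrow> coeffs (S t0) = trop_gen"

abbreviation cluster_variable ::
    "('n list \<Rightarrow> ('p::semifield, 'n::{finite,linorder}) seed) \<Rightarrow> 'n \<Rightarrow> 'n list \<Rightarrow> ('p, 'n) ambient" where
  "cluster_variable S l t \<equiv> cluster (S t) l"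


section \<open>F-polynomials\<close>

text \<open>
  The value \<open>z|\<^bsub>x\<^sub>1=\<dots>=x\<^sub>n=1\<^esub>\<close> in \<open>\<rat>\<P>\<close> of a rational function \<open>z = f(X)/g(X)\<close> whose denominator does not
  vanish at \<open>(1,\<dots>,1)\<close>, where \<open>X\<close> is a free generating set. It does not depend on the choice of
  such \<open>f\<close> and \<open>g\<close>. Cluster variables are of this form, being obtained from the initial ones by
  subtraction-free expressions.
\<close>

definition at_ones ::
    "('n::{finite,linorder} \<Rightarrow> ('p::semifield, 'n) ambient) \<Rightarrow> ('p, 'n) ambient \<Rightarrow> 'p QP" where
  "at_ones X z = (THE c. \<exists>f g. poly_eval id (\<lambda>_. 1) g \<noteq> 0 \<and>
     z = poly_eval scalar X f / poly_eval scalar X g \<and>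
     c = poly_eval id (\<lambda>_. 1) f / poly_eval id (\<lambda>_. 1) g)"

text \<open>
  For principal coefficients at \<open>t0\<close>, this value lies in the subring \<open>\<int>[y\<^sub>1,\<dots>,y\<^sub>n]\<close> of \<open>\<rat>\<P>\<close>, by the
  Laurent phenomenon.
\<close>

definition F_polynomial ::
    "('n list \<Rightarrow> ('n trop, 'n::{finite,linorder}) seed) \<Rightarrow> 'n list \<Rightarrow> 'n \<Rightarrow> 'n list \<Rightarrow> 'n trop QP" where
  "F_polynomial S t0 l t = at_ones (cluster (S t0)) (cluster_variable S l t)"

end

theory Submission
  imports Defs "HOL-Library.Product_Lexorder" "HOL-Library.Product_Plus"
begin

text \<open>
  Write \<open>X\<close> for the initial cluster, and call the Laurent ring of a cluster the ring of Laurent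
  polynomials in that cluster with coefficients in the group ring of \<open>\<P>\<close>.

  The value of a cluster variable at \<open>X = 1\<close> determines it up to a Laurent monomial in \<open>X\<close>. Every
  cluster variable is homogeneous for the grading with \<open>deg x\<^sub>i = e\<^sub>i\<close> and \<open>deg y\<^sub>j = - (column j of B)\<close>,
  that is, it is the product of a Laurent monomial in \<open>X\<close> and of a rational function of the
  degree-zero elements \<open>yhat\<^sub>j = y\<^sub>j \<Prod> x\<^sub>i\<^bsup>b\<^sub>i\<^sub>j\<^esup>\<close>, and setting \<open>X = 1\<close> turns \<open>yhat\<^sub>j\<close> into \<open>y\<^sub>j\<close>
  (\<open>cluster_variable_homogeneous\<close>, \<open>homogeneous_eq_up_to_monomial\<close>). So two cluster variables \<open>x, x'\<close>
  with the same F-polynomial satisfy \<open>x' = X\<^sup>h x\<close> for some \<open>h\<close>, and it has to be shown that \<open>h = 0\<close>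
  unless one of them is initial.

  Suppose \<open>h\<^sub>k > 0\<close>; the case \<open>h\<^sub>k < 0\<close> is symmetric. Then \<open>e = x' / x\<^sub>k\<close> belongs to the Laurent ring of
  \<open>X\<close> and to those of all its neighbours: \<open>x\<^sub>k\<close> is invertible everywhere except at the neighbour in
  direction \<open>k\<close>, and there \<open>e = X\<^bsup>h - e\<^sub>k\<^esup> x\<close> has no negative power of \<open>x\<^sub>k\<close>. The intersection of these
  Laurent rings, the upper bound of a seed, is invariant under mutation (\<open>upper_bound_invariant\<close>).
  Hence \<open>x' = x\<^sub>k e\<close> is a factorisation inside the Laurent ring of a cluster containing \<open>x'\<close>, where
  \<open>x'\<close> is a unit; so both factors are monomials in that cluster, and their exponents cannot be negative
  as both factors are Laurent polynomials in the neighbouring clusters as well. So one of the factors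
  is \<open>\<plusminus>p\<close> with \<open>p \<in> \<P>\<close> (\<open>cluster_variable_irreducible\<close>). It is not \<open>x\<^sub>k\<close>, so \<open>x' = \<plusminus>p x\<^sub>k\<close>. Finally, put
  \<open>X = 1\<close> and all \<open>y\<^sub>j = 1\<close> except \<open>y\<^sub>i = s\<close>, a positive real: every cluster variable stays between two
  positive constants as \<open>s\<close> tends to 0 (\<open>cluster_variable_bounded\<close>), which forces the sign to be \<open>+\<close>
  and \<open>p = 1\<close>. So \<open>x' = x\<^sub>k\<close> is initial.

  The invariance of the upper bound contains the Laurent phenomenon. It is reduced to the following
  statement about two mutations (\<open>laurent_ring_transfer\<close>): an element of the Laurent rings at \<open>\<Sigma>\<close> and at
  \<open>\<mu>\<^sub>j \<mu>\<^sub>k \<Sigma>\<close> is in the Laurent ring at \<open>\<mu>\<^sub>j \<Sigma>\<close>. Passing from the first ring to the third costs a power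
  of the exchange binomial \<open>1 + yhat\<^sub>j\<close> as denominator, passing from the second costs a power of the
  product of two cluster variables, and that product is a nonzerodivisor modulo \<open>1 + yhat\<^sub>j\<close>. If
  \<open>b\<^sub>k\<^sub>j = 0\<close>, this rests on \<open>yhat\<^sub>j\<close> and \<open>yhat\<^sub>k\<close> being multiplicatively independent, which principal
  coefficients provide at one seed and mutation preserves (\<open>mult_independent_mutation\<close>).
\<close>

section \<open>Monoid algebras and their homomorphisms\<close>

text \<open>
  Exponents of Laurent monomials are pairs (coefficient in \<open>\<P>\<close>, exponent of the cluster). Ordering them
  lexicographically makes their group an ordered group, so that elements of its group ring have
  extreme terms.
\<close>

instance prod :: (linordered_ab_group_add, linordered_ab_group_add) linordered_ab_group_add
  by standard (auto simp: less_eq_prod_def)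

definition is_ring_hom :: "('a::comm_semiring_1 \<Rightarrow> 'b::comm_semiring_1) \<Rightarrow> bool" where
  "is_ring_hom h \<longleftrightarrow> h 0 = 0 \<and> h 1 = 1 \<and> (\<forall>a b. h (a + b) = h a + h b) \<and> (\<forall>a b. h (a * b) = h a * h b)"

text \<open>
  The homomorphism of a monoid algebra given by its effect \<open>h\<close> on coefficients and \<open>\<phi>\<close> on
  monomials. Polynomial evaluation, Laurent expansions, the substitution of \<open>yhat\<close> for \<open>y\<close> and
  augmentations are all of this form.
\<close>

definition lin_ext :: "('c::zero \<Rightarrow> 'a::comm_semiring_1) \<Rightarrow> ('m \<Rightarrow> 'a) \<Rightarrow> ('m \<Rightarrow>\<^sub>0 'c) \<Rightarrow> 'a" where
  "lin_ext h \<phi> f = (\<Sum>m\<in>Poly_Mapping.keys f. h (Poly_Mapping.lookup f m) * \<phi> m)"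

lemma is_ring_homD:
  assumes "is_ring_hom h"
  shows "h 0 = 0" "h 1 = 1" "h (a + b) = h a + h b" "h (a * b) = h a * h b"
  using assms by (auto simp: is_ring_hom_def)

lemma is_ring_hom_diff:
  fixes h :: "'a::comm_ring_1 \<Rightarrow> 'b::comm_ring_1"
  assumes "is_ring_hom h"
  shows "h (a - b) = h a - h b"
proof -
  have "h (a - b) + h b = h a" using is_ring_homD(3)[OF assms, of "a - b" b] by simp
  then show ?thesis by (simp add: algebra_simps)
qed

lemma is_ring_hom_minus:
  fixes h :: "'a::comm_ring_1 \<Rightarrow> 'b::comm_ring_1"
  assumes "is_ring_hom h"
  shows "h (- b) = - h b"
  using is_ring_hom_diff[OF assms, of 0 b] is_ring_homD(1)[OF assms] by simp

lemma is_ring_hom_id: "is_ring_hom id"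
  by (simp add: is_ring_hom_def)

lemma is_ring_hom_commutes_of_int:
  fixes h :: "'a::comm_ring_1 \<Rightarrow> 'b::comm_ring_1"
  assumes "is_ring_hom h"
  shows "h (of_int c) = of_int c"
  by (induction c rule: int_induct[where k = 0])
    (simp_all add: is_ring_homD[OF assms] is_ring_hom_diff[OF assms])

lemma is_ring_hom_of_int: "is_ring_hom (of_int :: int \<Rightarrow> 'a::comm_ring_1)"
  by (simp add: is_ring_hom_def)

lemma sum_of_singles: "(\<Sum>m\<in>Poly_Mapping.keys f. Poly_Mapping.single m (Poly_Mapping.lookup f m)) = f"
  for f :: "'m \<Rightarrow>\<^sub>0 'c::comm_monoid_add"
proof (rule poly_mapping_eqI)
  fix k
  show "Poly_Mapping.lookup (\<Sum>m\<in>Poly_Mapping.keys f. Poly_Mapping.single m (Poly_Mapping.lookup f m)) k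
     = Poly_Mapping.lookup f k"
    by (auto simp: lookup_sum lookup_single when_def in_keys_iff sum.delta)
qed

lemma monoid_algebra_induct [case_names zero single add]:
  fixes f :: "'m \<Rightarrow>\<^sub>0 'c::comm_monoid_add"
  assumes "P 0" and "\<And>m c. P (Poly_Mapping.single m c)" and "\<And>f g. P f \<Longrightarrow> P g \<Longrightarrow> P (f + g)"
  shows "P f"
proof -
  have "P (\<Sum>m\<in>A. Poly_Mapping.single m (Poly_Mapping.lookup f m))" for A
    by (induction A rule: infinite_finite_induct) (auto intro: assms)
  then show ?thesis by (metis sum_of_singles)
qed

context
  fixes h :: "'c::comm_semiring_1 \<Rightarrow> 'a::comm_semiring_1"
  assumes h: "is_ring_hom h"
begin

lemma lin_ext_superset:
  assumes "finite A" "Poly_Mapping.keys f \<subseteq> A"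
  shows "lin_ext h \<phi> f = (\<Sum>m\<in>A. h (Poly_Mapping.lookup f m) * \<phi> m)"
  unfolding lin_ext_def using assms
  by (intro sum.mono_neutral_left) (auto simp: in_keys_iff is_ring_homD[OF h])

lemma lin_ext_add: "lin_ext h \<phi> (f + g) = lin_ext h \<phi> f + lin_ext h \<phi> g"
proof -
  let ?A = "Poly_Mapping.keys f \<union> Poly_Mapping.keys g"
  have "lin_ext h \<phi> (f + g) = (\<Sum>m\<in>?A. h (Poly_Mapping.lookup (f + g) m) * \<phi> m)"
    by (rule lin_ext_superset) (use keys_add[of f g] in auto)
  moreover have "lin_ext h \<phi> f = (\<Sum>m\<in>?A. h (Poly_Mapping.lookup f m) * \<phi> m)"
    by (rule lin_ext_superset) auto
  moreover have "lin_ext h \<phi> g = (\<Sum>m\<in>?A. h (Poly_Mapping.lookup g m) * \<phi> m)"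
    by (rule lin_ext_superset) auto
  ultimately show ?thesis
    by (simp add: lookup_add is_ring_homD[OF h] distrib_right sum.distrib)
qed

lemma lin_ext_0 [simp]: "lin_ext h \<phi> 0 = 0"
  by (simp add: lin_ext_def)

lemma lin_ext_single: "lin_ext h \<phi> (Poly_Mapping.single m c) = h c * \<phi> m"
  by (cases "c = 0") (simp_all add: lin_ext_def is_ring_homD[OF h])

lemma lin_ext_sum: "lin_ext h \<phi> (sum f A) = (\<Sum>a\<in>A. lin_ext h \<phi> (f a))"
  by (induction A rule: infinite_finite_induct) (auto simp: lin_ext_add)

lemma lin_ext_is_ring_hom:
  fixes \<phi> :: "'m::comm_monoid_add \<Rightarrow> 'a"
  assumes "\<phi> 0 = 1" and mult: "\<And>m n. \<phi> (m + n) = \<phi> m * \<phi> n"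
  shows "is_ring_hom (lin_ext h \<phi>)"
  unfolding is_ring_hom_def
proof (intro conjI allI)
  show "lin_ext h \<phi> 1 = 1"
    using lin_ext_single[of \<phi> 0 1] assms(1) by (simp add: is_ring_homD[OF h])
  fix f g :: "'m \<Rightarrow>\<^sub>0 'c"
  show "lin_ext h \<phi> (f * g) = lin_ext h \<phi> f * lin_ext h \<phi> g"
  proof (induction f rule: monoid_algebra_induct)
    case (single m c)
    show ?case
    proof (induction g rule: monoid_algebra_induct)
      case (single n d)
      show ?case
        by (simp add: mult_single lin_ext_single is_ring_homD[OF h] mult mult_ac)
    qed (simp_all add: distrib_left lin_ext_add)
  qed (simp_all add: distrib_right lin_ext_add)
qed (simp_all add: lin_ext_add)

end

section \<open>Specialisation of fractions\<close>

text \<open>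
  A substitution \<open>\<psi>\<close> on a ring extends to those fractions, taken in the field to which \<open>\<alpha>\<close> maps the ring,
  that have a denominator not killed by \<open>\<psi>\<close>. Written as a relation, it is
  compatible with the field operations. It serves twice: for \<open>X = 1\<close>, and for real points.
\<close>

definition spec_rel :: "('r \<Rightarrow> 'f::field) \<Rightarrow> ('r \<Rightarrow> 'k::field) \<Rightarrow> 'f \<Rightarrow> 'k \<Rightarrow> bool" where
  "spec_rel \<alpha> \<psi> z c \<longleftrightarrow> (\<exists>f g. \<psi> g \<noteq> 0 \<and> z = \<alpha> f / \<alpha> g \<and> c = \<psi> f / \<psi> g)"

locale specialization =
  fixes \<alpha> :: "'r::comm_ring_1 \<Rightarrow> 'f::field" and \<psi> :: "'r \<Rightarrow> 'k::field"
  assumes \<alpha>: "is_ring_hom \<alpha>" and \<psi>: "is_ring_hom \<psi>" and inj: "\<alpha> f = 0 \<Longrightarrow> f = 0"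
begin

lemma denom_nonzero: "\<psi> g \<noteq> 0 \<Longrightarrow> \<alpha> g \<noteq> 0"
  using inj is_ring_homD(1)[OF \<psi>] by metis

lemma spec_unique:
  assumes "spec_rel \<alpha> \<psi> z c" "spec_rel \<alpha> \<psi> z d"
  shows "c = d"
proof -
  obtain f g where fg: "\<psi> g \<noteq> 0" "z = \<alpha> f / \<alpha> g" "c = \<psi> f / \<psi> g"
    using assms(1) by (auto simp: spec_rel_def)
  obtain f' g' where fg': "\<psi> g' \<noteq> 0" "z = \<alpha> f' / \<alpha> g'" "d = \<psi> f' / \<psi> g'"
    using assms(2) by (auto simp: spec_rel_def)
  have "\<alpha> f / \<alpha> g = \<alpha> f' / \<alpha> g'" using fg fg' by simp
  then have "\<alpha> (f * g' - f' * g) = 0"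
    using denom_nonzero fg fg' by (simp add: is_ring_hom_diff[OF \<alpha>] is_ring_homD(4)[OF \<alpha>] field_simps)
  then have "\<psi> (f * g' - f' * g) = 0"
    using inj is_ring_homD(1)[OF \<psi>] by metis
  then have "\<psi> f * \<psi> g' = \<psi> f' * \<psi> g"
    by (simp add: is_ring_hom_diff[OF \<psi>] is_ring_homD(4)[OF \<psi>])
  then show ?thesis
    using fg(1) fg'(1) by (simp add: fg(3) fg'(3) frac_eq_eq)
qed

lemma spec_base: "spec_rel \<alpha> \<psi> (\<alpha> f) (\<psi> f)"
  unfolding spec_rel_def by (rule exI[of _ f], rule exI[of _ 1]) (simp add: is_ring_homD[OF \<alpha>] is_ring_homD[OF \<psi>])

lemma spec_0: "spec_rel \<alpha> \<psi> 0 0"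
  using spec_base[of 0] by (simp add: is_ring_homD[OF \<alpha>] is_ring_homD[OF \<psi>])

lemma spec_1: "spec_rel \<alpha> \<psi> 1 1"
  using spec_base[of 1] by (simp add: is_ring_homD[OF \<alpha>] is_ring_homD[OF \<psi>])

lemma spec_add:
  assumes "spec_rel \<alpha> \<psi> z c" "spec_rel \<alpha> \<psi> w d"
  shows "spec_rel \<alpha> \<psi> (z + w) (c + d)"
proof -
  obtain f g where fg: "\<psi> g \<noteq> 0" "z = \<alpha> f / \<alpha> g" "c = \<psi> f / \<psi> g"
    using assms(1) by (auto simp: spec_rel_def)
  obtain f' g' where fg': "\<psi> g' \<noteq> 0" "w = \<alpha> f' / \<alpha> g'" "d = \<psi> f' / \<psi> g'"
    using assms(2) by (auto simp: spec_rel_def)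
  have "\<psi> (g * g') \<noteq> 0" using fg fg' by (simp add: is_ring_homD[OF \<psi>])
  moreover have "z + w = \<alpha> (f * g' + f' * g) / \<alpha> (g * g')"
    using fg fg' denom_nonzero by (simp add: is_ring_homD[OF \<alpha>] field_simps)
  moreover have "c + d = \<psi> (f * g' + f' * g) / \<psi> (g * g')"
    using fg fg' by (simp add: is_ring_homD[OF \<psi>] field_simps)
  ultimately show ?thesis unfolding spec_rel_def by blast
qed

lemma spec_mult:
  assumes "spec_rel \<alpha> \<psi> z c" "spec_rel \<alpha> \<psi> w d"
  shows "spec_rel \<alpha> \<psi> (z * w) (c * d)"
proof -
  obtain f g where fg: "\<psi> g \<noteq> 0" "z = \<alpha> f / \<alpha> g" "c = \<psi> f / \<psi> g"
    using assms(1) by (auto simp: spec_rel_def)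
  obtain f' g' where fg': "\<psi> g' \<noteq> 0" "w = \<alpha> f' / \<alpha> g'" "d = \<psi> f' / \<psi> g'"
    using assms(2) by (auto simp: spec_rel_def)
  have "\<psi> (g * g') \<noteq> 0" using fg fg' by (simp add: is_ring_homD[OF \<psi>])
  moreover have "z * w = \<alpha> (f * f') / \<alpha> (g * g')"
    using fg fg' by (simp add: is_ring_homD[OF \<alpha>])
  moreover have "c * d = \<psi> (f * f') / \<psi> (g * g')"
    using fg fg' by (simp add: is_ring_homD[OF \<psi>])
  ultimately show ?thesis unfolding spec_rel_def by blast
qed

lemma spec_inverse:
  assumes "spec_rel \<alpha> \<psi> z c" "c \<noteq> 0"
  shows "spec_rel \<alpha> \<psi> (inverse z) (inverse c)"
proof -
  obtain f g where fg: "\<psi> g \<noteq> 0" "z = \<alpha> f / \<alpha> g" "c = \<psi> f / \<psi> g"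
    using assms(1) by (auto simp: spec_rel_def)
  then show ?thesis unfolding spec_rel_def using assms(2)
    by (intro exI[of _ g] exI[of _ f]) (auto simp: field_simps)
qed

lemma spec_divide:
  assumes "spec_rel \<alpha> \<psi> z c" "spec_rel \<alpha> \<psi> w d" "d \<noteq> 0"
  shows "spec_rel \<alpha> \<psi> (z / w) (c / d)"
  using spec_mult[OF assms(1) spec_inverse[OF assms(2,3)]] by (simp add: divide_inverse)

lemma spec_power: "spec_rel \<alpha> \<psi> z c \<Longrightarrow> spec_rel \<alpha> \<psi> (z ^ n) (c ^ n)"
  by (induction n) (auto intro: spec_1 spec_mult)

lemma spec_powi:
  assumes "spec_rel \<alpha> \<psi> z c" "c \<noteq> 0"
  shows "spec_rel \<alpha> \<psi> (z powi n) (c powi n)"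
  using spec_power[OF assms(1)] spec_power[OF spec_inverse[OF assms]] by (auto simp: power_int_def)

lemma spec_prod:
  assumes "\<And>i. i \<in> A \<Longrightarrow> spec_rel \<alpha> \<psi> (z i) (c i)"
  shows "spec_rel \<alpha> \<psi> (prod z A) (prod c A)"
  using assms by (induction A rule: infinite_finite_induct) (auto intro: spec_1 spec_mult)

end

section \<open>Units and nonzerodivisors in group rings\<close>

lemma lookup_single_mult:
  fixes f :: "'g::ab_group_add \<Rightarrow>\<^sub>0 int"
  shows "Poly_Mapping.lookup (Poly_Mapping.single g k * f) x = k * Poly_Mapping.lookup f (x - g)"
proof (induction f rule: monoid_algebra_induct)
  case (single m c)
  have "(g + m = x) = (m = x - g)" by (auto simp: algebra_simps)
  then show ?case by (simp add: mult_single lookup_single when_def)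
qed (simp_all add: distrib_left lookup_add)

text \<open>
  If \<open>a + b\<close> can be written in only one way as a sum of exponents of \<open>f\<close> and of \<open>g\<close>, no cancellation
  happens there.
\<close>

lemma lookup_mult_unique:
  fixes f g :: "'g::ab_group_add \<Rightarrow>\<^sub>0 int"
  assumes "\<And>a' b'. a' \<in> Poly_Mapping.keys f \<Longrightarrow> b' \<in> Poly_Mapping.keys g \<Longrightarrow> a' + b' = a + b \<Longrightarrow> a' = a"
  shows "Poly_Mapping.lookup (f * g) (a + b) = Poly_Mapping.lookup f a * Poly_Mapping.lookup g b"
proof -
  have "f * g = (\<Sum>m\<in>Poly_Mapping.keys f. Poly_Mapping.single m (Poly_Mapping.lookup f m) * g)"
    by (metis sum_distrib_right sum_of_singles)
  then have "Poly_Mapping.lookup (f * g) (a + b)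
      = (\<Sum>m\<in>Poly_Mapping.keys f. Poly_Mapping.lookup f m * Poly_Mapping.lookup g (a + b - m))"
    by (simp add: lookup_sum lookup_single_mult)
  also have "\<dots> = (\<Sum>m\<in>Poly_Mapping.keys f. if m = a then Poly_Mapping.lookup f a * Poly_Mapping.lookup g b else 0)"
  proof (rule sum.cong)
    fix m assume m: "m \<in> Poly_Mapping.keys f"
    show "Poly_Mapping.lookup f m * Poly_Mapping.lookup g (a + b - m)
       = (if m = a then Poly_Mapping.lookup f a * Poly_Mapping.lookup g b else 0)"
      using assms[OF m, of "a + b - m"] by (auto simp: in_keys_iff)
  qed simp
  also have "\<dots> = Poly_Mapping.lookup f a * Poly_Mapping.lookup g b"
    by (auto simp: in_keys_iff)
  finally show ?thesis .
qed

text \<open>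
  The units of the integral group ring of an ordered group are the monomials with coefficient \<open>\<plusminus>1\<close>:
  the products of the highest terms and of the lowest terms both survive, so in a product with one term
  every factor has just one term.
\<close>

lemma monomial_factors:
  fixes f g :: "'g::linordered_ab_group_add \<Rightarrow>\<^sub>0 int"
  assumes fg: "f * g = Poly_Mapping.single h 1"
  obtains a b c where "f = Poly_Mapping.single a c" "g = Poly_Mapping.single b c"
    "c = 1 \<or> c = -1" "a + b = h"
proof -
  have nz: "f \<noteq> 0" "g \<noteq> 0"
    using fg by (metis mult_zero_left mult_zero_right frag_of_nonzero)+
  let ?F = "Poly_Mapping.keys f" and ?G = "Poly_Mapping.keys g"
  have ne: "?F \<noteq> {}" "?G \<noteq> {}" using nz by auto
  have in_keys: "Poly_Mapping.lookup (f * g) (a + b) = Poly_Mapping.lookup f a * Poly_Mapping.lookup g b"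
      "a + b = h"
    if "a \<in> ?F" "b \<in> ?G" and "(\<forall>a'\<in>?F. a' \<le> a) \<and> (\<forall>b'\<in>?G. b' \<le> b) \<or> (\<forall>a'\<in>?F. a \<le> a') \<and> (\<forall>b'\<in>?G. b \<le> b')" for a b
  proof -
    have u: "a' = a" if "a' \<in> ?F" "b' \<in> ?G" "a' + b' = a + b" for a' b'
      using \<open>_ \<or> _\<close> that
      by (metis add_le_less_mono add_less_le_mono nle_le order_le_less order_less_irrefl)
    show 1: "Poly_Mapping.lookup (f * g) (a + b) = Poly_Mapping.lookup f a * Poly_Mapping.lookup g b"
      by (rule lookup_mult_unique) (rule u)
    have "Poly_Mapping.lookup f a * Poly_Mapping.lookup g b \<noteq> 0" using that(1,2) by (simp add: in_keys_iff)
    then show "a + b = h" using 1 fg by (auto simp: lookup_single when_def split: if_splits)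
  qed
  have M: "Max ?F + Max ?G = h" by (rule in_keys(2)) (use ne in auto)
  have m: "Min ?F + Min ?G = h" by (rule in_keys(2)) (use ne in auto)
  have "Min ?F \<le> Max ?F" "Min ?G \<le> Max ?G" using ne by auto
  then have eq: "Min ?F = Max ?F" "Min ?G = Max ?G" using M m
    by (metis add_le_less_mono add_less_le_mono order_le_less order_less_irrefl)+
  define a b where "a = Max ?F" and "b = Max ?G"
  have "x = a" if "x \<in> ?F" for x
    using Min_le[OF finite_keys that] Max_ge[OF finite_keys that] eq(1) unfolding a_def by simp
  then have "?F = {a}" using ne(1) by blast
  moreover have "x = b" if "x \<in> ?G" for x
    using Min_le[OF finite_keys that] Max_ge[OF finite_keys that] eq(2) unfolding b_def by simp
  then have "?G = {b}" using ne(2) by blast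
  ultimately have fs: "f = Poly_Mapping.single a (Poly_Mapping.lookup f a)" "g = Poly_Mapping.single b (Poly_Mapping.lookup g b)"
    using sum_of_singles[of f] sum_of_singles[of g] by simp_all
  have ab: "a + b = h" using M a_def b_def by simp
  have "Poly_Mapping.lookup f a * Poly_Mapping.lookup g b = 1"
    using in_keys(1)[of a b] ne fg ab unfolding a_def b_def by auto
  then have "Poly_Mapping.lookup f a = Poly_Mapping.lookup g b \<and> (Poly_Mapping.lookup f a = 1 \<or> Poly_Mapping.lookup f a = -1)"
    by (metis pos_zmult_eq_1_iff_lemma zmult_eq_1_iff)
  then show ?thesis using that fs ab by metis
qed

definition graded_part :: "('g \<Rightarrow> int) \<Rightarrow> int \<Rightarrow> ('g \<Rightarrow>\<^sub>0 int) \<Rightarrow> ('g \<Rightarrow>\<^sub>0 int)" where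
  "graded_part \<delta> d = Poly_Mapping.mapp (\<lambda>g c. if \<delta> g = d then c else 0)"

lemma lookup_graded_part:
  "Poly_Mapping.lookup (graded_part \<delta> d f) g = (if \<delta> g = d then Poly_Mapping.lookup f g else 0)"
  by (auto simp: graded_part_def lookup_mapp when_def in_keys_iff)

lemma graded_part_add: "graded_part \<delta> d (f + g) = graded_part \<delta> d f + graded_part \<delta> d g"
  by (rule poly_mapping_eqI) (simp add: lookup_graded_part lookup_add)

lemma graded_part_single_mult:
  fixes f :: "'g::ab_group_add \<Rightarrow>\<^sub>0 int"
  assumes "additive \<delta>"
  shows "graded_part \<delta> d (Poly_Mapping.single g k * f) = Poly_Mapping.single g k * graded_part \<delta> (d - \<delta> g) f"
  by (rule poly_mapping_eqI)
    (auto simp: lookup_graded_part lookup_single_mult additive.diff[OF assms])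

text \<open>
  A binomial with terms of different degree is a nonzerodivisor modulo \<open>1 + z\<^sup>v\<close> if \<open>v\<close> has degree 0.
  Comparing parts of top degree shows that \<open>1 + z\<^sup>v\<close> divides the top part of \<open>a\<close>, as the leading term of
  the binomial is a unit; then induction on the number of degrees that occur in \<open>a\<close>.
\<close>

lemma binomial_regular:
  fixes a b :: "'g::ab_group_add \<Rightarrow>\<^sub>0 int" and \<delta> :: "'g \<Rightarrow> int"
  assumes \<delta>: "additive \<delta>" and v: "\<delta> v = 0" and less: "\<delta> q' < \<delta> q"
    and eq: "(Poly_Mapping.single q 1 + Poly_Mapping.single q' n) * a = (1 + Poly_Mapping.single v 1) * b"
  shows "(1 + Poly_Mapping.single v 1) dvd a"
  using eq
proof (induction "card (\<delta> ` Poly_Mapping.keys a)" arbitrary: a b rule: less_induct)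
  case less': less
  let ?D = "1 + Poly_Mapping.single v 1 :: 'g \<Rightarrow>\<^sub>0 int"
  let ?Q = "Poly_Mapping.single q 1 + Poly_Mapping.single q' n"
  show ?case
  proof (cases "a = 0")
    case False
    define d where "d = Max (\<delta> ` Poly_Mapping.keys a)"
    have ne: "\<delta> ` Poly_Mapping.keys a \<noteq> {}" using False by simp
    define top where "top = graded_part \<delta> d a"
    \<comment> \<open>The lower term of the binomial would need a part of \<open>a\<close> above the top degree.\<close>
    have vanish: "graded_part \<delta> (d + \<delta> q - \<delta> q') a = 0"
    proof (rule poly_mapping_eqI)
      fix g
      have "Poly_Mapping.lookup a g = 0" if "\<delta> g = d + \<delta> q - \<delta> q'"
      proof (rule ccontr)
        assume "Poly_Mapping.lookup a g \<noteq> 0"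
        then have "\<delta> g \<le> d" unfolding d_def by (intro Max_ge) (auto simp: in_keys_iff)
        then show False using that less by simp
      qed
      then show "Poly_Mapping.lookup (graded_part \<delta> (d + \<delta> q - \<delta> q') a) g = Poly_Mapping.lookup 0 g"
        by (simp add: lookup_graded_part)
    qed
    have "graded_part \<delta> (d + \<delta> q) (?Q * a) = Poly_Mapping.single q 1 * top"
      using vanish by (simp add: distrib_right graded_part_add graded_part_single_mult[OF \<delta>] top_def)
    moreover have "graded_part \<delta> (d + \<delta> q) (?D * b) = ?D * graded_part \<delta> (d + \<delta> q) b"
      using v by (simp add: distrib_right graded_part_add graded_part_single_mult[OF \<delta>])
    ultimately have "Poly_Mapping.single q 1 * top = ?D * graded_part \<delta> (d + \<delta> q) b"
      using less'.prems by simp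
    then have "Poly_Mapping.single (-q) 1 * (Poly_Mapping.single q 1 * top)
        = ?D * (Poly_Mapping.single (-q) 1 * graded_part \<delta> (d + \<delta> q) b)"
      by (simp add: mult_ac)
    then have "top = ?D * (Poly_Mapping.single (-q) 1 * graded_part \<delta> (d + \<delta> q) b)"
      by (simp add: mult.assoc[symmetric] mult_single)
    then obtain b' where top: "top = ?D * b'" by blast
    have "?D dvd a - top"
    proof (rule less'.hyps)
      show "?Q * (a - top) = ?D * (b - ?Q * b')"
        using less'.prems top by (simp add: algebra_simps)
      have sub: "\<delta> ` Poly_Mapping.keys (a - top) \<subseteq> \<delta> ` Poly_Mapping.keys a - {d}"
        by (auto simp: in_keys_iff lookup_minus top_def lookup_graded_part split: if_splits)
      have "d \<in> \<delta> ` Poly_Mapping.keys a" unfolding d_def by (rule Max_in) (use ne in auto)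
      then show "card (\<delta> ` Poly_Mapping.keys (a - top)) < card (\<delta> ` Poly_Mapping.keys a)"
        using sub by (intro psubset_card_mono) (simp, blast)
    qed
    then show ?thesis using top by (metis diff_add_cancel dvd_add dvd_triv_left)
  qed simp
qed

section \<open>Laurent expansions in a cluster\<close>

definition laurent_monomial ::
    "('n \<Rightarrow> ('p::semifield, 'n::{finite,linorder}) ambient) \<Rightarrow> 'p \<times> ('n \<Rightarrow>\<^sub>0 int) \<Rightarrow> ('p, 'n) ambient" where
  "laurent_monomial X g = P_elem (fst g) * (\<Prod>i\<in>UNIV. X i powi Poly_Mapping.lookup (snd g) i)"

definition laurent ::
    "('n \<Rightarrow> ('p::semifield, 'n::{finite,linorder}) ambient) \<Rightarrow> (('p \<times> ('n \<Rightarrow>\<^sub>0 int)) \<Rightarrow>\<^sub>0 int) \<Rightarrow> ('p, 'n) ambient" where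
  "laurent X = lin_ext of_int (laurent_monomial X)"

lemma is_ring_hom_scalar: "is_ring_hom scalar"
  unfolding is_ring_hom_def scalar_def
  by (auto simp: single_add mult_single simp flip: to_fract_add to_fract_mult)

lemma is_ring_hom_to_fract: "is_ring_hom to_fract"
  by (simp add: is_ring_hom_def)

lemma QP_of_0 [simp]: "QP_of 0 = 1" and QP_of_add: "QP_of (p + q) = QP_of p * QP_of q"
  by (simp_all add: QP_of_def mult_single flip: to_fract_mult)

lemma to_fract_single: "to_fract (Poly_Mapping.single q c) = of_int c * QP_of q"
  for q :: "'p::semifield"
proof -
  have "to_fract (Poly_Mapping.single q c) = to_fract (of_int c * Poly_Mapping.single q 1)"
    using mult_single[of 0 c q 1] single_of_int[of c, where ?'b = int, where ?'a = 'p] by simp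
  also have "\<dots> = of_int c * QP_of q"
    by (simp only: to_fract_mult is_ring_hom_commutes_of_int[OF is_ring_hom_to_fract] QP_of_def)
  finally show ?thesis .
qed

lemma P_elem_0 [simp]: "P_elem 0 = 1" and P_elem_add: "P_elem (p + q) = P_elem p * P_elem q"
  by (simp_all add: P_elem_def QP_of_add is_ring_homD[OF is_ring_hom_scalar])

lemma P_elem_uminus_mult: "P_elem p * P_elem (- p) = 1"
  by (simp flip: P_elem_add)

lemma P_elem_nonzero [simp]: "P_elem p \<noteq> 0"
  by (metis P_elem_uminus_mult mult_zero_left zero_neq_one)

lemma P_elem_uminus: "P_elem (- p) = inverse (P_elem p)"
  by (rule inverse_unique[symmetric]) (rule P_elem_uminus_mult)

lemma free_generating_nonzero:
  fixes X :: "'n \<Rightarrow> ('p::semifield, 'n::{finite,linorder}) ambient"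
  assumes "free_generating X"
  shows "X i \<noteq> 0"
proof
  assume "X i = 0"
  let ?m = "Poly_Mapping.single i (1::nat)"
  have "(\<Prod>j\<in>UNIV. X j ^ Poly_Mapping.lookup ?m j) = 0"
    using \<open>X i = 0\<close> by (intro prod_zero) (auto intro!: bexI[of _ i])
  then have "poly_eval scalar X (Poly_Mapping.single ?m 1) = 0"
    by (simp add: poly_eval_def)
  then have "Poly_Mapping.single ?m (1 :: 'p QP) = 0" using assms by (auto simp: free_generating_def)
  then show False by (metis lookup_single_eq lookup_zero zero_neq_one)
qed

lemma poly_eval_eq_lin_ext:
  "poly_eval h x = lin_ext h (\<lambda>m. \<Prod>i\<in>UNIV. x i ^ Poly_Mapping.lookup m i)"
  by (simp add: fun_eq_iff poly_eval_def lin_ext_def)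

lemma poly_eval_is_ring_hom: "is_ring_hom h \<Longrightarrow> is_ring_hom (poly_eval h x)"
  unfolding poly_eval_eq_lin_ext
  by (rule lin_ext_is_ring_hom) (auto simp: lookup_add power_add prod.distrib)

lemma laurent_monomial_0 [simp]: "laurent_monomial X 0 = 1"
  by (simp add: laurent_monomial_def)

lemma laurent_monomial_add:
  assumes "\<And>i. X i \<noteq> 0"
  shows "laurent_monomial X (g + h) = laurent_monomial X g * laurent_monomial X h"
  using assms by (simp add: laurent_monomial_def P_elem_add lookup_add power_int_add prod.distrib mult_ac)

lemma laurent_monomial_nonzero [simp]:
  assumes "\<And>i. X i \<noteq> 0"
  shows "laurent_monomial X g \<noteq> 0"
  using assms by (simp add: laurent_monomial_def)

lemma laurent_monomial_uminus:
  assumes "\<And>i. X i \<noteq> 0"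
  shows "laurent_monomial X (- g) = inverse (laurent_monomial X g)"
  using laurent_monomial_add[of X g "-g", OF assms] by (simp add: inverse_unique)

lemma laurent_is_ring_hom: "(\<And>i. X i \<noteq> 0) \<Longrightarrow> is_ring_hom (laurent X)"
  unfolding laurent_def
  by (rule lin_ext_is_ring_hom) (auto simp: is_ring_hom_of_int laurent_monomial_add)

lemma laurent_single: "laurent X (Poly_Mapping.single g c) = of_int c * laurent_monomial X g"
  by (simp add: laurent_def lin_ext_single is_ring_hom_of_int)

text \<open>
  Algebraic independence of \<open>X\<close> concerns polynomials over the fraction field of the group ring of \<open>\<P>\<close>,
  whereas \<open>f\<close> combines the exponents of \<open>X\<close> with elements of \<open>\<P>\<close>. Multiplying by a power of
  \<open>\<Prod> x\<^sub>i\<close> clears the denominators, and the terms with the same exponent of \<open>X\<close> are collected into one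
  coefficient.
\<close>

lemma laurent_inj:
  fixes X :: "'n \<Rightarrow> ('p::semifield, 'n::{finite,linorder}) ambient"
  assumes free: "free_generating X" and zero: "laurent X f = 0"
  shows "f = 0"
proof (rule poly_mapping_eqI)
  fix g0
  let ?K = "Poly_Mapping.keys f"
  have nz: "X i \<noteq> 0" for i using free by (rule free_generating_nonzero)
  obtain N :: nat where N: "0 \<le> Poly_Mapping.lookup (snd g) i + int N" if "g \<in> ?K" for g i
  proof
    fix g i assume g: "g \<in> ?K"
    let ?e = "\<lambda>(g, i). nat (- Poly_Mapping.lookup (snd g) i)"
    have "?e (g, i) \<le> Max (?e ` (?K \<times> UNIV))" using g by (intro Max_ge) auto
    then show "0 \<le> Poly_Mapping.lookup (snd g) i + int (Max (?e ` (?K \<times> UNIV)))" by simp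
  qed
  \<comment> \<open>Nonnegative on the exponents of \<open>f\<close> by the choice of \<open>N\<close>; the truncation elsewhere is harmless.\<close>
  define shift where "shift m = Poly_Mapping.Abs_poly_mapping (\<lambda>i. nat (Poly_Mapping.lookup m i + int N))"
    for m :: "'n \<Rightarrow>\<^sub>0 int"
  have lookup_shift: "Poly_Mapping.lookup (shift m) i = nat (Poly_Mapping.lookup m i + int N)" for m i
    by (simp add: shift_def)
  have shift_inj: "snd g = snd g'" if "g \<in> ?K" "g' \<in> ?K" "shift (snd g) = shift (snd g')" for g g'
  proof (rule poly_mapping_eqI)
    fix i
    show "Poly_Mapping.lookup (snd g) i = Poly_Mapping.lookup (snd g') i"
      using N[OF that(1), of i] N[OF that(2), of i] lookup_shift[of "snd g" i] lookup_shift[of "snd g'" i] that(3)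
      by simp
  qed
  define p where "p = (\<Sum>g\<in>?K. Poly_Mapping.single (shift (snd g)) (of_int (Poly_Mapping.lookup f g) * QP_of (fst g)))"
  have "poly_eval scalar X p = (\<Sum>g\<in>?K. scalar (of_int (Poly_Mapping.lookup f g) * QP_of (fst g))
          * (\<Prod>i\<in>UNIV. X i ^ Poly_Mapping.lookup (shift (snd g)) i))"
    by (simp add: p_def poly_eval_eq_lin_ext lin_ext_sum lin_ext_single is_ring_hom_scalar)
  also have "\<dots> = (\<Sum>g\<in>?K. (of_int (Poly_Mapping.lookup f g) * laurent_monomial X g) * (\<Prod>i\<in>UNIV. X i ^ N))"
  proof (rule sum.cong)
    fix g assume g: "g \<in> ?K"
    have "X i ^ Poly_Mapping.lookup (shift (snd g)) i = X i powi Poly_Mapping.lookup (snd g) i * X i ^ N" for i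
      using N[OF g, of i] nz[of i]
      by (simp add: lookup_shift power_int_nonneg_exp[symmetric] power_int_add)
    moreover have "scalar (of_int c) = (of_int c :: ('p, 'n) ambient)" for c
      by (rule is_ring_hom_commutes_of_int[OF is_ring_hom_scalar])
    ultimately show "scalar (of_int (Poly_Mapping.lookup f g) * QP_of (fst g))
          * (\<Prod>i\<in>UNIV. X i ^ Poly_Mapping.lookup (shift (snd g)) i)
        = (of_int (Poly_Mapping.lookup f g) * laurent_monomial X g) * (\<Prod>i\<in>UNIV. X i ^ N)"
      by (simp add: is_ring_homD[OF is_ring_hom_scalar] prod.distrib laurent_monomial_def P_elem_def)
  qed simp
  also have "\<dots> = laurent X f * (\<Prod>i\<in>UNIV. X i ^ N)"
    by (simp add: laurent_def lin_ext_def sum_distrib_right)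
  finally have "poly_eval scalar X p = 0" using zero by simp
  then have p0: "p = 0" using free by (simp add: free_generating_def)
  show "Poly_Mapping.lookup f g0 = Poly_Mapping.lookup 0 g0"
  proof (rule ccontr)
    assume "\<not> ?thesis"
    then have g0: "g0 \<in> ?K" by (simp add: in_keys_iff)
    let ?J = "{g \<in> ?K. snd g = snd g0}"
    define r where "r = (\<Sum>g\<in>?J. Poly_Mapping.single (fst g) (Poly_Mapping.lookup f g))"
    have "0 = Poly_Mapping.lookup p (shift (snd g0))" using p0 by simp
    also have "\<dots> = (\<Sum>g\<in>?K. if shift (snd g) = shift (snd g0) then of_int (Poly_Mapping.lookup f g) * QP_of (fst g) else 0)"
      unfolding p_def lookup_sum by (intro sum.cong) (simp_all only: lookup_single when_def)
    also have "\<dots> = (\<Sum>g\<in>?J. of_int (Poly_Mapping.lookup f g) * QP_of (fst g))"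
    proof (rule sum.mono_neutral_cong_right)
      show "\<forall>g\<in>?K - ?J. (if shift (snd g) = shift (snd g0) then of_int (Poly_Mapping.lookup f g) * QP_of (fst g) else 0) = 0"
        using shift_inj[OF _ g0] by auto
    qed auto
    also have "\<dots> = to_fract r"
    proof -
      show ?thesis by (simp only: r_def to_fract_sum to_fract_single)
    qed
    finally have "to_fract r = 0" by (rule sym)
    then have "r = 0" by (simp only: to_fract_eq_0_iff)
    then have "0 = Poly_Mapping.lookup r (fst g0)" by simp
    also have "\<dots> = (\<Sum>g\<in>?J. if g = g0 then Poly_Mapping.lookup f g0 else 0)"
      unfolding r_def lookup_sum
    proof (rule sum.cong)
      fix g assume "g \<in> ?J"
      then have "fst g = fst g0 \<longleftrightarrow> g = g0" by (auto intro: prod_eqI)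
      then show "Poly_Mapping.lookup (Poly_Mapping.single (fst g) (Poly_Mapping.lookup f g)) (fst g0)
          = (if g = g0 then Poly_Mapping.lookup f g0 else 0)"
        by (auto simp: lookup_single)
    qed (rule refl)
    also have "\<dots> = Poly_Mapping.lookup f g0" using g0 by (subst sum.delta) auto
    finally show False using g0 by (simp add: in_keys_iff)
  qed
qed

text \<open>
  The coefficients are taken from the group ring of \<open>\<P>\<close>, not from its field of fractions: otherwise
  an exchange binomial with a zero column of \<open>B\<close> would be a unit.
\<close>

definition laurent_ring :: "('n \<Rightarrow> ('p::semifield, 'n::{finite,linorder}) ambient) \<Rightarrow> ('p, 'n) ambient set" where
  "laurent_ring X = range (laurent X)"

context
  fixes X :: "'n \<Rightarrow> ('p::semifield, 'n::{finite,linorder}) ambient"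
  assumes nonzero: "\<And>i. X i \<noteq> 0"
begin

lemmas laurent_hom = laurent_is_ring_hom[of X, OF nonzero]

lemma laurent_ring_add: "a \<in> laurent_ring X \<Longrightarrow> b \<in> laurent_ring X \<Longrightarrow> a + b \<in> laurent_ring X"
  by (auto simp: laurent_ring_def simp flip: is_ring_homD[OF laurent_hom])

lemma laurent_ring_mult: "a \<in> laurent_ring X \<Longrightarrow> b \<in> laurent_ring X \<Longrightarrow> a * b \<in> laurent_ring X"
  by (auto simp: laurent_ring_def simp flip: is_ring_homD[OF laurent_hom])

lemma laurent_ring_minus: "a \<in> laurent_ring X \<Longrightarrow> - a \<in> laurent_ring X"
  by (auto simp: laurent_ring_def simp flip: is_ring_hom_minus[OF laurent_hom])

lemma laurent_ring_diff: "a \<in> laurent_ring X \<Longrightarrow> b \<in> laurent_ring X \<Longrightarrow> a - b \<in> laurent_ring X"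
  by (auto simp: laurent_ring_def simp flip: is_ring_hom_diff[OF laurent_hom])

lemma laurent_monomial_in_ring: "laurent_monomial X g \<in> laurent_ring X"
  unfolding laurent_ring_def using laurent_single[of X g 1] by (metis mult_1 of_int_1 rangeI)

lemma laurent_ring_0: "0 \<in> laurent_ring X"
  unfolding laurent_ring_def using is_ring_homD(1)[OF laurent_hom] by (metis rangeI)

lemma laurent_ring_1: "1 \<in> laurent_ring X"
  using laurent_monomial_in_ring[of 0] by simp

lemma laurent_ring_power: "a \<in> laurent_ring X \<Longrightarrow> a ^ n \<in> laurent_ring X"
  by (induction n) (auto intro: laurent_ring_1 laurent_ring_mult)

lemma laurent_ring_prod: "(\<And>i. i \<in> A \<Longrightarrow> f i \<in> laurent_ring X) \<Longrightarrow> prod f A \<in> laurent_ring X"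
  by (induction A rule: infinite_finite_induct) (auto intro: laurent_ring_1 laurent_ring_mult)

lemma laurent_ring_P_elem: "P_elem p \<in> laurent_ring X"
  using laurent_monomial_in_ring[of "(p, 0)"] by (simp add: laurent_monomial_def)

lemma laurent_monomial_var: "laurent_monomial X (0, Poly_Mapping.single i m) = X i powi m"
proof -
  have "(\<Prod>j\<in>UNIV. X j powi Poly_Mapping.lookup (Poly_Mapping.single i m) j)
     = (\<Prod>j\<in>UNIV. if j = i then X i powi m else 1)"
    by (intro prod.cong) (auto simp: lookup_single when_def)
  then show ?thesis by (simp add: laurent_monomial_def)
qed

lemma laurent_ring_powi: "X i powi m \<in> laurent_ring X"
  using laurent_monomial_in_ring[of "(0, Poly_Mapping.single i m)"] by (simp add: laurent_monomial_var)

lemma laurent_ring_var: "X i \<in> laurent_ring X" and laurent_ring_inverse_var: "inverse (X i) \<in> laurent_ring X"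
  using laurent_ring_powi[of i 1] laurent_ring_powi[of i "-1"] by (simp_all add: power_int_minus)

lemma laurent_ring_of_int: "of_int c \<in> laurent_ring X"
  unfolding laurent_ring_def using is_ring_hom_commutes_of_int[OF laurent_hom] by (metis rangeI)

lemmas laurent_ring_intros = laurent_ring_add laurent_ring_mult laurent_ring_minus laurent_ring_diff
  laurent_ring_0 laurent_ring_1 laurent_ring_power laurent_ring_prod
  laurent_ring_P_elem laurent_ring_powi laurent_ring_var laurent_ring_inverse_var laurent_ring_of_int
  laurent_monomial_in_ring

lemma laurent_ring_induct [consumes 1, case_names add mult neg P_elem var inverse_var]:
  assumes "e \<in> laurent_ring X"
    and add: "\<And>a b. Q a \<Longrightarrow> Q b \<Longrightarrow> Q (a + b)" and mult: "\<And>a b. Q a \<Longrightarrow> Q b \<Longrightarrow> Q (a * b)"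
    and neg: "Q (-1)" and P_elem: "\<And>p. Q (P_elem p)"
    and var: "\<And>i. Q (X i)" and inv: "\<And>i. Q (inverse (X i))"
  shows "Q e"
proof -
  have one: "Q 1" using P_elem[of 0] by simp
  have zero: "Q 0" using add[OF one neg] by simp
  have pow: "Q (a ^ n)" if "Q a" for a n using that by (induction n) (auto intro: one mult)
  have powi: "Q (X i powi n)" for i n
    unfolding power_int_def by (auto intro: pow var inv)
  have mono: "Q (laurent_monomial X g)" for g
  proof -
    have "Q (\<Prod>i\<in>A. X i powi Poly_Mapping.lookup (snd g) i)" for A
      by (induction A rule: infinite_finite_induct) (auto intro: one mult powi)
    then show ?thesis unfolding laurent_monomial_def by (intro mult P_elem)
  qed
  have int: "Q (of_int c)" for c
    by (induction c rule: int_induct[where k = 0]) (auto intro: zero add one neg simp: diff_conv_add_uminus simp del: add_uminus_conv_diff)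
  obtain f where "e = laurent X f" using assms(1) by (auto simp: laurent_ring_def)
  moreover have "Q (laurent X f)" for f
  proof (induction f rule: monoid_algebra_induct)
    case (single g c)
    show ?case by (simp add: laurent_single mult int mono)
  qed (auto simp: is_ring_homD[OF laurent_hom] zero intro: add)
  ultimately show ?thesis by simp
qed

end

section \<open>Denominators and nonzerodivisors\<close>

text \<open>
  If \<open>Q\<close> clears the denominator of each generator of one Laurent ring, a power of \<open>Q\<close> clears that of
  any of its elements.
\<close>

lemma laurent_ring_localization:
  fixes X Z :: "'n \<Rightarrow> ('p::semifield, 'n::{finite,linorder}) ambient"
  assumes X: "\<And>i. X i \<noteq> 0" and Z: "\<And>i. Z i \<noteq> 0" and Q: "Q \<in> laurent_ring Z"
    and var: "\<And>i. X i \<in> laurent_ring Z" and inv: "\<And>i. inverse (X i) * Q \<in> laurent_ring Z"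
    and e: "e \<in> laurent_ring X"
  obtains N where "e * Q ^ N \<in> laurent_ring Z"
proof -
  note intros = laurent_ring_intros[of Z, OF Z] Q
  have mem: "a \<in> laurent_ring Z \<Longrightarrow> \<exists>N. a * Q ^ N \<in> laurent_ring Z" for a
    by (intro exI[of _ 0]) simp
  have "\<exists>N. e * Q ^ N \<in> laurent_ring Z"
    using X e
  proof (induction e rule: laurent_ring_induct[consumes 2, case_names add mult neg P_elem var inverse_var])
    case (add a b)
    then obtain N M where N: "a * Q ^ N \<in> laurent_ring Z" and M: "b * Q ^ M \<in> laurent_ring Z" by blast
    have "(a * Q ^ N) * Q ^ M + (b * Q ^ M) * Q ^ N \<in> laurent_ring Z"
      by (intro intros N M)
    then have "(a + b) * Q ^ (N + M) \<in> laurent_ring Z" by (simp add: power_add algebra_simps)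
    then show ?case by blast
  next
    case (mult a b)
    then obtain N M where N: "a * Q ^ N \<in> laurent_ring Z" and M: "b * Q ^ M \<in> laurent_ring Z" by blast
    have "(a * Q ^ N) * (b * Q ^ M) \<in> laurent_ring Z"
      by (intro intros N M)
    then have "(a * b) * Q ^ (N + M) \<in> laurent_ring Z" by (simp add: power_add mult_ac)
    then show ?case by blast
  next
    case (inverse_var i)
    show ?case using inv[of i] by (intro exI[of _ 1]) simp
  qed (auto intro!: mem intro: intros var)
  then show ?thesis using that by blast
qed

definition regular_mod :: "'a::comm_ring_1 set \<Rightarrow> 'a \<Rightarrow> 'a \<Rightarrow> bool" where
  "regular_mod L P Q \<longleftrightarrow> (\<forall>a\<in>L. \<forall>b\<in>L. Q * a = P * b \<longrightarrow> (\<exists>c\<in>L. a = P * c))"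

text \<open>
  A fraction with denominators \<open>P\<^sup>N\<close> and \<open>Q\<^sup>M\<close> has none if \<open>Q\<close> is a nonzerodivisor modulo \<open>P\<close>. So
  nonzerodivisors play the part that coprime elements have in a factorial ring.
\<close>

lemma coprime_denominators:
  fixes Z :: "'n \<Rightarrow> ('p::semifield, 'n::{finite,linorder}) ambient"
  assumes Z: "\<And>i. Z i \<noteq> 0" and P: "P \<in> laurent_ring Z" "P \<noteq> 0" and Q: "Q \<in> laurent_ring Z"
    and reg: "regular_mod (laurent_ring Z) P Q"
    and eP: "e * P ^ N \<in> laurent_ring Z" and eQ: "e * Q ^ M \<in> laurent_ring Z"
  shows "e \<in> laurent_ring Z"
proof -
  note intros = laurent_ring_intros[of Z, OF Z] P Q
  have reg_power: "\<exists>c\<in>laurent_ring Z. a = P * c"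
    if "a \<in> laurent_ring Z" "b \<in> laurent_ring Z" "Q ^ M * a = P * b" for M a b
    using that
  proof (induction M arbitrary: a b)
    case (Suc M)
    have "Q * (Q ^ M * a) = P * b" using Suc.prems(3) by (simp add: mult_ac)
    moreover have "Q ^ M * a \<in> laurent_ring Z" by (intro intros Suc.prems)
    ultimately obtain c where "c \<in> laurent_ring Z" "Q ^ M * a = P * c"
      using reg Suc.prems(2) unfolding regular_mod_def by blast
    then show ?case using Suc.IH Suc.prems(1) by blast
  qed auto
  show ?thesis using eP eQ
  proof (induction N arbitrary: e)
    case (Suc N)
    have "(e * P) * Q ^ M = P * (e * Q ^ M)" by (simp add: mult_ac)
    also have "\<dots> \<in> laurent_ring Z" by (intro intros Suc.prems)
    finally have "e * P \<in> laurent_ring Z"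
      using Suc.IH[of "e * P"] Suc.prems(1) by (simp add: mult_ac)
    moreover have "Q ^ M * (e * P) = P * (e * Q ^ M)" by (simp add: mult_ac)
    ultimately obtain c where "c \<in> laurent_ring Z" "e * P = P * c"
      using reg_power Suc.prems(2) by blast
    then show ?case using P(2) by simp
  qed simp
qed

lemma regular_mod_mult:
  fixes Z :: "'n \<Rightarrow> ('p::semifield, 'n::{finite,linorder}) ambient"
  assumes Z: "\<And>i. Z i \<noteq> 0" and "Q' \<in> laurent_ring Z"
    and "regular_mod (laurent_ring Z) P Q" "regular_mod (laurent_ring Z) P Q'"
  shows "regular_mod (laurent_ring Z) P (Q * Q')"
  using assms(2-4) laurent_ring_mult[of Z, OF Z] unfolding regular_mod_def by (metis mult.assoc)

lemma regular_mod_add_multiple: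
  fixes Z :: "'n \<Rightarrow> ('p::semifield, 'n::{finite,linorder}) ambient"
  assumes Z: "\<And>i. Z i \<noteq> 0" and "d \<in> laurent_ring Z" and reg: "regular_mod (laurent_ring Z) P Q"
  shows "regular_mod (laurent_ring Z) P (Q + P * d)"
  unfolding regular_mod_def
proof (intro ballI impI)
  fix a b assume ab: "a \<in> laurent_ring Z" "b \<in> laurent_ring Z" and "(Q + P * d) * a = P * b"
  then have "Q * a = P * (b - d * a)" by (simp add: algebra_simps)
  moreover have "b - d * a \<in> laurent_ring Z" by (intro laurent_ring_intros[of Z, OF Z] ab assms)
  ultimately show "\<exists>c\<in>laurent_ring Z. a = P * c" using reg ab unfolding regular_mod_def by blast
qed

lemma regular_mod_unit:
  fixes Z :: "'n \<Rightarrow> ('p::semifield, 'n::{finite,linorder}) ambient"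
  assumes Z: "\<And>i. Z i \<noteq> 0"
  shows "regular_mod (laurent_ring Z) P (laurent_monomial Z g)"
  unfolding regular_mod_def
proof (intro ballI impI)
  fix a b assume ab: "a \<in> laurent_ring Z" "b \<in> laurent_ring Z" and "laurent_monomial Z g * a = P * b"
  then have "a = P * (laurent_monomial Z (-g) * b)"
    using Z by (simp add: laurent_monomial_uminus[of Z, OF Z] field_simps laurent_monomial_nonzero[of Z, OF Z])
  then show "\<exists>c\<in>laurent_ring Z. a = P * c"
    using laurent_ring_mult[of Z, OF Z laurent_monomial_in_ring[of Z, OF Z] ab(2)] by blast
qed

lemma regular_mod_binomial:
  fixes Z :: "'n \<Rightarrow> ('p::semifield, 'n::{finite,linorder}) ambient"
    and \<delta> :: "'p \<times> ('n \<Rightarrow>\<^sub>0 int) \<Rightarrow> int"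
  assumes free: "free_generating Z" and \<delta>: "additive \<delta>" and v: "\<delta> v = 0" and less: "\<delta> q' < \<delta> q"
  shows "regular_mod (laurent_ring Z) (1 + laurent_monomial Z v) (laurent_monomial Z q + of_int n * laurent_monomial Z q')"
  unfolding regular_mod_def
proof (intro ballI impI)
  have Z: "\<And>i. Z i \<noteq> 0" using free_generating_nonzero[OF free] .
  note hom = laurent_is_ring_hom[of Z, OF Z]
  fix a b assume "a \<in> laurent_ring Z" "b \<in> laurent_ring Z"
    and eq: "(laurent_monomial Z q + of_int n * laurent_monomial Z q') * a = (1 + laurent_monomial Z v) * b"
  then obtain f g where f: "a = laurent Z f" and g: "b = laurent Z g" by (auto simp: laurent_ring_def)
  let ?Q = "Poly_Mapping.single q 1 + Poly_Mapping.single q' n" and ?D = "1 + Poly_Mapping.single v (1::int)"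
  have "laurent Z (?Q * f - ?D * g) = 0"
    using eq by (simp add: is_ring_hom_diff[OF hom] is_ring_homD[OF hom] laurent_single f g del: single_one)
  then have "?Q * f = ?D * g" using laurent_inj[OF free] by (metis eq_iff_diff_eq_0)
  then have "?D dvd f" by (rule binomial_regular[OF \<delta> v less])
  then obtain c where "f = ?D * c" by (rule dvdE)
  then have "a = (1 + laurent_monomial Z v) * laurent Z c"
    by (simp add: is_ring_homD[OF hom] laurent_single f)
  then show "\<exists>c\<in>laurent_ring Z. a = (1 + laurent_monomial Z v) * c"
    by (auto simp: laurent_ring_def)
qed

section \<open>Mutation of the exchange monomials\<close>

lemma is_seed_nonzero: "is_seed S \<Longrightarrow> cluster S i \<noteq> 0"
  by (simp add: is_seed_def free_generating_nonzero)

lemma is_seed_sss: "is_seed S \<Longrightarrow> sign_skew_symmetric (exchange_matrix S)"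
  unfolding is_seed_def totally_sign_skew_symmetric_def by (metis fold_simps(1))

lemma prod_power_int:
  fixes f :: "'i \<Rightarrow> 'a::field"
  shows "prod f A powi n = (\<Prod>i\<in>A. f i powi n)"
  by (induction A rule: infinite_finite_induct) (auto simp: power_int_mult_distrib)

lemma power_nat_pos_part:
  fixes x :: "'a::field" and z :: int
  shows "x ^ nat (pos_part z) = x powi pos_part z"
  by (simp add: pos_part_def power_int_def)

lemma P_elem_gpow:
  fixes a :: "'p::semifield"
  shows "P_elem (gpow a m) = (P_elem a powi m :: ('p, 'n::{finite,linorder}) ambient)"
proof -
  have "P_elem (((+) a ^^ n) 0) = (P_elem a ^ n :: ('p, 'n) ambient)" for n
    by (induction n) (auto simp: P_elem_add)
  then show ?thesis by (simp add: gpow_def power_int_def P_elem_uminus power_inverse)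
qed

text \<open>
  The quotient of the two terms of the exchange relation in direction \<open>j\<close>.
\<close>

definition yhat :: "('p::semifield, 'n::{finite,linorder}) seed \<Rightarrow> 'n \<Rightarrow> ('p, 'n) ambient" where
  "yhat S j = P_elem (coeffs S j) * (\<Prod>i\<in>UNIV. cluster S i powi (exchange_matrix S $ i $ j))"

definition yhat_exponent :: "('p::semifield, 'n::{finite,linorder}) seed \<Rightarrow> 'n \<Rightarrow> 'p \<times> ('n \<Rightarrow>\<^sub>0 int)" where
  "yhat_exponent S j = (coeffs S j, Poly_Mapping.Abs_poly_mapping (\<lambda>i. exchange_matrix S $ i $ j))"

lemma snd_yhat_exponent [simp]: "Poly_Mapping.lookup (snd (yhat_exponent S j)) i = exchange_matrix S $ i $ j"
  by (simp add: yhat_exponent_def)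

lemma yhat_eq_monomial: "yhat S j = laurent_monomial (cluster S) (yhat_exponent S j)"
  by (simp add: yhat_def laurent_monomial_def) (simp add: yhat_exponent_def)

lemma cluster_seed_mutation_other: "i \<noteq> k \<Longrightarrow> cluster (seed_mutation k S) i = cluster S i"
  by (simp add: seed_mutation_def cluster_mutation_def Let_def)

lemma exchange_matrix_seed_mutation [simp]:
  "exchange_matrix (seed_mutation k S) = matrix_mutation k (exchange_matrix S)"
  by (simp add: seed_mutation_def)

lemma sign_skew_symmetric_diag: "sign_skew_symmetric B \<Longrightarrow> B $ i $ i = 0"
  unfolding sign_skew_symmetric_def by (metis not_square_less_zero)

lemma cluster_seed_mutation_binomial:
  "cluster (seed_mutation k S) k =
     (P_elem (coeffs S k) * (\<Prod>i\<in>UNIV. cluster S i powi pos_part (exchange_matrix S $ i $ k))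
       + (\<Prod>i\<in>UNIV. cluster S i powi pos_part (- exchange_matrix S $ i $ k)))
     / (P_elem (coeffs S k \<oplus> 0) * cluster S k)"
  by (simp add: seed_mutation_def cluster_mutation_def Let_def power_nat_pos_part)

context
  fixes S :: "('p::semifield, 'n::{finite,linorder}) seed"
  assumes nonzero: "\<And>i. cluster S i \<noteq> 0" and sss: "sign_skew_symmetric (exchange_matrix S)"
begin

lemma yhat_nonzero: "yhat S j \<noteq> 0"
  using nonzero by (simp add: yhat_def)

lemma cluster_seed_mutation_yhat:
  "cluster (seed_mutation k S) k =
     (1 + yhat S k) * (\<Prod>i\<in>UNIV. cluster S i powi pos_part (- exchange_matrix S $ i $ k))
     / (P_elem (coeffs S k \<oplus> 0) * cluster S k)"
proof -
  have "cluster S i powi (exchange_matrix S $ i $ k) * cluster S i powi pos_part (- exchange_matrix S $ i $ k)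
     = cluster S i powi pos_part (exchange_matrix S $ i $ k)" for i
    using nonzero[of i] by (subst power_int_add[symmetric]) (auto simp: pos_part_def max_def)
  then show ?thesis
    unfolding cluster_seed_mutation_binomial yhat_def
    by (simp add: distrib_right mult.assoc flip: prod.distrib)
qed

lemma yhat_seed_mutation_self: "yhat (seed_mutation k S) k = inverse (yhat S k)"
proof -
  let ?B = "exchange_matrix S"
  have "(\<Prod>i\<in>UNIV. cluster (seed_mutation k S) i powi (matrix_mutation k ?B $ i $ k))
     = (\<Prod>i\<in>UNIV. inverse (cluster S i powi (?B $ i $ k)))"
  proof (rule prod.cong)
    fix i
    show "cluster (seed_mutation k S) i powi (matrix_mutation k ?B $ i $ k) = inverse (cluster S i powi (?B $ i $ k))"
      using sign_skew_symmetric_diag[OF sss, of k]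
      by (cases "i = k") (auto simp: matrix_mutation_def cluster_seed_mutation_other power_int_minus)
  qed simp
  moreover have "coeffs (seed_mutation k S) k = - coeffs S k"
    by (simp add: seed_mutation_def coeffs_mutation_def Let_def)
  ultimately show ?thesis
    by (simp add: yhat_def P_elem_uminus prod_inversef[unfolded comp_def])
qed

text \<open>
  In the \<open>yhat\<close> the semifield addition disappears: the factor \<open>y\<^sub>k \<oplus> 1\<close> in the mutation of \<open>y\<^sub>j\<close> cancels against the
  denominator of \<open>x\<^sub>k'\<close>, and they mutate as coefficients in a field would. The exponent of each
  \<open>x\<^sub>i\<close> agrees by the identity \<open>sgn a [a c]\<^sub>+ - c [-a]\<^sub>+ = a [c]\<^sub>+\<close>.
\<close>

lemma yhat_seed_mutation_other:
  assumes jk: "j \<noteq> k"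
  shows "yhat (seed_mutation k S) j = yhat S j * yhat S k powi pos_part (exchange_matrix S $ k $ j)
     * (1 + yhat S k) powi (- (exchange_matrix S $ k $ j))"
proof -
  let ?B = "exchange_matrix S" and ?X = "cluster S" and ?X' = "cluster (seed_mutation k S)"
  let ?c = "?B $ k $ j" and ?E = "P_elem (coeffs S k \<oplus> 0) :: ('p, 'n) ambient"
  let ?B' = "matrix_mutation k ?B"
  let ?K = "UNIV - {k}"
  have diag: "?B $ k $ k = 0" using sign_skew_symmetric_diag[OF sss] .
  have split: "prod f UNIV = f k * prod f ?K" for f :: "'n \<Rightarrow> ('p, 'n) ambient"
    by (rule prod.remove) auto
  have X'k: "?X' k = (1 + yhat S k) * (\<Prod>i\<in>?K. ?X i powi pos_part (- ?B $ i $ k)) / (?E * ?X k)"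
    using diag by (simp add: cluster_seed_mutation_yhat split pos_part_def)
  have X'k_pow: "?X' k powi (- ?c) = (1 + yhat S k) powi (- ?c) * (\<Prod>i\<in>?K. ?X i powi (- ?c * pos_part (- ?B $ i $ k)))
       * ?E powi ?c * ?X k powi ?c"
    unfolding X'k power_int_divide_distrib power_int_mult_distrib prod_power_int
    by (simp add: power_int_minus divide_inverse mult.commute flip: power_int_mult)
  have exps: "?X i powi (- ?c * pos_part (- ?B $ i $ k)) * ?X i powi (?B' $ i $ j)
     = ?X i powi (?B $ i $ j) * (?X i powi (?B $ i $ k)) powi pos_part ?c" if "i \<in> ?K" for i
  proof -
    have "sgn a * pos_part (a * c) - c * pos_part (- a) = a * pos_part c" for a c :: int
      by (cases "a = 0"; cases "c = 0"; cases "a > 0"; cases "c > 0")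
        (auto simp: pos_part_def max_def sgn_if mult_less_0_iff zero_less_mult_iff mult_le_0_iff not_less dest: antisym)
    from this[of "?B $ i $ k" ?c] have "- ?c * pos_part (- ?B $ i $ k) + ?B' $ i $ j = ?B $ i $ j + ?B $ i $ k * pos_part ?c"
      using that jk by (simp add: matrix_mutation_def)
    then show ?thesis using nonzero[of i]
      by (simp add: power_int_add[symmetric] power_int_mult[symmetric])
  qed
  have "(\<Prod>i\<in>UNIV. ?X' i powi (?B' $ i $ j)) = ?X' k powi (- ?c) * (\<Prod>i\<in>?K. ?X i powi (?B' $ i $ j))"
    unfolding split by (intro arg_cong2[where f = "(*)"] prod.cong)
      (auto simp: cluster_seed_mutation_other matrix_mutation_def)
  also have "\<dots> = (1 + yhat S k) powi (- ?c) * ?E powi ?c * ?X k powi ?c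
       * (\<Prod>i\<in>?K. ?X i powi (- ?c * pos_part (- ?B $ i $ k)) * ?X i powi (?B' $ i $ j))"
    unfolding X'k_pow by (simp add: prod.distrib mult_ac)
  also have "(\<Prod>i\<in>?K. ?X i powi (- ?c * pos_part (- ?B $ i $ k)) * ?X i powi (?B' $ i $ j))
     = (\<Prod>i\<in>?K. ?X i powi (?B $ i $ j) * (?X i powi (?B $ i $ k)) powi pos_part ?c)"
    by (rule prod.cong) (auto simp only: exps)
  finally have prod: "(\<Prod>i\<in>UNIV. ?X' i powi (?B' $ i $ j)) = (1 + yhat S k) powi (- ?c) * ?E powi ?c
     * ((\<Prod>i\<in>UNIV. ?X i powi (?B $ i $ j)) * (\<Prod>i\<in>UNIV. ?X i powi (?B $ i $ k)) powi pos_part ?c)"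
    using diag by (simp add: split prod_power_int power_int_mult_distrib prod.distrib mult_ac)
  have "coeffs (seed_mutation k S) j = coeffs S j + gpow (coeffs S k) (pos_part ?c) + gpow (coeffs S k \<oplus> 0) (- ?c)"
    using jk by (simp add: seed_mutation_def coeffs_mutation_def Let_def)
  then have coeff: "P_elem (coeffs (seed_mutation k S) j)
      = P_elem (coeffs S j) * P_elem (coeffs S k) powi pos_part ?c * inverse (?E powi ?c)"
    by (simp add: P_elem_add P_elem_gpow power_int_minus)
  have "?E powi ?c \<noteq> 0" by simp
  then show ?thesis
    unfolding yhat_def[of "seed_mutation k S"] exchange_matrix_seed_mutation prod coeff
    by (simp add: yhat_def[of S] power_int_mult_distrib mult_ac)
qed

end

section \<open>Laurent rings of adjacent seeds\<close>

text \<open>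
  These monomials are units both in the Laurent ring of a seed and in that of its neighbour in direction \<open>j\<close>.
\<close>

definition monomials_without :: "('n \<Rightarrow> ('p::semifield, 'n::{finite,linorder}) ambient) \<Rightarrow> 'n \<Rightarrow> ('p, 'n) ambient set" where
  "monomials_without X j = {laurent_monomial X g |g. Poly_Mapping.lookup (snd g) j = 0}"

lemma laurent_monomial_cong:
  assumes "Poly_Mapping.lookup (snd g) j = 0" "\<And>i. i \<noteq> j \<Longrightarrow> X i = Z i"
  shows "laurent_monomial X g = laurent_monomial Z g"
  unfolding laurent_monomial_def
proof (intro arg_cong2[where f = "(*)"] prod.cong)
  fix i show "X i powi Poly_Mapping.lookup (snd g) i = Z i powi Poly_Mapping.lookup (snd g) i"
    using assms by (cases "i = j") auto
qed auto

lemma monomials_without_cong: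
  assumes "\<And>i. i \<noteq> j \<Longrightarrow> X i = Z i"
  shows "monomials_without X j = monomials_without Z j"
  unfolding monomials_without_def
proof (intro Collect_cong ex_cong1)
  fix a g
  show "a = laurent_monomial X g \<and> Poly_Mapping.lookup (snd g) j = 0
    \<longleftrightarrow> a = laurent_monomial Z g \<and> Poly_Mapping.lookup (snd g) j = 0"
    using laurent_monomial_cong[of g j X Z] assms by auto
qed

context
  fixes X :: "'n \<Rightarrow> ('p::semifield, 'n::{finite,linorder}) ambient" and j :: 'n
  assumes nonzero: "\<And>i. X i \<noteq> 0"
begin

lemma monomials_without_mult: "a \<in> monomials_without X j \<Longrightarrow> b \<in> monomials_without X j \<Longrightarrow> a * b \<in> monomials_without X j"
proof -
  assume "a \<in> monomials_without X j" "b \<in> monomials_without X j"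
  then obtain g h where "a = laurent_monomial X g" "b = laurent_monomial X h"
    "Poly_Mapping.lookup (snd g) j = 0" "Poly_Mapping.lookup (snd h) j = 0"
    unfolding monomials_without_def by blast
  then have "a * b = laurent_monomial X (g + h) \<and> Poly_Mapping.lookup (snd (g + h)) j = 0"
    by (simp add: laurent_monomial_add[OF nonzero] lookup_add)
  then show ?thesis unfolding monomials_without_def by blast
qed

lemma monomials_without_inverse: "a \<in> monomials_without X j \<Longrightarrow> inverse a \<in> monomials_without X j"
proof -
  assume "a \<in> monomials_without X j"
  then obtain g where "a = laurent_monomial X g" "Poly_Mapping.lookup (snd g) j = 0"
    unfolding monomials_without_def by blast
  then have "inverse a = laurent_monomial X (- g) \<and> Poly_Mapping.lookup (snd (- g)) j = 0"
    by (simp add: laurent_monomial_uminus[OF nonzero])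
  then show ?thesis unfolding monomials_without_def by blast
qed

lemma monomials_without_divide: "a \<in> monomials_without X j \<Longrightarrow> b \<in> monomials_without X j \<Longrightarrow> a / b \<in> monomials_without X j"
  by (simp add: divide_inverse monomials_without_mult monomials_without_inverse)

lemma monomials_without_P_elem: "P_elem p \<in> monomials_without X j"
  unfolding monomials_without_def by (rule CollectI, rule exI[of _ "(p, 0)"]) (simp add: laurent_monomial_def)

lemma monomials_without_1: "1 \<in> monomials_without X j"
  using monomials_without_P_elem[of 0] by simp

lemma monomials_without_powi: "i \<noteq> j \<or> m = 0 \<Longrightarrow> X i powi m \<in> monomials_without X j"
  unfolding monomials_without_def
  by (rule CollectI, rule exI[of _ "(0, Poly_Mapping.single i m)"])
    (auto simp: laurent_monomial_var[OF nonzero] lookup_single when_def)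

lemma monomials_without_var: "i \<noteq> j \<Longrightarrow> X i \<in> monomials_without X j"
  using monomials_without_powi[of i 1] by simp

lemma monomials_without_prod: "(\<And>i. i \<in> A \<Longrightarrow> f i \<in> monomials_without X j) \<Longrightarrow> prod f A \<in> monomials_without X j"
  by (induction A rule: infinite_finite_induct) (auto intro: monomials_without_1 monomials_without_mult)

lemma monomials_without_power: "a \<in> monomials_without X j \<Longrightarrow> a ^ n \<in> monomials_without X j"
  by (induction n) (auto intro: monomials_without_1 monomials_without_mult)

lemma monomials_without_nonzero: "a \<in> monomials_without X j \<Longrightarrow> a \<noteq> 0"
  unfolding monomials_without_def using laurent_monomial_nonzero[OF nonzero] by auto

lemma monomials_without_in_ring: "a \<in> monomials_without X j \<Longrightarrow> a \<in> laurent_ring X"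
  unfolding monomials_without_def using laurent_monomial_in_ring[OF nonzero] by auto

lemmas monomials_without_intros = monomials_without_mult monomials_without_inverse monomials_without_divide
  monomials_without_P_elem monomials_without_powi monomials_without_var monomials_without_prod monomials_without_power monomials_without_1

end

lemma pos_part_simps [simp]:
  "x \<ge> 0 \<Longrightarrow> pos_part x = (x::int)" "x \<le> 0 \<Longrightarrow> pos_part x = (0::int)"
  by (auto simp: pos_part_def)

lemma exchange_relation:
  fixes S :: "('p::semifield, 'n::{finite,linorder}) seed"
  assumes X: "\<And>i. cluster S i \<noteq> 0" and sss: "sign_skew_symmetric (exchange_matrix S)"
  obtains W where "W \<in> monomials_without (cluster S) k"
    "cluster S k * cluster (seed_mutation k S) k = (1 + yhat S k) * W"
proof
  let ?W = "(\<Prod>i\<in>UNIV. cluster S i powi pos_part (- exchange_matrix S $ i $ k)) / P_elem (coeffs S k \<oplus> 0)"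
  show "?W \<in> monomials_without (cluster S) k"
  proof (intro monomials_without_divide[OF X] monomials_without_prod[OF X] monomials_without_P_elem[OF X])
    fix i
    show "cluster S i powi pos_part (- exchange_matrix S $ i $ k) \<in> monomials_without (cluster S) k"
      using sign_skew_symmetric_diag[OF sss, of k]
      by (cases "i = k") (auto intro!: monomials_without_powi[OF X] monomials_without_1[OF X])
  qed
  show "cluster S k * cluster (seed_mutation k S) k = (1 + yhat S k) * ?W"
    using X[of k] by (simp add: cluster_seed_mutation_yhat[OF X sss])
qed

lemma one_plus_power_expansion:
  fixes q :: "('p::semifield, 'n::{finite,linorder}) ambient"
  assumes "\<And>i. Z i \<noteq> 0" "q \<in> laurent_ring Z"
  shows "\<exists>t\<in>laurent_ring Z. (1 + q) ^ m = 1 + q * (of_nat m + q * t)"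
proof (induction m)
  case 0
  show ?case by (intro bexI[of _ 0]) (auto simp: laurent_ring_0[OF assms(1)])
next
  case (Suc m)
  then obtain t where t: "t \<in> laurent_ring Z" "(1 + q) ^ m = 1 + q * (of_nat m + q * t)" by blast
  have "of_nat m + t + q * t \<in> laurent_ring Z"
    using laurent_ring_of_int[of Z "int m", OF assms(1)] t(1) assms(2)
    by (auto intro!: laurent_ring_add[of Z, OF assms(1)] laurent_ring_mult[of Z, OF assms(1)])
  moreover have "(1 + q) ^ Suc m = 1 + q * (of_nat (Suc m) + q * (of_nat m + t + q * t))"
    by (simp add: t(2) algebra_simps)
  ultimately show ?case by blast
qed

text \<open>
  With \<open>q = yhat\<^sub>k\<^bsup>\<plusminus>1\<^esup>\<close>, the sign chosen so that \<open>x\<^sub>j\<close> occurs in \<open>q\<close> with positive exponent \<open>d\<close>, the mutated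
  \<open>x\<^sub>k\<close> is \<open>1 + q\<close> and the variable obtained by mutating at \<open>k\<close> and then at \<open>j\<close> is
  \<open>(1 + yhat\<^sub>j + r ((1 + q)\<^sup>m - 1)) / x\<^sub>j\<close>, up to units without \<open>x\<^sub>j\<close>. As \<open>q\<close> vanishes with \<open>x\<^sub>j\<close>, its numerator is
  the exchange binomial \<open>1 + yhat\<^sub>j\<close> modulo \<open>x\<^sub>j\<close>. The two cases for the sign of \<open>b\<^sub>j\<^sub>k\<close> correspond to the two
  terms of the exchange relation in direction \<open>k\<close>; by sign-skew-symmetry \<open>b\<^sub>k\<^sub>j\<close> has the opposite sign.
\<close>

lemma variable_after_two_mutations:
  fixes S :: "('p::semifield, 'n::{finite,linorder}) seed" and j k :: 'n
  defines "S' \<equiv> seed_mutation k S" and "B \<equiv> exchange_matrix S"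
  defines "F \<equiv> monomials_without (cluster S) j"
  assumes nz: "\<And>i. cluster S i \<noteq> 0" and nz': "\<And>i. cluster S' i \<noteq> 0"
    and sss: "sign_skew_symmetric B" and sss': "sign_skew_symmetric (exchange_matrix S')"
    and jk: "j \<noteq> k" and c: "B $ k $ j \<noteq> 0"
  obtains q M d m U V r where "q = M * cluster S j ^ d" "d > 0" "M \<in> F" "U \<in> F" "V \<in> F" "r \<in> F"
    "cluster S' k = U * (1 + q)"
    "cluster (seed_mutation j S') j * cluster S j = V * (1 + yhat S j + r * ((1 + q) ^ m - 1))"
proof -
  let ?X = "cluster S" and ?X' = "cluster S'"
  let ?E = "P_elem (coeffs S k \<oplus> 0) :: ('p, 'n) ambient"
  let ?E' = "P_elem (coeffs S' j \<oplus> 0) :: ('p, 'n) ambient"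
  note F_intros = monomials_without_intros[where X = ?X and j = j, OF nz, folded F_def]
  note F_mult = monomials_without_mult[where X = ?X and j = j, OF nz, folded F_def]
    and F_divide = monomials_without_divide[where X = ?X and j = j, OF nz, folded F_def]
    and F_prod = monomials_without_prod[where X = ?X and j = j, OF nz, folded F_def]
    and F_power = monomials_without_power[where X = ?X and j = j, OF nz, folded F_def]
    and F_P_elem = monomials_without_P_elem[where X = ?X and j = j, OF nz, folded F_def]
    and F_var = monomials_without_var[where X = ?X and j = j, OF nz, folded F_def]
  have Ek: "?E * ?X k \<in> F" using jk by (intro F_mult F_P_elem F_var) auto
  have signs: "B $ j $ k > 0 \<and> B $ k $ j < 0 \<or> B $ j $ k < 0 \<and> B $ k $ j > 0"
  proof -
    have "B $ j $ k * B $ k $ j < 0" using sss c unfolding sign_skew_symmetric_def by blast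
    then show ?thesis by (auto simp: mult_less_0_iff)
  qed
  have diag: "B $ i $ i = 0" "exchange_matrix S' $ i $ i = 0" for i
    using sign_skew_symmetric_diag[OF sss] sign_skew_symmetric_diag[OF sss'] by auto
  define M0 where "M0 = P_elem (coeffs S k) * (\<Prod>i\<in>UNIV - {j}. ?X i powi (B $ i $ k))"
  have M0: "M0 \<in> F" unfolding M0_def by (intro F_intros) auto
  have yk: "yhat S k = M0 * ?X j powi (B $ j $ k)"
    unfolding yhat_def M0_def B_def by (subst prod.remove[of _ j]) (auto simp: mult_ac)
  define C where "C = (\<Prod>i\<in>UNIV. ?X i powi pos_part (- B $ i $ k))"
  have X'k: "?X' k = (1 + yhat S k) * C / (?E * ?X k)"
    unfolding S'_def C_def B_def by (rule cluster_seed_mutation_yhat[OF nz sss[unfolded B_def]])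
  define R where "R = (\<Prod>i\<in>UNIV - {k}. ?X' i powi pos_part (- exchange_matrix S' $ i $ j))"
  have R: "R \<in> F"
    unfolding R_def
  proof (intro F_intros)
    fix i assume "i \<in> UNIV - {k}"
    then have "?X' i = ?X i" by (simp add: S'_def cluster_seed_mutation_other)
    then show "?X' i powi pos_part (- exchange_matrix S' $ i $ j) \<in> F"
      using diag(2)[of j] by (cases "i = j") (auto intro!: F_intros)
  qed
  have "exchange_matrix S' $ k $ j = - B $ k $ j"
    by (simp add: S'_def B_def matrix_mutation_def)
  moreover have "?X' j = ?X j" using jk by (simp add: S'_def cluster_seed_mutation_other)
  moreover have "cluster (seed_mutation j S') j = (1 + yhat S' j)
      * (\<Prod>i\<in>UNIV. ?X' i powi pos_part (- exchange_matrix S' $ i $ j)) / (?E' * ?X' j)"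
    by (rule cluster_seed_mutation_yhat[OF nz' sss'])
  ultimately have X'': "cluster (seed_mutation j S') j * ?X j = (1 + yhat S' j) * ?X' k powi pos_part (B $ k $ j) * R / ?E'"
  proof -
    assume B': "exchange_matrix S' $ k $ j = - B $ k $ j" and X'j: "?X' j = ?X j"
      and X'': "cluster (seed_mutation j S') j = (1 + yhat S' j)
        * (\<Prod>i\<in>UNIV. ?X' i powi pos_part (- exchange_matrix S' $ i $ j)) / (?E' * ?X' j)"
    have "(\<Prod>i\<in>UNIV. ?X' i powi pos_part (- exchange_matrix S' $ i $ j)) = ?X' k powi pos_part (B $ k $ j) * R"
      unfolding R_def by (subst prod.remove[of UNIV k]) (simp_all add: B')
    then show ?thesis unfolding X'' X'j using nz[of j] by simp
  qed
  have y': "yhat S' j = yhat S j * yhat S k powi pos_part (B $ k $ j) * (1 + yhat S k) powi (- (B $ k $ j))"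
    unfolding S'_def B_def by (rule yhat_seed_mutation_other[OF nz sss[unfolded B_def] jk])
  have RE: "R / ?E' \<in> F" by (intro F_divide F_P_elem R)
  from signs show ?thesis
  proof
    assume pos: "B $ j $ k > 0 \<and> B $ k $ j < 0"
    let ?q = "yhat S k" and ?U = "C / (?E * ?X k)" and ?m = "nat (- B $ k $ j)"
    have 1: "yhat S k = M0 * ?X j ^ nat (B $ j $ k)" using yk pos by (simp add: power_int_nonneg_exp)
    have 2: "C / (?E * ?X k) \<in> F"
    proof -
      have "?X i powi pos_part (- B $ i $ k) \<in> F" for i
        using pos by (cases "i = j") (auto intro!: F_intros)
      then show ?thesis unfolding C_def by (intro F_divide F_prod Ek)
    qed
    have 3: "?X' k = C / (?E * ?X k) * (1 + yhat S k)" using X'k by simp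
    have 4: "yhat S j \<in> F"
      unfolding yhat_eq_monomial F_def monomials_without_def
      using diag(1)[of j] by (intro CollectI exI[of _ "yhat_exponent S j"]) (simp add: B_def)
    have 5: "cluster (seed_mutation j S') j * ?X j
      = R / ?E' * (1 + yhat S j + yhat S j * ((1 + yhat S k) ^ nat (- B $ k $ j) - 1))"
    proof -
      have y'': "yhat S' j = yhat S j * (1 + yhat S k) ^ nat (- B $ k $ j)"
        unfolding y' using pos by (simp add: power_int_nonneg_exp)
      have expand: "(1 + y * z) * 1 * R / ?E' = R / ?E' * (1 + y + y * (z - 1))" for y z
        by (simp add: algebra_simps)
      have "pos_part (B $ k $ j) = 0" using pos by simp
      then show ?thesis unfolding X'' y'' by (simp only: power_int_0_right expand)
    qed
    show ?thesis by (rule that[OF 1 _ M0 2 RE 4 3 5]) (use pos in simp)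
  next
    assume neg: "B $ j $ k < 0 \<and> B $ k $ j > 0"
    let ?q = "inverse (yhat S k)" and ?U = "yhat S k * C / (?E * ?X k)" and ?m = "nat (B $ k $ j)"
    have yk0: "yhat S k \<noteq> 0" by (rule yhat_nonzero[OF nz sss[unfolded B_def]])
    have 1: "?q = inverse M0 * ?X j ^ nat (- B $ j $ k)"
      using yk neg by (simp add: power_int_def power_inverse)
    have U: "?U \<in> F"
    proof -
      have "?X i powi (B $ i $ k) * ?X i powi pos_part (- B $ i $ k) \<in> F" for i
        using neg nz[of j] by (cases "i = j") (auto intro!: F_intros simp flip: power_int_add)
      then have "P_elem (coeffs S k) * (\<Prod>i\<in>UNIV. ?X i powi (B $ i $ k) * ?X i powi pos_part (- B $ i $ k)) / (?E * ?X k) \<in> F"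
        by (intro F_divide F_mult[OF F_P_elem] F_prod Ek)
      then show ?thesis unfolding yhat_def C_def B_def by (simp add: prod.distrib mult_ac)
    qed
    have X'k': "?X' k = ?U * (1 + ?q)"
    proof -
      have "yhat S k * (1 + ?q) = 1 + yhat S k" using yk0 by (simp add: distrib_left)
      moreover have "a * C / (?E * ?X k) * b = (a * b) * C / (?E * ?X k)" for a b by simp
      ultimately show ?thesis unfolding X'k by (simp only:)
    qed
    have 2: "?U ^ ?m * (R / ?E') \<in> F" by (intro F_mult F_power U RE)
    have 3: "1 \<in> F" unfolding F_def by (rule monomials_without_1[OF nz])
    have 5: "cluster (seed_mutation j S') j * ?X j
      = ?U ^ ?m * (R / ?E') * (1 + yhat S j + 1 * ((1 + ?q) ^ ?m - 1))"
    proof -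
      have q1: "1 + ?q \<noteq> 0" using X'k' nz'[of k] by auto
      have "1 + yhat S k = yhat S k * (1 + ?q)" using yk0 by (simp add: distrib_left)
      then have "yhat S' j = yhat S j * (yhat S k ^ ?m * inverse ((yhat S k * (1 + ?q)) ^ ?m))"
        unfolding y' using neg by (simp add: power_int_minus power_int_nonneg_exp)
      also have "\<dots> = yhat S j / (1 + ?q) ^ ?m"
        using yk0 q1 by (simp add: power_mult_distrib divide_inverse)
      finally have "yhat S' j = yhat S j / (1 + ?q) ^ ?m" .
      moreover have "(1 + y / z) * z = z + y" if "z \<noteq> 0" for y z :: "('p, 'n) ambient"
        using that by (simp add: distrib_right)
      ultimately have "(1 + yhat S' j) * (1 + ?q) ^ ?m = (1 + ?q) ^ ?m + yhat S j"
        using q1 by (metis power_not_zero)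
      moreover have "(1 + yhat S' j) * ?X' k ^ ?m = ?U ^ ?m * ((1 + yhat S' j) * (1 + ?q) ^ ?m)"
        unfolding X'k' power_mult_distrib by (rule mult.left_commute)
      ultimately have X'k_pow: "(1 + yhat S' j) * ?X' k ^ ?m = ?U ^ ?m * ((1 + ?q) ^ ?m + yhat S j)"
        by (simp only:)
      have powi: "?X' k powi pos_part (B $ k $ j) = ?X' k ^ ?m"
        using neg by (simp add: power_int_nonneg_exp)
      have expand: "u * (z + y) * R / ?E' = u * (R / ?E') * (1 + y + 1 * (z - 1))" for u y z
        by (simp add: algebra_simps)
      show ?thesis unfolding X'' powi X'k_pow by (rule expand)
    qed
    show ?thesis by (rule that[OF 1 _ F_intros(2)[OF M0] U 2 3 X'k' 5]) (use neg in simp)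
  qed
qed

text \<open>
  Over the Laurent ring at \<open>\<mu>\<^sub>j \<Sigma>\<close>, elements of the Laurent ring at \<open>\<Sigma>\<close> have a power of \<open>P = 1 + yhat\<^sub>j\<close> as
  denominator, because \<open>x\<^sub>j\<close> is \<open>P\<close> up to a unit. Those at \<open>\<mu>\<^sub>j \<mu>\<^sub>k \<Sigma>\<close> have a power of \<open>Q\<close>, the product
  of the two variables introduced at \<open>k\<close> and \<open>j\<close>. Modulo \<open>P\<close> and up to units, for \<open>b\<^sub>k\<^sub>j \<noteq> 0\<close> the first
  variable is 1 and the second a binomial that is linear in \<open>x\<^sub>j'\<close>, or the monomial \<open>x\<^sub>j'\<close> itself; for
  \<open>b\<^sub>k\<^sub>j = 0\<close> the first is \<open>1 + yhat\<^sub>k\<close> and the second \<open>x\<^sub>j'\<close>. The degree used in the first case is the exponent of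
  \<open>x\<^sub>j'\<close>; in the second case a degree that separates \<open>yhat\<^sub>k\<close> from \<open>yhat\<^sub>j\<close> is a hypothesis.
\<close>

lemma laurent_ring_transfer:
  fixes S :: "('p::semifield, 'n::{finite,linorder}) seed" and j k :: 'n
  defines "Sj \<equiv> seed_mutation j S" and "Sk \<equiv> seed_mutation k S"
  defines "Skj \<equiv> seed_mutation j Sk" and "B \<equiv> exchange_matrix S"
  assumes seed: "is_seed S" and seed_j: "is_seed Sj" and seed_k: "is_seed Sk" and seed_kj: "is_seed Skj"
    and jk: "j \<noteq> k"
    and coprime: "B $ k $ j = 0 \<Longrightarrow>
      \<exists>\<delta> :: 'p \<times> ('n \<Rightarrow>\<^sub>0 int) \<Rightarrow> int. additive \<delta> \<and> \<delta> (yhat_exponent S j) = 0 \<and> \<delta> (yhat_exponent S k) \<noteq> 0"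
    and eS: "e \<in> laurent_ring (cluster S)" and eSkj: "e \<in> laurent_ring (cluster Skj)"
  shows "e \<in> laurent_ring (cluster Sj)"
proof -
  let ?X = "cluster S" and ?Z = "cluster Sj" and ?X' = "cluster Sk" and ?X'' = "cluster Skj"
  let ?L = "laurent_ring ?Z"
  have X: "\<And>i. ?X i \<noteq> 0" and Z: "\<And>i. ?Z i \<noteq> 0" and X': "\<And>i. ?X' i \<noteq> 0" and X'': "\<And>i. ?X'' i \<noteq> 0"
    using seed seed_j seed_k seed_kj by (auto simp: is_seed_nonzero)
  have sss: "sign_skew_symmetric B" using is_seed_sss[OF seed] by (simp add: B_def)
  have sss': "sign_skew_symmetric (exchange_matrix Sk)" by (rule is_seed_sss[OF seed_k])
  have diag: "B $ i $ i = 0" for i using sign_skew_symmetric_diag[OF sss] .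
  have Zi: "?Z i = ?X i" if "i \<noteq> j" for i using that by (simp add: Sj_def cluster_seed_mutation_other)
  have X'i: "?X' i = ?X i" if "i \<noteq> k" for i using that by (simp add: Sk_def cluster_seed_mutation_other)
  have X''i: "?X'' i = ?X' i" if "i \<noteq> j" for i using that by (simp add: Skj_def cluster_seed_mutation_other)
  define F where "F = monomials_without ?Z j"
  have FX: "F = monomials_without ?X j" unfolding F_def by (rule monomials_without_cong) (rule Zi)
  note F_mult = monomials_without_mult[where X = ?Z and j = j, OF Z, folded F_def]
    and F_inverse = monomials_without_inverse[where X = ?Z and j = j, OF Z, folded F_def]
    and F_divide = monomials_without_divide[where X = ?Z and j = j, OF Z, folded F_def]
    and F_P_elem = monomials_without_P_elem[where X = ?Z and j = j, OF Z, folded F_def]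
    and F_1 = monomials_without_1[where X = ?Z and j = j, OF Z, folded F_def]
    and F_L = monomials_without_in_ring[where X = ?Z and j = j, OF Z, folded F_def]
    and F_nonzero = monomials_without_nonzero[where X = ?Z and j = j, OF Z, folded F_def]
    and F_prod = monomials_without_prod[where X = ?X and j = j, OF X, folded FX]
    and F_powi = monomials_without_powi[where X = ?X and j = j, OF X, folded FX]
    and F_var = monomials_without_var[where X = ?X and j = j, OF X, folded FX]
  note L_add = laurent_ring_add[of ?Z, OF Z] and L_mult = laurent_ring_mult[of ?Z, OF Z]
    and L_1 = laurent_ring_1[of ?Z, OF Z] and L_power = laurent_ring_power[of ?Z, OF Z]
    and L_var = laurent_ring_var[of ?Z, OF Z] and L_inverse_var = laurent_ring_inverse_var[of ?Z, OF Z]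
    and L_of_int = laurent_ring_of_int[of ?Z, OF Z]
  have F_cong: "laurent_monomial ?X g = laurent_monomial ?Z g" if "Poly_Mapping.lookup (snd g) j = 0" for g
    using that by (rule laurent_monomial_cong) (rule Zi[symmetric])
  define P where "P = 1 + yhat S j"
  have yj: "yhat S j = laurent_monomial ?Z (yhat_exponent S j)"
    unfolding yhat_eq_monomial by (rule F_cong) (use diag[of j] in \<open>simp add: B_def\<close>)
  have P_L: "P \<in> ?L" unfolding P_def yj by (intro L_add L_1 laurent_monomial_in_ring[of ?Z, OF Z])
  obtain W where "W \<in> monomials_without ?X j" and rel: "?X j * ?Z j = (1 + yhat S j) * W"
    using exchange_relation[OF X is_seed_sss[OF seed], of j] unfolding Sj_def .
  then have W: "W \<in> F" by (simp add: FX)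
  have W0: "W \<noteq> 0" using F_nonzero[OF W] .
  have P0: "P \<noteq> 0" using rel X[of j] Z[of j] by (auto simp: P_def)
  have Xj: "?X j = P * (W * inverse (?Z j))" using rel Z[of j] by (simp add: P_def field_simps)
  then have Xj': "inverse (?X j) * P = inverse W * ?Z j" using P0 W0 by simp
  have X_L: "?X i \<in> ?L" for i
  proof (cases "i = j")
    case True
    then show ?thesis unfolding True Xj by (intro L_mult P_L F_L[OF W] L_inverse_var)
  next
    case False
    then show ?thesis using L_var[of i] Zi by simp
  qed
  have invP: "inverse (?X i) * P \<in> ?L" for i
  proof (cases "i = j")
    case True
    then show ?thesis unfolding True Xj' by (intro L_mult L_var F_L F_inverse W)
  next
    case False
    then have "inverse (?X i) = inverse (?Z i)" using Zi by simp
    then show ?thesis by (simp add: L_mult P_L L_inverse_var)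
  qed
  obtain N where eP: "e * P ^ N \<in> ?L"
    by (rule laurent_ring_localization[of ?X ?Z P e, OF X Z P_L X_L invP eS])
  have unit_regular: "regular_mod ?L P u" if "u \<in> F" for u
    using that regular_mod_unit[of ?Z, OF Z] unfolding F_def monomials_without_def by auto
  have Zj_regular: "regular_mod ?L P (u * ?Z j)" if "u \<in> F" for u
    using that regular_mod_unit[of ?Z P "_ + (0, Poly_Mapping.single j 1)", OF Z]
    unfolding F_def monomials_without_def
    by (auto simp: laurent_monomial_add[of ?Z, OF Z] laurent_monomial_var[of ?Z, OF Z])
  have "?X' k \<in> ?L \<and> regular_mod ?L P (?X' k) \<and> ?X'' j \<in> ?L \<and> regular_mod ?L P (?X'' j)"
  proof (cases "B $ k $ j = 0")
    case False
    obtain q M d m U V r where q: "q = M * ?X j ^ d" and d: "d > 0" and M: "M \<in> F" and U: "U \<in> F"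
      and V: "V \<in> F" and r: "r \<in> F" and X'k: "?X' k = U * (1 + q)"
      and X''j: "?X'' j * ?X j = V * (1 + yhat S j + r * ((1 + q) ^ m - 1))"
      using variable_after_two_mutations[of S k j, OF X X'[unfolded Sk_def] sss[unfolded B_def] sss'[unfolded Sk_def] jk]
        False unfolding FX[symmetric] Sk_def Skj_def B_def by metis
    obtain d' where d': "d = Suc d'" using d by (cases d) auto
    define t0 where "t0 = M * ?X j ^ d' * (W * inverse (?Z j))"
    have t0: "t0 \<in> ?L" unfolding t0_def by (intro L_mult L_power X_L F_L[OF M] F_L[OF W] L_inverse_var)
    have qP: "q = P * t0" unfolding q d' t0_def power_Suc by (subst Xj) (simp add: mult_ac)
    have q_L: "q \<in> ?L" unfolding qP by (intro L_mult P_L t0)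
    have "?X' k = U + P * (U * t0)" unfolding X'k qP by (simp add: distrib_left mult_ac)
    then have "regular_mod ?L P (?X' k)"
      using regular_mod_add_multiple[of ?Z "U * t0" P U, OF Z L_mult[OF F_L[OF U] t0] unit_regular[OF U]] by simp
    moreover have "?X' k \<in> ?L" unfolding X'k by (intro L_mult L_add L_1 q_L F_L U)
    moreover obtain t where t: "t \<in> ?L" "(1 + q) ^ m = 1 + q * (of_nat m + q * t)"
      using one_plus_power_expansion[of ?Z q m, OF Z q_L] by blast
    \<comment> \<open>Two parts: a unit times \<open>x\<^sub>j'\<close>, and a multiple of \<open>x\<^sub>j\<close> to the power \<open>d - 1\<close>.\<close>
    have split: "?X'' j = V * inverse W * ?Z j + V * r * M * ?X j ^ d' * (of_int (int m) + q * t)"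
    proof -
      have "?X'' j * ?X j = (V * inverse W * ?Z j + V * r * M * ?X j ^ d' * (of_int (int m) + q * t)) * ?X j"
      proof -
        have "P = inverse W * ?Z j * ?X j" using Xj' X[of j] by (simp add: field_simps)
        then have "V * P = V * inverse W * ?Z j * ?X j" by (simp add: mult_ac)
        moreover have "V * (r * (q * (of_nat m + q * t))) = V * r * M * ?X j ^ d' * (of_int (int m) + q * t) * ?X j"
          by (subst (1) q) (simp add: d' mult_ac)
        ultimately show ?thesis unfolding X''j P_def[symmetric] t(2)
          by (simp add: distrib_left distrib_right)
      qed
      then show ?thesis using X[of j] by simp
    qed
    have "?X'' j \<in> ?L"
      unfolding split by (intro L_add L_mult L_power L_of_int L_var q_L t(1) X_L F_L F_inverse V r M W)
    moreover have "regular_mod ?L P (?X'' j)"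
    \<comment> \<open>For \<open>d = 1\<close> the second part survives modulo \<open>P\<close> as \<open>m\<close> times a unit without \<open>x\<^sub>j'\<close>; for \<open>d > 1\<close> it vanishes.\<close>
    proof (cases d')
      case 0
      have VW: "V * inverse W \<in> F" by (intro F_mult F_inverse V W)
      have VrM: "V * r * M \<in> F" by (intro F_mult V r M)
      obtain g h where g: "V * inverse W = laurent_monomial ?Z g" "Poly_Mapping.lookup (snd g) j = 0"
        and h: "V * r * M = laurent_monomial ?Z h" "Poly_Mapping.lookup (snd h) j = 0"
        using VW VrM unfolding F_def monomials_without_def by blast
      let ?\<delta> = "\<lambda>g. Poly_Mapping.lookup (snd g) j"
      let ?g = "g + (0, Poly_Mapping.single j 1)"
      have "regular_mod ?L (1 + laurent_monomial ?Z (yhat_exponent S j))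
          (laurent_monomial ?Z ?g + of_int (int m) * laurent_monomial ?Z h)"
      proof (rule regular_mod_binomial[where \<delta> = ?\<delta>])
        show "free_generating ?Z" using seed_j by (simp add: is_seed_def)
        show "additive ?\<delta>" by standard (simp add: lookup_add)
        show "?\<delta> (yhat_exponent S j) = 0" using diag[of j] by (simp add: B_def)
        show "?\<delta> h < ?\<delta> ?g" using g h by (simp add: lookup_add)
      qed
      moreover have "laurent_monomial ?Z ?g = V * inverse W * ?Z j"
        by (simp add: laurent_monomial_add[of ?Z, OF Z] laurent_monomial_var[of ?Z, OF Z] g(1))
      ultimately have "regular_mod ?L P (V * inverse W * ?Z j + of_int (int m) * (V * r * M))"
        unfolding P_def yj h(1) by simp
      moreover have "V * r * M * (t0 * t) \<in> ?L" by (intro L_mult t0 t(1) F_L V r M)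
      ultimately have "regular_mod ?L P (V * inverse W * ?Z j + of_int (int m) * (V * r * M) + P * (V * r * M * (t0 * t)))"
        by (intro regular_mod_add_multiple[of ?Z, OF Z])
      moreover have "?X'' j = V * inverse W * ?Z j + of_int (int m) * (V * r * M) + P * (V * r * M * (t0 * t))"
        unfolding split 0 by (simp add: qP algebra_simps)
      ultimately show ?thesis by simp
    next
      case (Suc d'')
      let ?s = "V * r * M * (?X j ^ d'' * (W * inverse (?Z j))) * (of_int (int m) + q * t)"
      have "?s \<in> ?L" by (intro L_add L_mult L_power L_of_int L_inverse_var q_L t(1) X_L F_L V r M W)
      moreover have "regular_mod ?L P (V * inverse W * ?Z j)" by (intro Zj_regular F_mult F_inverse V W)
      ultimately have "regular_mod ?L P (V * inverse W * ?Z j + P * ?s)"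
        by (intro regular_mod_add_multiple[of ?Z, OF Z])
      moreover have "?X j ^ d' = P * (?X j ^ d'' * (W * inverse (?Z j)))"
        unfolding Suc power_Suc by (subst Xj) (simp add: mult_ac)
      then have "?X'' j = V * inverse W * ?Z j + P * ?s"
        unfolding split by (simp add: mult_ac)
      ultimately show ?thesis by simp
    qed
    ultimately show ?thesis by blast
  next
    case True
    then have jk0: "B $ j $ k = 0" using sss unfolding sign_skew_symmetric_def by (metis less_irrefl mult_zero_right)
    have "coeffs Sk j = coeffs S j"
      using jk True by (simp add: Sk_def seed_mutation_def coeffs_mutation_def Let_def B_def gpow_def)
    moreover have "exchange_matrix Sk $ i $ j = B $ i $ j" for i
      using jk True by (simp add: Sk_def matrix_mutation_def B_def)
    moreover have "?X' i powi pos_part (B $ i $ j) = ?X i powi pos_part (B $ i $ j)"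
      "?X' i powi pos_part (- B $ i $ j) = ?X i powi pos_part (- B $ i $ j)" for i
      using True X'i by (cases "i = k"; simp)+
    moreover have "?X' j = ?X j" using X'i jk by simp
    ultimately have X''j: "?X'' j = ?Z j"
      unfolding Skj_def Sj_def cluster_seed_mutation_binomial by (simp add: B_def)
    define U where "U = (\<Prod>i\<in>UNIV. ?X i powi pos_part (- B $ i $ k)) / (P_elem (coeffs S k \<oplus> 0) * ?X k)"
    have U: "U \<in> F" unfolding U_def
    proof (intro F_divide F_prod F_mult F_P_elem F_var)
      fix i show "?X i powi pos_part (- B $ i $ k) \<in> F" using jk0 by (cases "i = j") (auto intro!: F_powi F_1)
    qed (use jk in auto)
    have yk: "yhat S k = laurent_monomial ?Z (yhat_exponent S k)"
      unfolding yhat_eq_monomial by (rule F_cong) (use jk0 in \<open>simp add: B_def\<close>)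
    have yk_L: "1 + yhat S k \<in> ?L" unfolding yk by (intro L_add L_1 laurent_monomial_in_ring[of ?Z, OF Z])
    have X'k: "?X' k = U * (1 + yhat S k)"
      unfolding Sk_def U_def B_def by (subst cluster_seed_mutation_yhat[OF X is_seed_sss[OF seed]]) simp
    obtain \<delta> :: "'p \<times> ('n \<Rightarrow>\<^sub>0 int) \<Rightarrow> int" where \<delta>: "additive \<delta>" "\<delta> (yhat_exponent S j) = 0"
      "\<delta> (yhat_exponent S k) \<noteq> 0" using coprime[OF True] by blast
    have free: "free_generating ?Z" using seed_j by (simp add: is_seed_def)
    have \<delta>0: "\<delta> 0 = 0" by (rule additive.zero[OF \<delta>(1)])
    have "regular_mod ?L P (1 + yhat S k)"
    proof (cases "\<delta> (yhat_exponent S k) > 0")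
      case True
      then show ?thesis
        using regular_mod_binomial[OF free \<delta>(1,2), of 0 "yhat_exponent S k" 1] \<delta>0
        by (simp add: P_def yj yk add.commute)
    next
      case False
      then show ?thesis
        using regular_mod_binomial[OF free \<delta>(1,2), of "yhat_exponent S k" 0 1] \<delta>0 \<delta>(3)
        by (simp add: P_def yj yk)
    qed
    then have "regular_mod ?L P (?X' k)"
      unfolding X'k by (rule regular_mod_mult[of ?Z, OF Z yk_L unit_regular[OF U]])
    moreover have "?X' k \<in> ?L" unfolding X'k by (intro L_mult F_L U yk_L)
    moreover have "?X'' j \<in> ?L" "regular_mod ?L P (?X'' j)"
      using X''j L_var[of j] Zj_regular[OF F_P_elem[of 0]] by simp_all
    ultimately show ?thesis by blast
  qed
  then have k: "?X' k \<in> ?L" "regular_mod ?L P (?X' k)" and j: "?X'' j \<in> ?L" "regular_mod ?L P (?X'' j)"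
    by blast+
  define Q where "Q = ?X' k * ?X'' j"
  have Q_L: "Q \<in> ?L" unfolding Q_def by (intro L_mult k j)
  have other: "?X'' i = ?Z i" if "i \<noteq> j" "i \<noteq> k" for i using that X''i X'i Zi by simp
  have X''k: "?X'' k = ?X' k" using X''i jk by simp
  have "?X'' i \<in> ?L" for i
    using k(1) j(1) X''k other[of i] L_var[of i] by (cases "i = j"; cases "i = k") auto
  moreover have "inverse (?X'' i) * Q \<in> ?L" for i
  proof -
    consider "i = j" | "i = k" | "i \<noteq> j" "i \<noteq> k" by blast
    then show ?thesis
    proof cases
      case 1
      then have "inverse (?X'' i) * Q = ?X' k" unfolding Q_def using X''[of j] by (simp add: field_simps)
      then show ?thesis using k(1) by simp
    next
      case 2
      then have "inverse (?X'' i) * Q = ?X'' j" unfolding Q_def using X''k X'[of k] by (simp add: field_simps)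
      then show ?thesis using j(1) by simp
    next
      case 3
      then show ?thesis using other[OF 3] L_mult[OF L_inverse_var[of i] Q_L] by simp
    qed
  qed
  ultimately obtain N' where eQ: "e * Q ^ N' \<in> ?L"
    using laurent_ring_localization[of ?X'' ?Z Q e, OF X'' Z Q_L _ _ eSkj] by blast
  have "regular_mod ?L P Q" unfolding Q_def by (intro regular_mod_mult[of ?Z, OF Z] k j)
  then show ?thesis using coprime_denominators[of ?Z P Q e N N', OF Z P_L P0 Q_L _ eP eQ] by blast
qed

section \<open>Multiplicative independence of the exchange monomials\<close>

lemma additive_gpow:
  fixes \<delta> :: "'a::ab_group_add \<Rightarrow> int"
  assumes "additive \<delta>"
  shows "\<delta> (gpow a m) = m * \<delta> a"
proof -
  have "\<delta> (((+) a ^^ n) 0) = int n * \<delta> a" for n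
    by (induction n) (auto simp: additive.zero[OF assms] additive.add[OF assms] algebra_simps)
  then show ?thesis by (simp add: gpow_def additive.minus[OF assms])
qed

lemma fst_gpow: "fst (gpow g m) = gpow (fst g) m" for g :: "'a::ab_group_add \<times> 'b::ab_group_add"
proof -
  have "fst (((+) g ^^ n) 0) = ((+) (fst g) ^^ n) 0" for n
    by (induction n) auto
  then show ?thesis by (simp add: gpow_def)
qed

lemma power_int_sum:
  fixes x :: "'a::field"
  assumes "x \<noteq> 0"
  shows "x powi (sum f A) = (\<Prod>i\<in>A. x powi f i)"
  by (induction A rule: infinite_finite_induct) (auto simp: power_int_add assms)

lemma laurent_monomial_gpow:
  assumes "\<And>i. X i \<noteq> 0"
  shows "laurent_monomial X (gpow g m) = laurent_monomial X g powi m"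
proof -
  have "laurent_monomial X (((+) g ^^ n) 0) = laurent_monomial X g ^ n" for n
    by (induction n) (auto simp: laurent_monomial_add[OF assms])
  then show ?thesis
    by (simp add: gpow_def power_int_def laurent_monomial_uminus[OF assms] power_inverse)
qed

lemma laurent_monomial_sum:
  assumes "\<And>i. X i \<noteq> 0"
  shows "laurent_monomial X (sum g A) = (\<Prod>a\<in>A. laurent_monomial X (g a))"
  by (induction A rule: infinite_finite_induct) (auto simp: laurent_monomial_add[OF assms])

lemma laurent_monomial_inj:
  assumes "free_generating X" "laurent_monomial X g = laurent_monomial X h"
  shows "g = h"
proof -
  have "laurent X (Poly_Mapping.single g 1 - Poly_Mapping.single h 1) = 0"
    using assms(2) free_generating_nonzero[OF assms(1)]
    by (simp add: is_ring_hom_diff[OF laurent_is_ring_hom] laurent_single)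
  then have "Poly_Mapping.single g (1::int) - Poly_Mapping.single h 1 = 0" using laurent_inj[OF assms(1)] by blast
  then show ?thesis by (simp add: frag_of_eq)
qed

text \<open>
  The augmentation sends \<open>1 + z\<^sup>v\<close> to 2 and monomials to 1.
\<close>

lemma one_plus_monomial_not_unit:
  fixes X :: "'n \<Rightarrow> ('p::semifield, 'n::{finite,linorder}) ambient"
  assumes free: "free_generating X" and u: "u \<in> laurent_ring X"
  shows "(1 + laurent_monomial X v) * u \<noteq> laurent_monomial X g"
proof
  assume eq: "(1 + laurent_monomial X v) * u = laurent_monomial X g"
  have nz: "\<And>i. X i \<noteq> 0" using free_generating_nonzero[OF free] .
  note hom = laurent_is_ring_hom[of X, OF nz]
  obtain f where f: "u = laurent X f" using u by (auto simp: laurent_ring_def)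
  let ?P = "(1 + Poly_Mapping.single v 1) * f" and ?m = "Poly_Mapping.single g (1::int)"
  have "laurent X (?P - ?m) = 0"
    using eq by (simp add: is_ring_hom_diff[OF hom] is_ring_homD[OF hom] laurent_single f)
  then have "?P - ?m = 0" by (rule laurent_inj[OF free])
  then have "?P = ?m" by (simp only: right_minus_eq)
  define aug :: "(('p \<times> ('n \<Rightarrow>\<^sub>0 int)) \<Rightarrow>\<^sub>0 int) \<Rightarrow> int" where "aug = lin_ext of_int (\<lambda>_. 1)"
  have aug: "is_ring_hom aug" unfolding aug_def by (rule lin_ext_is_ring_hom[OF is_ring_hom_of_int]) auto
  have single: "aug (Poly_Mapping.single h 1) = 1" for h
    unfolding aug_def lin_ext_single[OF is_ring_hom_of_int] by simp
  have "aug ?P = aug ?m" using \<open>?P = ?m\<close> by simp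
  then have "2 * aug f = 1" by (simp add: is_ring_homD[OF aug] single)
  then show False by presburger
qed

definition mult_independent :: "('n::finite \<Rightarrow> 'a::field) \<Rightarrow> bool" where
  "mult_independent y \<longleftrightarrow> (\<forall>a. (\<Prod>j\<in>UNIV. y j powi a j) = 1 \<longrightarrow> (\<forall>j. a j = 0))"

lemma mult_independent_pair:
  assumes y: "mult_independent y" "\<And>j. y j \<noteq> 0" and jk: "j \<noteq> k" and eq: "y k powi a = y j powi b"
  shows "a = 0"
proof -
  let ?a = "\<lambda>i. if i = k then a else if i = j then - b else 0"
  have "(\<Prod>i\<in>UNIV. y i powi ?a i) = (\<Prod>i\<in>{j, k}. y i powi ?a i)"
    by (rule prod.mono_neutral_right) auto
  also have "\<dots> = y j powi (- b) * y k powi a" using jk by simp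
  also have "\<dots> = 1" using y(2)[of j] by (simp add: eq power_int_minus)
  finally have "?a k = 0" by (rule y(1)[unfolded mult_independent_def, rule_format])
  then show ?thesis by simp
qed

text \<open>
  A relation between the mutated \<open>yhat\<close> says that a power of \<open>1 + yhat\<^sub>k\<close> is a monomial in the old ones. As
  \<open>1 + yhat\<^sub>k\<close> is not a unit, the exponent of that power is 0, and a relation between the old \<open>yhat\<close> remains.
\<close>

lemma mult_independent_mutation:
  fixes S :: "('p::semifield, 'n::{finite,linorder}) seed"
  assumes seed: "is_seed S" and seed': "is_seed (seed_mutation k S)" and indep: "mult_independent (yhat S)"
  shows "mult_independent (yhat (seed_mutation k S))"
  unfolding mult_independent_def
proof (intro allI impI)
  fix a :: "'n \<Rightarrow> int" and j
  let ?y = "yhat S" and ?X = "cluster S" and ?K = "UNIV - {k}"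
  let ?c = "\<lambda>j. exchange_matrix S $ k $ j"
  assume prod: "(\<Prod>j\<in>UNIV. yhat (seed_mutation k S) j powi a j) = 1"
  have X: "?X i \<noteq> 0" for i using seed by (rule is_seed_nonzero)
  note sss = is_seed_sss[OF seed]
  have y: "?y i \<noteq> 0" for i by (rule yhat_nonzero[OF X sss])
  have "cluster (seed_mutation k S) k \<noteq> 0" by (rule is_seed_nonzero[OF seed'])
  then have y1: "1 + ?y k \<noteq> 0" by (auto simp: cluster_seed_mutation_yhat[OF X sss])
  define N where "N = (\<Sum>j\<in>?K. ?c j * a j)"
  define m where "m = (\<Sum>j\<in>?K. pos_part (?c j) * a j) - a k"
  let ?b = "a(k := m)"
  have split: "prod f UNIV = f k * prod f ?K" for f :: "'n \<Rightarrow> ('p, 'n) ambient"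
    by (rule prod.remove) auto
  have "1 = yhat (seed_mutation k S) k powi a k * (\<Prod>j\<in>?K. yhat (seed_mutation k S) j powi a j)"
    using prod split by simp
  also have "yhat (seed_mutation k S) k powi a k = ?y k powi (- a k)"
    by (simp add: yhat_seed_mutation_self[OF X sss] power_int_inverse power_int_minus)
  also have "(\<Prod>j\<in>?K. yhat (seed_mutation k S) j powi a j)
      = (\<Prod>j\<in>?K. ?y j powi a j * ?y k powi (pos_part (?c j) * a j) * (1 + ?y k) powi (- (?c j * a j)))"
    by (rule prod.cong) (auto simp: yhat_seed_mutation_other[OF X sss] power_int_mult_distrib simp flip: power_int_mult)
  also have "\<dots> = (\<Prod>j\<in>?K. ?y j powi a j) * ?y k powi (\<Sum>j\<in>?K. pos_part (?c j) * a j) * (1 + ?y k) powi (- N)"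
    by (simp add: prod.distrib power_int_sum[OF y] power_int_sum[OF y1] N_def sum_negf[symmetric])
  finally have "1 = ((\<Prod>j\<in>?K. ?y j powi a j) * (?y k powi (- a k) * ?y k powi (\<Sum>j\<in>?K. pos_part (?c j) * a j)))
      * (1 + ?y k) powi (- N)"
    by (simp add: mult_ac)
  also have "?y k powi (- a k) * ?y k powi (\<Sum>j\<in>?K. pos_part (?c j) * a j) = ?y k powi m"
    using y by (simp add: m_def flip: power_int_add)
  also have "(\<Prod>j\<in>?K. ?y j powi a j) * ?y k powi m = (\<Prod>j\<in>UNIV. ?y j powi ?b j)"
    unfolding split by (simp add: mult.commute)
  finally have eq: "(\<Prod>j\<in>UNIV. ?y j powi ?b j) = (1 + ?y k) powi N"
    using y1 by (simp add: power_int_minus field_simps)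
  have free: "free_generating ?X" using seed by (simp add: is_seed_def)
  let ?v = "yhat_exponent S k"
  define g where "g = (\<Sum>j\<in>UNIV. gpow (yhat_exponent S j) (?b j))"
  have g: "(1 + laurent_monomial ?X ?v) powi N = laurent_monomial ?X g"
    unfolding g_def laurent_monomial_sum[OF X] laurent_monomial_gpow[OF X] yhat_eq_monomial[symmetric]
    by (rule eq[symmetric])
  have contra: "(1 + laurent_monomial ?X ?v) ^ Suc n \<noteq> laurent_monomial ?X h" for n h
    unfolding power_Suc
    by (intro one_plus_monomial_not_unit[OF free] laurent_ring_power[OF X] laurent_ring_add[OF X]
        laurent_ring_1[OF X] laurent_monomial_in_ring[OF X])
  \<comment> \<open>A negative \<open>N\<close> is reduced to a positive one by inverting the monomial.\<close>
  have "N = 0"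
  proof (rule ccontr)
    assume "N \<noteq> 0"
    then have "N = int (Suc (nat \<bar>N\<bar> - 1)) \<or> - N = int (Suc (nat \<bar>N\<bar> - 1))" by linarith
    then obtain n where "N = int (Suc n) \<or> - N = int (Suc n)" by blast
    then show False
    proof
      assume "N = int (Suc n)"
      then have "(1 + laurent_monomial ?X ?v) ^ Suc n = laurent_monomial ?X g" using g by (metis power_int_of_nat)
      then show False using contra by blast
    next
      assume N: "- N = int (Suc n)"
      have "(1 + laurent_monomial ?X ?v) powi (- N) = laurent_monomial ?X (- g)"
        unfolding laurent_monomial_uminus[OF X] g[symmetric] by (rule power_int_minus)
      then have "(1 + laurent_monomial ?X ?v) ^ Suc n = laurent_monomial ?X (- g)" using N by (metis power_int_of_nat)
      then show False using contra by blast
    qed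
  qed
  then have "(\<Prod>j\<in>UNIV. ?y j powi ?b j) = 1" using eq by simp
  then have b: "?b i = 0" for i using indep unfolding mult_independent_def by blast
  have "a i = 0" if "i \<noteq> k" for i using b[of i] that by simp
  moreover from this have "m = - a k" unfolding m_def by (simp add: sum.neutral)
  then have "a k = 0" using b[of k] by simp
  ultimately show "a j = 0" by (cases "j = k") auto
qed

text \<open>
  The coordinates of the lattice of exponents, those in \<open>\<P>\<close> first.
\<close>

definition exponent_coord :: "'n + 'n \<Rightarrow> ('n trop) \<times> ('n \<Rightarrow>\<^sub>0 int) \<Rightarrow> int" where
  "exponent_coord s g = (case s of Inl i \<Rightarrow> Poly_Mapping.lookup (fst g) i | Inr i \<Rightarrow> Poly_Mapping.lookup (snd g) i)"

lemma additive_exponent_coord: "additive (exponent_coord s)"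
  by standard (auto simp: exponent_coord_def lookup_add split: sum.split)

lemma exponent_coord_eqI: "(\<And>s. exponent_coord s g = exponent_coord s h) \<Longrightarrow> g = h"
proof (rule prod_eqI)
  assume eq: "\<And>s. exponent_coord s g = exponent_coord s h"
  show "fst g = fst h" using eq[of "Inl _"] by (intro poly_mapping_eqI) (simp add: exponent_coord_def)
  show "snd g = snd h" using eq[of "Inr _"] by (intro poly_mapping_eqI) (simp add: exponent_coord_def)
qed

text \<open>
  The \<open>2 \<times> 2\<close> minors of \<open>(v, w)\<close>, as linear forms in \<open>w\<close>, vanish at \<open>v\<close>. If all of them vanish at \<open>w\<close> too,
  then \<open>v\<close> and \<open>w\<close> are proportional, which contradicts multiplicative independence.
\<close>

lemma separating_degree:
  fixes S :: "('n trop, 'n::{finite,linorder}) seed"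
  assumes seed: "is_seed S" and indep: "mult_independent (yhat S)" and jk: "j \<noteq> k"
  shows "\<exists>\<delta> :: 'n trop \<times> ('n \<Rightarrow>\<^sub>0 int) \<Rightarrow> int.
    additive \<delta> \<and> \<delta> (yhat_exponent S j) = 0 \<and> \<delta> (yhat_exponent S k) \<noteq> 0"
proof (rule ccontr)
  assume none: "\<not> ?thesis"
  let ?v = "yhat_exponent S j" and ?w = "yhat_exponent S k"
  have X: "cluster S i \<noteq> 0" for i using seed by (rule is_seed_nonzero)
  have y: "yhat S i \<noteq> 0" for i by (rule yhat_nonzero[OF X is_seed_sss[OF seed]])
  have proportional: "exponent_coord \<alpha> ?v * exponent_coord \<beta> ?w = exponent_coord \<beta> ?v * exponent_coord \<alpha> ?w" for \<alpha> \<beta>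
  proof -
    \<comment> \<open>The minor in the coordinates \<open>\<alpha>\<close> and \<open>\<beta>\<close>.\<close>
    let ?\<delta> = "\<lambda>g. exponent_coord \<alpha> ?v * exponent_coord \<beta> g - exponent_coord \<beta> ?v * exponent_coord \<alpha> g"
    have "additive ?\<delta>" by standard (simp add: additive.add[OF additive_exponent_coord] algebra_simps)
    moreover have "?\<delta> ?v = 0" by (simp add: mult.commute)
    ultimately have "?\<delta> ?w = 0" using none by blast
    then show ?thesis by simp
  qed
  have "exponent_coord \<alpha> ?v = 0" for \<alpha>
  proof (rule mult_independent_pair[OF indep y jk])
    have "gpow ?w (exponent_coord \<alpha> ?v) = gpow ?v (exponent_coord \<alpha> ?w)"
    proof (rule exponent_coord_eqI)
      fix \<beta>
      show "exponent_coord \<beta> (gpow ?w (exponent_coord \<alpha> ?v)) = exponent_coord \<beta> (gpow ?v (exponent_coord \<alpha> ?w))"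
        unfolding additive_gpow[OF additive_exponent_coord] using proportional[of \<alpha> \<beta>] by (simp only: mult.commute)
    qed
    then show "yhat S k powi exponent_coord \<alpha> ?v = yhat S j powi exponent_coord \<alpha> ?w"
      unfolding yhat_eq_monomial laurent_monomial_gpow[OF X, symmetric] by simp
  qed
  then have "?v = 0" by (intro exponent_coord_eqI) (simp add: additive.zero[OF additive_exponent_coord])
  then have "yhat S k powi 0 = yhat S j powi 1" "yhat S j = 1" by (simp_all add: yhat_eq_monomial)
  then have "yhat S j powi 1 = yhat S k powi 0" by simp
  then show False using mult_independent_pair[OF indep y jk[symmetric]] by fastforce
qed

lemma trop_sum_gens: "(\<Sum>j\<in>UNIV. gpow (trop_gen j) (Poly_Mapping.lookup p j)) = p" for p :: "'n::{finite,linorder} trop"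
proof (rule poly_mapping_eqI)
  fix i
  have "additive (\<lambda>p :: 'n trop. Poly_Mapping.lookup p i)" by standard (rule lookup_add)
  from additive_gpow[OF this]
  have "Poly_Mapping.lookup (gpow (trop_gen j) m) i = (if j = i then m else 0)" for j m
    by (simp add: trop_gen_def lookup_single when_def)
  then show "Poly_Mapping.lookup (\<Sum>j\<in>UNIV. gpow (trop_gen j) (Poly_Mapping.lookup p j)) i = Poly_Mapping.lookup p i"
    by (simp add: lookup_sum)
qed

lemma mult_independent_principal:
  fixes S :: "('n trop, 'n::{finite,linorder}) seed"
  assumes seed: "is_seed S" and principal: "coeffs S = trop_gen"
  shows "mult_independent (yhat S)"
  unfolding mult_independent_def
proof (intro allI impI)
  fix a :: "'n \<Rightarrow> int" and i
  let ?X = "cluster S" and ?p = "Poly_Mapping.Abs_poly_mapping a"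
  assume prod: "(\<Prod>j\<in>UNIV. yhat S j powi a j) = 1"
  have X: "?X i \<noteq> 0" for i using seed by (rule is_seed_nonzero)
  let ?g = "\<Sum>j\<in>UNIV. gpow (yhat_exponent S j) (a j)"
  have "laurent_monomial ?X ?g = laurent_monomial ?X 0"
    using prod by (simp add: laurent_monomial_sum[OF X] laurent_monomial_gpow[OF X] yhat_eq_monomial)
  then have "?g = 0" using laurent_monomial_inj seed unfolding is_seed_def by blast
  let ?\<delta> = "\<lambda>g :: 'n trop \<times> ('n \<Rightarrow>\<^sub>0 int). Poly_Mapping.lookup (fst g) i"
  have add: "additive ?\<delta>" by standard (simp add: lookup_add)
  have "?\<delta> ?g = (\<Sum>j\<in>UNIV. a j * ?\<delta> (yhat_exponent S j))"
    by (simp add: additive.sum[OF add] additive_gpow[OF add])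
  also have "\<dots> = (\<Sum>j\<in>UNIV. if j = i then a i else 0)"
    by (intro sum.cong) (auto simp: yhat_exponent_def principal trop_gen_def lookup_single when_def)
  also have "\<dots> = a i" by simp
  finally show "a i = 0" using \<open>?g = 0\<close> by simp
qed

section \<open>The upper bound of a seed\<close>

lemma tree_edge_sym: "tree_edge k t t' \<Longrightarrow> tree_edge k t' t"
  by (auto simp: tree_edge_def)

lemma tree_edge_vertices: "tree_edge k t t' \<Longrightarrow> t \<in> tree_vertices" "tree_edge k t t' \<Longrightarrow> t' \<in> tree_vertices"
  by (simp_all add: tree_edge_def)

lemma tree_edge_exists:
  assumes "t \<in> tree_vertices"
  obtains t' where "tree_edge k t t'"
proof (cases "\<exists>w. t = k # w")
  case True
  then obtain w where "t = k # w" by blast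
  moreover from this have "w \<in> tree_vertices" using assms by (auto simp: tree_vertices_def distinct_adj_Cons)
  ultimately have "tree_edge k t w" using assms by (auto simp: tree_edge_def)
  then show ?thesis by (rule that)
next
  case False
  then have "k # t \<in> tree_vertices" using assms by (cases t) (auto simp: tree_vertices_def)
  then have "tree_edge k t (k # t)" using assms by (auto simp: tree_edge_def)
  then show ?thesis by (rule that)
qed

lemma tree_propagate:
  assumes t0: "t0 \<in> tree_vertices" and t: "t \<in> tree_vertices" and base: "Q t0"
    and step: "\<And>k t t'. tree_edge k t t' \<Longrightarrow> Q t \<Longrightarrow> Q t'"
  shows "Q t"
proof -
  have edge: "tree_edge k w (k # w)" if "k # w \<in> tree_vertices" for k w
    using that by (auto simp: tree_edge_def tree_vertices_def distinct_adj_Cons)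
  have tl: "w \<in> tree_vertices" if "k # w \<in> tree_vertices" for k :: 'a and w
    using that by (auto simp: tree_vertices_def distinct_adj_Cons)
  have nil: "Q []" using t0 base
  proof (induction t0)
    case (Cons k w)
    have "Q w" by (rule step[OF edge[OF Cons.prems(1), THEN tree_edge_sym] Cons.prems(2)])
    then show ?case by (rule Cons.IH[OF tl[OF Cons.prems(1)]])
  qed
  show ?thesis using t
  proof (induction t)
    case (Cons k w)
    show ?case by (rule step[OF edge[OF Cons.prems] Cons.IH[OF tl[OF Cons.prems]]])
  qed (rule nil)
qed

lemma cluster_seed_mutation_in_laurent_ring:
  fixes S :: "('p::semifield, 'n::{finite,linorder}) seed"
  assumes X: "\<And>i. cluster S i \<noteq> 0"
  shows "cluster (seed_mutation k S) i \<in> laurent_ring (cluster S)"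
proof (cases "i = k")
  case True
  have "cluster (seed_mutation k S) k =
     (P_elem (coeffs S k) * (\<Prod>i\<in>UNIV. cluster S i powi pos_part (exchange_matrix S $ i $ k))
       + (\<Prod>i\<in>UNIV. cluster S i powi pos_part (- exchange_matrix S $ i $ k)))
     * (P_elem (- (coeffs S k \<oplus> 0)) * inverse (cluster S k))"
    by (simp add: cluster_seed_mutation_binomial P_elem_uminus divide_inverse)
  also have "\<dots> \<in> laurent_ring (cluster S)"
    by (intro laurent_ring_mult[OF X] laurent_ring_add[OF X] laurent_ring_prod[OF X] laurent_ring_powi[OF X]
        laurent_ring_P_elem[OF X] laurent_ring_inverse_var[OF X])
  finally show ?thesis using True by simp
next
  case False
  then show ?thesis using laurent_ring_var[of "cluster S" i, OF X] by (simp add: cluster_seed_mutation_other)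
qed

lemma cluster_pattern_seed: "cluster_pattern S \<Longrightarrow> t \<in> tree_vertices \<Longrightarrow> is_seed (S t)"
  by (simp add: cluster_pattern_def)

lemma cluster_pattern_edge: "cluster_pattern S \<Longrightarrow> tree_edge k t t' \<Longrightarrow> S t' = seed_mutation k (S t)"
  by (simp add: cluster_pattern_def)

text \<open>
  The intersection of the Laurent rings of a seed and of its neighbours, as introduced by Berenstein,
  Fomin and Zelevinsky.
\<close>

definition upper_bound :: "('n list \<Rightarrow> ('p::semifield, 'n::{finite,linorder}) seed) \<Rightarrow> 'n list \<Rightarrow> ('p, 'n) ambient set" where
  "upper_bound S t = {e \<in> laurent_ring (cluster (S t)). \<forall>k t'. tree_edge k t t' \<longrightarrow> e \<in> laurent_ring (cluster (S t'))}"

lemma upper_boundD: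
  "e \<in> upper_bound S t \<Longrightarrow> e \<in> laurent_ring (cluster (S t))"
  "e \<in> upper_bound S t \<Longrightarrow> tree_edge k t t' \<Longrightarrow> e \<in> laurent_ring (cluster (S t'))"
  by (simp_all add: upper_bound_def)

lemma upper_boundI:
  assumes "e \<in> laurent_ring (cluster (S t))"
    and "\<And>k t'. tree_edge k t t' \<Longrightarrow> e \<in> laurent_ring (cluster (S t'))"
  shows "e \<in> upper_bound S t"
  using assms by (simp add: upper_bound_def)

text \<open>
  If \<open>x\<^sub>k\<close> had a negative exponent, then \<open>x\<^sub>k = (1 + yhat\<^sub>k) W / x\<^sub>k'\<close> would make \<open>1 + yhat\<^sub>k\<close> invertible in the
  Laurent ring of the neighbour.
\<close>

lemma monomial_nonneg_exponent:
  fixes S :: "('p::semifield, 'n::{finite,linorder}) seed"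
  assumes seed: "is_seed S" and seed': "is_seed (seed_mutation k S)"
    and e: "laurent_monomial (cluster S) a \<in> laurent_ring (cluster (seed_mutation k S))"
  shows "0 \<le> Poly_Mapping.lookup (snd a) k"
proof (rule ccontr)
  let ?X = "cluster S" and ?Z = "cluster (seed_mutation k S)" and ?a = "Poly_Mapping.lookup (snd a) k"
  assume "\<not> 0 \<le> ?a"
  then have a: "?a = - int (Suc (nat (- ?a) - 1))" by linarith
  then obtain m where m: "?a = - int (Suc m)" by blast
  have X: "?X i \<noteq> 0" and Z: "?Z i \<noteq> 0" for i using seed seed' by (auto simp: is_seed_nonzero)
  have free: "free_generating ?Z" using seed' by (simp add: is_seed_def)
  note sss = is_seed_sss[OF seed]
  have ZX: "?X i = ?Z i" if "i \<noteq> k" for i using that by (simp add: cluster_seed_mutation_other)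
  have FX: "monomials_without ?X k = monomials_without ?Z k" by (rule monomials_without_cong) (rule ZX)
  obtain W where W: "W \<in> monomials_without ?X k" and rel: "?X k * ?Z k = (1 + yhat S k) * W"
    by (rule exchange_relation[OF X sss])
  have y: "yhat S k = laurent_monomial ?Z (yhat_exponent S k)"
    unfolding yhat_eq_monomial
    by (rule laurent_monomial_cong[OF _ ZX]) (simp_all add: sign_skew_symmetric_diag[OF sss])
  let ?b = "a + (0, Poly_Mapping.single k (int (Suc m)))"
  define u where "u = laurent_monomial ?X a * ?X k ^ Suc m"
  have "u = laurent_monomial ?X ?b"
    unfolding u_def laurent_monomial_add[OF X] laurent_monomial_var[OF X] power_int_of_nat ..
  moreover have "Poly_Mapping.lookup (snd ?b) k = 0" using m by (simp add: lookup_add)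
  ultimately have "u \<in> monomials_without ?X k" unfolding monomials_without_def by blast
  then have u: "u \<in> monomials_without ?Z k" by (simp only: FX)
  have W0: "W \<noteq> 0" and u0: "u \<noteq> 0" using monomials_without_nonzero[OF X W] monomials_without_nonzero[OF Z u] by auto
  let ?y = "1 + yhat S k"
  define s where "s = laurent_monomial ?X a * ?y ^ m * W ^ Suc m * inverse (?Z k) ^ Suc m * inverse u"
  have "?X k = ?y * W * inverse (?Z k)" using rel Z[of k] by (simp add: field_simps)
  then have "?X k ^ Suc m = ?y * (?y ^ m * W ^ Suc m * inverse (?Z k) ^ Suc m)"
    by (simp add: power_mult_distrib mult_ac)
  then have "?y * s = u * inverse u"
    unfolding s_def u_def by (simp only: mult_ac)
  then have "?y * s = laurent_monomial ?Z 0" using u0 by simp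
  moreover have "s \<in> laurent_ring ?Z"
    unfolding s_def
  proof (intro laurent_ring_mult[OF Z] laurent_ring_power[OF Z] e laurent_ring_inverse_var[OF Z])
    show "?y \<in> laurent_ring ?Z" unfolding y by (intro laurent_ring_add[OF Z] laurent_ring_1[OF Z] laurent_monomial_in_ring[OF Z])
    show "W \<in> laurent_ring ?Z" using W unfolding FX by (rule monomials_without_in_ring[OF Z])
    show "inverse u \<in> laurent_ring ?Z" by (rule monomials_without_in_ring[OF Z monomials_without_inverse[OF Z u]])
  qed
  ultimately show False using one_plus_monomial_not_unit[OF free] unfolding y by blast
qed

context
  fixes S :: "'n::{finite,linorder} list \<Rightarrow> ('n trop, 'n) seed" and t0 :: "'n list"
  assumes pattern: "cluster_pattern S" and t0: "t0 \<in> tree_vertices" and principal: "principal_coefficients S t0"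
begin

lemmas seed_at = cluster_pattern_seed[OF pattern]
lemmas seed_along_edge = cluster_pattern_edge[OF pattern]

lemma yhat_independent_at:
  assumes "t \<in> tree_vertices"
  shows "mult_independent (yhat (S t))"
proof (rule tree_propagate[of t0 t "\<lambda>t. mult_independent (yhat (S t))", OF t0 assms])
  show "mult_independent (yhat (S t0))"
    using principal by (intro mult_independent_principal seed_at t0) (simp add: principal_coefficients_def)
  fix k t t' assume edge: "tree_edge k t t'" and indep: "mult_independent (yhat (S t))"
  have "is_seed (S t)" "is_seed (S t')" using seed_at tree_edge_vertices[OF edge] by blast+
  then show "mult_independent (yhat (S t'))"
    unfolding seed_along_edge[OF edge] by (rule mult_independent_mutation[OF _ _ indep])
qed

text \<open>
  For a neighbour of the new seed \<open>s\<close> in direction \<open>j \<noteq> k\<close>, start from \<open>s\<close>: the old seed is \<open>\<mu>\<^sub>k s\<close>, its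
  neighbour in direction \<open>j\<close> is \<open>\<mu>\<^sub>j \<mu>\<^sub>k s\<close>, and membership has to be transferred to \<open>\<mu>\<^sub>j s\<close>.
\<close>

lemma upper_bound_mutation:
  assumes edge: "tree_edge k t s" and e: "e \<in> upper_bound S t"
  shows "e \<in> upper_bound S s"
proof -
  have s: "s \<in> tree_vertices" and t: "t \<in> tree_vertices" using tree_edge_vertices[OF edge] by blast+
  have Lt: "e \<in> laurent_ring (cluster (S t))" by (rule upper_boundD(1)[OF e])
  have Ls: "e \<in> laurent_ring (cluster (S s))" by (rule upper_boundD(2)[OF e edge])
  have St: "S t = seed_mutation k (S s)" by (rule seed_along_edge[OF tree_edge_sym[OF edge]])
  have "e \<in> laurent_ring (cluster (S s'))" if edge': "tree_edge j s s'" for j s'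
  proof (cases "j = k")
    case True
    then have "S s' = S t" using seed_along_edge[OF edge'] St by simp
    then show ?thesis using Lt by simp
  next
    case False
    have s': "s' \<in> tree_vertices" by (rule tree_edge_vertices(2)[OF edge'])
    have Ss': "S s' = seed_mutation j (S s)" by (rule seed_along_edge[OF edge'])
    obtain t' where t': "tree_edge j t t'" using tree_edge_exists[OF t] .
    have St': "S t' = seed_mutation j (seed_mutation k (S s))" using seed_along_edge[OF t'] St by simp
    have "t' \<in> tree_vertices" by (rule tree_edge_vertices(2)[OF t'])
    note seeds = seed_at[OF s] seed_at[OF s', unfolded Ss'] seed_at[OF t, unfolded St] seed_at[OF this, unfolded St']
    have "e \<in> laurent_ring (cluster (S t'))" by (rule upper_boundD(2)[OF e t'])
    then show ?thesis
      unfolding Ss' St'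
      by (rule laurent_ring_transfer[OF seeds False separating_degree[OF seed_at[OF s] yhat_independent_at[OF s] False] Ls])
  qed
  with Ls show ?thesis by (rule upper_boundI)
qed

lemma upper_bound_invariant:
  assumes "t \<in> tree_vertices" "t' \<in> tree_vertices" "e \<in> upper_bound S t"
  shows "e \<in> upper_bound S t'"
proof (rule tree_propagate[of t t' "\<lambda>t. e \<in> upper_bound S t", OF assms])
  fix k t t' assume "tree_edge k t t'" "e \<in> upper_bound S t"
  then show "e \<in> upper_bound S t'" by (rule upper_bound_mutation)
qed

lemma cluster_variable_in_upper_bound:
  assumes t: "t \<in> tree_vertices" and t': "t' \<in> tree_vertices"
  shows "cluster_variable S l t \<in> upper_bound S t'"
proof (rule upper_bound_invariant[OF t t'])
  have "cluster (S t) l \<in> laurent_ring (cluster (S t'))" if edge: "tree_edge k t t'" for k t'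
  proof -
    have "is_seed (S t')" using seed_at tree_edge_vertices[OF edge] by blast+
    then show ?thesis
      unfolding seed_along_edge[OF tree_edge_sym[OF edge]]
      by (intro cluster_seed_mutation_in_laurent_ring is_seed_nonzero)
  qed
  with laurent_ring_var[OF is_seed_nonzero[OF seed_at[OF t]]] show "cluster_variable S l t \<in> upper_bound S t"
    by (rule upper_boundI)
qed

lemma monomial_in_upper_bound:
  assumes t: "t \<in> tree_vertices" and c: "c = 1 \<or> c = -1"
    and e: "of_int c * laurent_monomial (cluster (S t)) a \<in> upper_bound S t"
  shows "0 \<le> Poly_Mapping.lookup (snd a) k"
proof -
  obtain t' where edge: "tree_edge k t t'" using tree_edge_exists[OF t] .
  have t': "t' \<in> tree_vertices" using tree_edge_vertices[OF edge] by blast+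
  have St': "S t' = seed_mutation k (S t)" by (rule seed_along_edge[OF edge])
  have "of_int c * laurent_monomial (cluster (S t)) a \<in> laurent_ring (cluster (S t'))"
    by (rule upper_boundD(2)[OF e edge])
  then have "laurent_monomial (cluster (S t)) a \<in> laurent_ring (cluster (S t'))"
    using c laurent_ring_minus[OF is_seed_nonzero[OF seed_at[OF t']]] by fastforce
  then show ?thesis
    using monomial_nonneg_exponent[OF seed_at[OF t] seed_at[OF t', unfolded St']] St' by simp
qed

text \<open>
  In the Laurent ring of its own cluster a cluster variable is a unit, so both factors are monomials up to
  sign. Their exponents are nonnegative and add up to a unit vector.
\<close>

lemma cluster_variable_irreducible:
  assumes t: "t \<in> tree_vertices" and e: "e \<in> upper_bound S t" and e': "e' \<in> upper_bound S t"
    and eq: "cluster_variable S l t = e * e'"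
  obtains p where "e = P_elem p \<or> e = - P_elem p" | p where "e' = P_elem p \<or> e' = - P_elem p"
proof -
  let ?X = "cluster (S t)"
  have X: "?X i \<noteq> 0" for i by (rule is_seed_nonzero[OF seed_at[OF t]])
  have free: "free_generating ?X" using seed_at[OF t] by (simp add: is_seed_def)
  note hom = laurent_is_ring_hom[of ?X, OF X]
  obtain f g where f: "e = laurent ?X f" and g: "e' = laurent ?X g"
    using upper_boundD(1)[OF e] upper_boundD(1)[OF e'] unfolding laurent_ring_def by blast
  let ?h = "(0, Poly_Mapping.single l 1) :: 'n trop \<times> ('n \<Rightarrow>\<^sub>0 int)"
  have "laurent ?X (f * g - Poly_Mapping.single ?h 1) = 0"
    using eq by (simp add: is_ring_hom_diff[OF hom] is_ring_homD[OF hom] laurent_single f g laurent_monomial_var[OF X])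
  then have "f * g - Poly_Mapping.single ?h 1 = 0" by (rule laurent_inj[OF free])
  then have "f * g = Poly_Mapping.single ?h 1" by (simp only: right_minus_eq)
  then obtain a b c where a: "f = Poly_Mapping.single a c" and b: "g = Poly_Mapping.single b c"
    and c: "c = 1 \<or> c = -1" and ab: "a + b = ?h" by (rule monomial_factors)
  have ea: "e = of_int c * laurent_monomial ?X a" and eb: "e' = of_int c * laurent_monomial ?X b"
    by (simp_all add: f g a b laurent_single)
  have a_nonneg: "0 \<le> Poly_Mapping.lookup (snd a) k" and b_nonneg: "0 \<le> Poly_Mapping.lookup (snd b) k" for k
    using monomial_in_upper_bound[OF t c] e e' ea eb by auto
  have sum: "Poly_Mapping.lookup (snd a) k + Poly_Mapping.lookup (snd b) k = (if l = k then 1 else 0)" for k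
  proof -
    have "Poly_Mapping.lookup (snd (a + b)) k = (if l = k then 1 else 0)"
      unfolding ab by (simp add: lookup_single when_def)
    then show ?thesis by (simp add: lookup_add)
  qed
  have const: "of_int c * laurent_monomial ?X (d :: 'n trop \<times> ('n \<Rightarrow>\<^sub>0 int)) = P_elem (fst d)
      \<or> of_int c * laurent_monomial ?X d = - P_elem (fst d)"
    if "\<And>k. Poly_Mapping.lookup (snd d) k = 0" for d
    using c that by (auto simp: laurent_monomial_def)
  show ?thesis
  proof (cases "Poly_Mapping.lookup (snd a) l = 0")
    case True
    then have "Poly_Mapping.lookup (snd a) k = 0" for k
      using sum[of k] a_nonneg[of k] b_nonneg[of k] by (cases "l = k") auto
    then show ?thesis using const[of a] ea that(1) by auto
  next
    case False
    then have "Poly_Mapping.lookup (snd b) k = 0" for k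
      using sum[of k] a_nonneg[of k] b_nonneg[of k] by (cases "l = k") auto
    then show ?thesis using const[of b] eb that(2) by auto
  qed
qed

end

section \<open>Boundedness at positive real points\<close>

text \<open>
  The evaluation at \<open>x\<^sub>1 = \<dots> = x\<^sub>n = 1\<close>, \<open>y\<^sub>i = s\<close> and \<open>y\<^sub>j = 1\<close> for \<open>j \<noteq> i\<close>.
\<close>

definition real_point :: "'n \<Rightarrow> real \<Rightarrow> (('n trop \<times> ('n \<Rightarrow>\<^sub>0 int)) \<Rightarrow>\<^sub>0 int) \<Rightarrow> real" where
  "real_point i s = lin_ext of_int (\<lambda>g. s powi Poly_Mapping.lookup (fst g) i)"

definition bounded_near_zero :: "('n \<Rightarrow> ('n trop, 'n::{finite,linorder}) ambient) \<Rightarrow> 'n \<Rightarrow> ('n trop, 'n) ambient \<Rightarrow> bool" where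
  "bounded_near_zero X i z \<longleftrightarrow> (\<exists>c C. 0 < c \<and>
     (\<forall>s. 0 < s \<and> s \<le> 1 \<longrightarrow> (\<exists>r. spec_rel (laurent X) (real_point i s) z r \<and> c \<le> r \<and> r \<le> C)))"

context
  fixes X :: "'n \<Rightarrow> ('n trop, 'n::{finite,linorder}) ambient" and i :: 'n
  assumes free: "free_generating X"
begin

lemma specialization_real_point:
  assumes "s \<noteq> 0"
  shows "specialization (laurent X) (real_point i s)"
proof
  show "is_ring_hom (laurent X)" by (rule laurent_is_ring_hom) (rule free_generating_nonzero[OF free])
  show "is_ring_hom (real_point i s)" unfolding real_point_def
    by (rule lin_ext_is_ring_hom[OF is_ring_hom_of_int]) (use assms in \<open>auto simp: lookup_add power_int_add\<close>)
  show "f = 0" if "laurent X f = 0" for f using laurent_inj[OF free that] .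
qed

lemma spec_monomial:
  "spec_rel (laurent X) (real_point i s) (laurent_monomial X g) (s powi Poly_Mapping.lookup (fst g) i)" if "s \<noteq> 0"
  using specialization.spec_base[OF specialization_real_point[OF that], of "Poly_Mapping.single g 1"]
  by (simp add: laurent_single) (simp add: real_point_def lin_ext_single is_ring_hom_of_int)

lemma spec_P_elem:
  "s \<noteq> 0 \<Longrightarrow> spec_rel (laurent X) (real_point i s) (P_elem p) (s powi Poly_Mapping.lookup p i)"
  using spec_monomial[of s "(p, 0)"] by (simp add: laurent_monomial_def)

lemma bounded_var: "bounded_near_zero X i (X j)"
  unfolding bounded_near_zero_def
proof (rule exI[of _ 1], rule exI[of _ 1], intro conjI allI impI)
  fix s :: real assume "0 < s \<and> s \<le> 1"
  then show "\<exists>r. spec_rel (laurent X) (real_point i s) (X j) r \<and> 1 \<le> r \<and> r \<le> 1"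
    using spec_monomial[of s "(0, Poly_Mapping.single j 1)"]
    by (intro exI[of _ 1]) (simp add: laurent_monomial_var[OF free_generating_nonzero[OF free]])
qed simp

lemma bounded_1: "bounded_near_zero X i 1"
  unfolding bounded_near_zero_def
proof (rule exI[of _ 1], rule exI[of _ 1], intro conjI allI impI)
  fix s :: real assume "0 < s \<and> s \<le> 1"
  then show "\<exists>r. spec_rel (laurent X) (real_point i s) 1 r \<and> 1 \<le> r \<and> r \<le> 1"
    using specialization.spec_1[OF specialization_real_point[of s]] by (intro exI[of _ 1]) simp
qed simp

lemma bounded_mult:
  assumes "bounded_near_zero X i z" "bounded_near_zero X i w"
  shows "bounded_near_zero X i (z * w)"
proof -
  obtain c C where z: "0 < c" "\<And>s. 0 < s \<and> s \<le> 1 \<Longrightarrow> \<exists>r. spec_rel (laurent X) (real_point i s) z r \<and> c \<le> r \<and> r \<le> C"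
    using assms(1) unfolding bounded_near_zero_def by blast
  obtain d D where w: "0 < d" "\<And>s. 0 < s \<and> s \<le> 1 \<Longrightarrow> \<exists>r. spec_rel (laurent X) (real_point i s) w r \<and> d \<le> r \<and> r \<le> D"
    using assms(2) unfolding bounded_near_zero_def by blast
  show ?thesis unfolding bounded_near_zero_def
  proof (rule exI[of _ "c * d"], rule exI[of _ "C * D"], intro conjI allI impI)
    show "0 < c * d" using z(1) w(1) by simp
    fix s :: real assume s: "0 < s \<and> s \<le> 1"
    obtain r where r: "spec_rel (laurent X) (real_point i s) z r" "c \<le> r" "r \<le> C" using z(2)[OF s] by blast
    obtain q where q: "spec_rel (laurent X) (real_point i s) w q" "d \<le> q" "q \<le> D" using w(2)[OF s] by blast
    have sp: "specialization (laurent X) (real_point i s)" by (rule specialization_real_point) (use s in simp)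
    have "spec_rel (laurent X) (real_point i s) (z * w) (r * q)"
      by (rule specialization.spec_mult[OF sp r(1) q(1)])
    moreover have "c * d \<le> r * q" "r * q \<le> C * D" using r q z(1) w(1) by (auto intro!: mult_mono)
    ultimately show "\<exists>r. spec_rel (laurent X) (real_point i s) (z * w) r \<and> c * d \<le> r \<and> r \<le> C * D"
      by blast
  qed
qed

lemma bounded_inverse:
  assumes "bounded_near_zero X i z"
  shows "bounded_near_zero X i (inverse z)"
proof -
  obtain c C where z: "0 < c" "\<And>s. 0 < s \<and> s \<le> 1 \<Longrightarrow> \<exists>r. spec_rel (laurent X) (real_point i s) z r \<and> c \<le> r \<and> r \<le> C"
    using assms unfolding bounded_near_zero_def by blast
  have C: "0 < C" using z(2)[of 1] z(1) by force
  show ?thesis unfolding bounded_near_zero_def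
  proof (rule exI[of _ "inverse C"], rule exI[of _ "inverse c"], intro conjI allI impI)
    show "0 < inverse C" using C by simp
    fix s :: real assume s: "0 < s \<and> s \<le> 1"
    obtain r where r: "spec_rel (laurent X) (real_point i s) z r" "c \<le> r" "r \<le> C" using z(2)[OF s] by blast
    have sp: "specialization (laurent X) (real_point i s)" by (rule specialization_real_point) (use s in simp)
    have "spec_rel (laurent X) (real_point i s) (inverse z) (inverse r)"
      by (rule specialization.spec_inverse[OF sp r(1)]) (use r z(1) in simp)
    moreover have "inverse C \<le> inverse r" "inverse r \<le> inverse c" using r z(1) by (auto intro!: le_imp_inverse_le)
    ultimately show "\<exists>r. spec_rel (laurent X) (real_point i s) (inverse z) r \<and> inverse C \<le> r \<and> r \<le> inverse c"
      by blast
  qed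
qed

text \<open>
  The coefficient \<open>s\<^bsup>a\<^esup>\<close> with \<open>a \<ge> 0\<close> lies in \<open>[0,1]\<close>; the second summand alone keeps the sum away from 0.
\<close>

lemma bounded_add:
  assumes "bounded_near_zero X i z" "bounded_near_zero X i w" and p: "0 \<le> Poly_Mapping.lookup p i"
  shows "bounded_near_zero X i (P_elem p * z + w)"
proof -
  obtain c C where z: "0 < c" "\<And>s. 0 < s \<and> s \<le> 1 \<Longrightarrow> \<exists>r. spec_rel (laurent X) (real_point i s) z r \<and> c \<le> r \<and> r \<le> C"
    using assms(1) unfolding bounded_near_zero_def by blast
  obtain d D where w: "0 < d" "\<And>s. 0 < s \<and> s \<le> 1 \<Longrightarrow> \<exists>r. spec_rel (laurent X) (real_point i s) w r \<and> d \<le> r \<and> r \<le> D"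
    using assms(2) unfolding bounded_near_zero_def by blast
  show ?thesis unfolding bounded_near_zero_def
  proof (rule exI[of _ d], rule exI[of _ "C + D"], intro conjI allI impI)
    show "0 < d" by fact
    fix s :: real assume s: "0 < s \<and> s \<le> 1"
    let ?s = "s powi Poly_Mapping.lookup p i"
    obtain r where r: "spec_rel (laurent X) (real_point i s) z r" "c \<le> r" "r \<le> C" using z(2)[OF s] by blast
    obtain q where q: "spec_rel (laurent X) (real_point i s) w q" "d \<le> q" "q \<le> D" using w(2)[OF s] by blast
    have sp: "specialization (laurent X) (real_point i s)" by (rule specialization_real_point) (use s in simp)
    have sum: "spec_rel (laurent X) (real_point i s) (P_elem p * z + w) (?s * r + q)"
      by (intro specialization.spec_add[OF sp] specialization.spec_mult[OF sp] spec_P_elem r q) (use s in simp)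
    have "0 \<le> ?s" "?s \<le> 1" using s p by (simp_all add: power_int_le_one)
    then have "0 \<le> ?s * r" "?s * r \<le> 1 * r" using r z(1) by (auto intro!: mult_right_mono)
    then have "d \<le> ?s * r + q" "?s * r + q \<le> C + D" using q r by auto
    with sum show "\<exists>r. spec_rel (laurent X) (real_point i s) (P_elem p * z + w) r \<and> d \<le> r \<and> r \<le> C + D"
      by blast
  qed
qed

lemma bounded_P_elem_mult:
  assumes z: "bounded_near_zero X i z" and p: "Poly_Mapping.lookup p i = 0"
  shows "bounded_near_zero X i (P_elem p * z)"
proof (rule bounded_mult[OF _ z])
  show "bounded_near_zero X i (P_elem p)"
    unfolding bounded_near_zero_def
  proof (rule exI[of _ 1], rule exI[of _ 1], intro conjI allI impI)
    fix s :: real assume "0 < s \<and> s \<le> 1"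
    then show "\<exists>r. spec_rel (laurent X) (real_point i s) (P_elem p) r \<and> 1 \<le> r \<and> r \<le> 1"
      using spec_P_elem[of s p] p by (intro exI[of _ 1]) simp
  qed simp
qed

lemma bounded_power: "bounded_near_zero X i z \<Longrightarrow> bounded_near_zero X i (z ^ n)"
  by (induction n) (auto intro: bounded_1 bounded_mult)

lemma bounded_powi: "bounded_near_zero X i z \<Longrightarrow> bounded_near_zero X i (z powi n)"
  by (auto simp: power_int_def intro: bounded_power bounded_inverse)

lemma bounded_prod: "(\<And>j. j \<in> A \<Longrightarrow> bounded_near_zero X i (f j)) \<Longrightarrow> bounded_near_zero X i (prod f A)"
  by (induction A rule: infinite_finite_induct) (auto intro: bounded_1 bounded_mult)

text \<open>
  Dividing by \<open>y\<^sub>k \<oplus> 1 = s\<^bsup>min(a,0)\<^esup>\<close> normalises the two coefficients \<open>y\<^sub>k = s\<^sup>a\<close> and 1 of the exchange relation in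
  such a way that one of them becomes 1 and the other one has a nonnegative exponent.
\<close>

lemma bounded_cluster_mutation:
  fixes S :: "('n trop, 'n) seed"
  assumes S: "\<And>j. bounded_near_zero X i (cluster S j)"
  shows "bounded_near_zero X i (cluster (seed_mutation k S) j)"
proof (cases "j = k")
  case True
  let ?Y = "coeffs S k"
  define A where "A = (\<Prod>i\<in>UNIV. cluster S i powi pos_part (exchange_matrix S $ i $ k))"
  define C where "C = (\<Prod>i\<in>UNIV. cluster S i powi pos_part (- exchange_matrix S $ i $ k))"
  have A: "bounded_near_zero X i A" and C: "bounded_near_zero X i C"
    unfolding A_def C_def by (intro bounded_prod bounded_powi S)+
  have min: "Poly_Mapping.lookup (?Y \<oplus> 0) i = min (Poly_Mapping.lookup ?Y i) 0"
    by (simp add: splus_poly_mapping.rep_eq)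
  let ?p = "?Y - (?Y \<oplus> 0)" and ?q = "- (?Y \<oplus> 0)"
  have eq: "cluster (seed_mutation k S) k = (P_elem ?p * A + P_elem ?q * C) * inverse (cluster S k)"
  proof -
    have "P_elem ?p = (P_elem ?Y / P_elem (?Y \<oplus> 0) :: ('n trop, 'n) ambient)"
      unfolding diff_conv_add_uminus P_elem_add P_elem_uminus divide_inverse ..
    then show ?thesis
      unfolding cluster_seed_mutation_binomial A_def[symmetric] C_def[symmetric] P_elem_uminus
      by (simp add: divide_inverse distrib_left distrib_right mult_ac)
  qed
  have "bounded_near_zero X i (P_elem ?p * A + P_elem ?q * C)"
  proof (cases "0 \<le> Poly_Mapping.lookup ?Y i")
    case True
    then have "Poly_Mapping.lookup ?q i = 0" "0 \<le> Poly_Mapping.lookup ?p i" by (simp_all add: min lookup_minus)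
    then have "bounded_near_zero X i (P_elem ?q * C)" "0 \<le> Poly_Mapping.lookup ?p i"
      using bounded_P_elem_mult C by blast+
    then show ?thesis by (intro bounded_add A)
  next
    case False
    then have "Poly_Mapping.lookup ?p i = 0" "0 \<le> Poly_Mapping.lookup ?q i" by (simp_all add: min lookup_minus)
    then have "bounded_near_zero X i (P_elem ?p * A)" "0 \<le> Poly_Mapping.lookup ?q i"
      using bounded_P_elem_mult A by blast+
    then have "bounded_near_zero X i (P_elem ?q * C + P_elem ?p * A)" by (intro bounded_add C)
    then show ?thesis by (simp only: add.commute)
  qed
  then show ?thesis unfolding True eq by (intro bounded_mult bounded_inverse S)
next
  case False
  then show ?thesis using S[of j] by (simp add: cluster_seed_mutation_other)
qed

lemma bounded_coefficient_trivial:
  assumes b: "bounded_near_zero X i (of_int c * P_elem p * X k)" and c: "c = 1 \<or> c = -1"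
  shows "c = 1 \<and> Poly_Mapping.lookup p i = 0"
proof -
  have b': "bounded_near_zero X i (of_int c * P_elem p)"
    using bounded_mult[OF b bounded_inverse[OF bounded_var[of k]]] free_generating_nonzero[OF free, of k]
    by (simp add: mult.assoc)
  let ?a = "Poly_Mapping.lookup p i"
  obtain d D where d: "0 < d" and bnd: "\<And>s. 0 < s \<and> s \<le> 1 \<Longrightarrow>
      \<exists>r. spec_rel (laurent X) (real_point i s) (of_int c * P_elem p) r \<and> d \<le> r \<and> r \<le> D"
    using b' unfolding bounded_near_zero_def by blast
  have val: "d \<le> of_int c * s powi ?a \<and> of_int c * s powi ?a \<le> D" if s: "0 < s" "s \<le> 1" for s
  proof -
    have sp: "specialization (laurent X) (real_point i s)" by (rule specialization_real_point) (use s in simp)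
    have "spec_rel (laurent X) (real_point i s) (of_int c * P_elem p) (of_int c * s powi ?a)"
      using spec_monomial[of s "(p, 0)"] s
        specialization.spec_base[OF sp, of "Poly_Mapping.single (p, 0) c"]
      by (simp add: laurent_single laurent_monomial_def real_point_def lin_ext_single is_ring_hom_of_int)
    then show ?thesis using bnd[of s] s specialization.spec_unique[OF sp] by blast
  qed
  have c1: "c = 1" using val[of 1] d c by auto
  have D: "0 < D" using val[of 1] d by auto
  have small: "s ^ n \<le> s" if "0 < s" "s \<le> 1" "n > 0" for s :: real and n
    using power_decreasing[of 1 n s] that by simp
  have "?a = 0"
  proof (rule ccontr)
    assume "?a \<noteq> 0"
    then consider "?a > 0" | "?a < 0" by linarith
    then show False
    proof cases
      case 1
      define s where "s = min 1 (d / 2)"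
      have s: "0 < s" "s \<le> 1" "s < d" using d by (auto simp: s_def)
      have "s powi ?a \<le> s" using 1 s small[of s "nat ?a"] by (simp add: power_int_def)
      then show False using val[of s] s c1 by simp
    next
      case 2
      define s where "s = min 1 (inverse D / 2)"
      have s: "0 < s" "s \<le> 1" "s < inverse D" using D by (auto simp: s_def min_less_iff_disj)
      have "inverse (s powi ?a) \<le> s" using 2 s small[of s "nat (- ?a)"] by (simp add: power_int_def power_inverse)
      moreover have "inverse D \<le> inverse (s powi ?a)"
        using val[of s] s c1 by (intro le_imp_inverse_le) auto
      ultimately show False using s by simp
    qed
  qed
  then show ?thesis using c1 by simp
qed

end

section \<open>Homogeneity and the specialisation at ones\<close>

definition hat_monomial :: "('n trop, 'n::{finite,linorder}) seed \<Rightarrow> 'n trop \<Rightarrow> ('n trop, 'n) ambient" where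
  "hat_monomial S p = (\<Prod>j\<in>UNIV. yhat S j powi Poly_Mapping.lookup p j)"

text \<open>
  The substitution \<open>y\<^sub>j \<mapsto> yhat\<^sub>j\<close> on the group ring of \<open>\<P>\<close>.
\<close>

definition hat_eval :: "('n trop, 'n::{finite,linorder}) seed \<Rightarrow> ('n trop \<Rightarrow>\<^sub>0 int) \<Rightarrow> ('n trop, 'n) ambient" where
  "hat_eval S = lin_ext of_int (hat_monomial S)"

definition degree_zero :: "('n trop, 'n::{finite,linorder}) seed \<Rightarrow> ('n trop, 'n) ambient set" where
  "degree_zero S = {hat_eval S a / hat_eval S b |a b. hat_eval S b \<noteq> 0}"

definition homogeneous :: "('n trop, 'n::{finite,linorder}) seed \<Rightarrow> ('n trop, 'n) ambient set" where
  "homogeneous S = {laurent_monomial (cluster S) (0, g) * w |g w. w \<in> degree_zero S}"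

context
  fixes S :: "('n trop, 'n::{finite,linorder}) seed"
  assumes seed: "is_seed S" and principal: "coeffs S = trop_gen"
begin

lemma principal_cluster_nonzero: "cluster S i \<noteq> 0"
  by (rule is_seed_nonzero[OF seed])

lemma principal_cluster_free: "free_generating (cluster S)"
  using seed by (simp add: is_seed_def)

lemma principal_yhat_nonzero: "yhat S j \<noteq> 0"
  by (rule yhat_nonzero[OF principal_cluster_nonzero is_seed_sss[OF seed]])

lemma hat_eval_hom: "is_ring_hom (hat_eval S)"
  unfolding hat_eval_def
  by (rule lin_ext_is_ring_hom[OF is_ring_hom_of_int])
    (auto simp: hat_monomial_def lookup_add power_int_add principal_yhat_nonzero prod.distrib)

lemma hat_eval_single: "hat_eval S (Poly_Mapping.single p 1) = hat_monomial S p"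
  by (simp add: hat_eval_def lin_ext_single is_ring_hom_of_int)

lemma hat_eval_1: "hat_eval S 1 = 1" and hat_eval_0: "hat_eval S 0 = 0"
  using is_ring_homD[OF hat_eval_hom] by auto

text \<open>
  Principal coefficients enter here: the coefficient of \<open>\<Prod> yhat\<^sub>j\<^bsup>p\<^sub>j\<^esup>\<close> is exactly \<open>p\<close>.
\<close>

lemma hat_monomial_eq:
  obtains m where "hat_monomial S p = laurent_monomial (cluster S) (p, m)"
proof
  let ?g = "\<Sum>j\<in>UNIV. gpow (yhat_exponent S j) (Poly_Mapping.lookup p j)"
  have "fst ?g = p" by (simp add: fst_sum fst_gpow yhat_exponent_def principal trop_sum_gens)
  then have "?g = (p, snd ?g)" by (simp add: prod_eq_iff)
  moreover have "hat_monomial S p = laurent_monomial (cluster S) ?g"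
    by (simp add: hat_monomial_def laurent_monomial_sum[OF principal_cluster_nonzero] laurent_monomial_gpow[OF principal_cluster_nonzero] yhat_eq_monomial)
  ultimately show "hat_monomial S p = laurent_monomial (cluster S) (p, snd ?g)" by simp
qed

lemma degree_zeroI: "hat_eval S b \<noteq> 0 \<Longrightarrow> hat_eval S a / hat_eval S b \<in> degree_zero S"
  unfolding degree_zero_def by blast

lemma degree_zero_hat: "hat_eval S a \<in> degree_zero S"
  using degree_zeroI[of 1 a] by (simp add: hat_eval_1)

lemma degree_zero_1: "1 \<in> degree_zero S"
  using degree_zero_hat[of 1] by (simp add: hat_eval_1)

lemma degree_zero_add: "z \<in> degree_zero S \<Longrightarrow> w \<in> degree_zero S \<Longrightarrow> z + w \<in> degree_zero S"
proof -
  assume "z \<in> degree_zero S" "w \<in> degree_zero S"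
  then obtain a b c d where "hat_eval S b \<noteq> 0" "z = hat_eval S a / hat_eval S b"
    "hat_eval S d \<noteq> 0" "w = hat_eval S c / hat_eval S d" unfolding degree_zero_def by blast
  then have "z + w = hat_eval S (a * d + c * b) / hat_eval S (b * d)" "hat_eval S (b * d) \<noteq> 0"
    by (simp_all add: is_ring_homD[OF hat_eval_hom] add_frac_eq)
  then show ?thesis using degree_zeroI by simp
qed

lemma degree_zero_mult: "z \<in> degree_zero S \<Longrightarrow> w \<in> degree_zero S \<Longrightarrow> z * w \<in> degree_zero S"
proof -
  assume "z \<in> degree_zero S" "w \<in> degree_zero S"
  then obtain a b c d where "hat_eval S b \<noteq> 0" "z = hat_eval S a / hat_eval S b"
    "hat_eval S d \<noteq> 0" "w = hat_eval S c / hat_eval S d" unfolding degree_zero_def by blast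
  then have "z * w = hat_eval S (a * c) / hat_eval S (b * d)" "hat_eval S (b * d) \<noteq> 0"
    by (simp_all add: is_ring_homD[OF hat_eval_hom])
  then show ?thesis using degree_zeroI by simp
qed

lemma degree_zero_inverse: "z \<in> degree_zero S \<Longrightarrow> inverse z \<in> degree_zero S"
proof -
  assume "z \<in> degree_zero S"
  then obtain a b where "hat_eval S b \<noteq> 0" "z = hat_eval S a / hat_eval S b" unfolding degree_zero_def by blast
  then show ?thesis
    using degree_zeroI[of a b] degree_zero_hat[of 0] by (cases "hat_eval S a = 0") (auto simp: hat_eval_0)
qed

lemma degree_zero_powi: "z \<in> degree_zero S \<Longrightarrow> z powi n \<in> degree_zero S"
proof -
  have "w ^ m \<in> degree_zero S" if "w \<in> degree_zero S" for w m
    using that by (induction m) (auto intro: degree_zero_1 degree_zero_mult)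
  then show "z \<in> degree_zero S \<Longrightarrow> z powi n \<in> degree_zero S"
    by (auto simp: power_int_def intro: degree_zero_inverse)
qed

lemma degree_zero_yhat: "yhat S j \<in> degree_zero S"
proof -
  have "hat_monomial S (Poly_Mapping.single j 1) = (\<Prod>i\<in>UNIV. if i = j then yhat S j else 1)"
    unfolding hat_monomial_def by (intro prod.cong) (auto simp: lookup_single when_def)
  then have "yhat S j = hat_eval S (Poly_Mapping.single (Poly_Mapping.single j 1) 1)"
    by (simp only: hat_eval_single) simp
  then show ?thesis using degree_zero_hat by simp
qed

lemma homogeneousI: "w \<in> degree_zero S \<Longrightarrow> laurent_monomial (cluster S) (0, g) * w \<in> homogeneous S"
  unfolding homogeneous_def by blast

lemma homogeneous_degree_zero: "w \<in> degree_zero S \<Longrightarrow> w \<in> homogeneous S"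
  using homogeneousI[of w 0] by (simp flip: zero_prod_def)

lemma homogeneous_mult: "z \<in> homogeneous S \<Longrightarrow> w \<in> homogeneous S \<Longrightarrow> z * w \<in> homogeneous S"
proof -
  assume "z \<in> homogeneous S" "w \<in> homogeneous S"
  then obtain g h z' w' where z: "z = laurent_monomial (cluster S) (0, g) * z'" and z': "z' \<in> degree_zero S"
    and w: "w = laurent_monomial (cluster S) (0, h) * w'" and w': "w' \<in> degree_zero S"
    unfolding homogeneous_def by blast
  have "laurent_monomial (cluster S) (0, g + h)
      = laurent_monomial (cluster S) (0, g) * laurent_monomial (cluster S) (0, h)"
    using laurent_monomial_add[of "cluster S" "(0, g)" "(0, h)", OF principal_cluster_nonzero] by simp
  then have "z * w = laurent_monomial (cluster S) (0, g + h) * (z' * w')"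
    unfolding z w by (simp only: mult_ac)
  then show ?thesis using homogeneousI[OF degree_zero_mult[OF z' w']] by simp
qed

lemma homogeneous_inverse: "z \<in> homogeneous S \<Longrightarrow> inverse z \<in> homogeneous S"
proof -
  assume "z \<in> homogeneous S"
  then obtain g w where z: "z = laurent_monomial (cluster S) (0, g) * w" and w: "w \<in> degree_zero S"
    unfolding homogeneous_def by blast
  have "laurent_monomial (cluster S) (0, - g) = inverse (laurent_monomial (cluster S) (0, g))"
    using laurent_monomial_uminus[of "cluster S" "(0, g)", OF principal_cluster_nonzero] by simp
  then have "inverse z = laurent_monomial (cluster S) (0, - g) * inverse w"
    unfolding z by (simp only: inverse_mult_distrib)
  then show ?thesis using homogeneousI[OF degree_zero_inverse[OF w]] by simp
qed

lemma homogeneous_1: "1 \<in> homogeneous S"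
  by (intro homogeneous_degree_zero degree_zero_1)

lemma homogeneous_powi: "z \<in> homogeneous S \<Longrightarrow> z powi n \<in> homogeneous S"
proof -
  have "w ^ m \<in> homogeneous S" if "w \<in> homogeneous S" for w m
    using that by (induction m) (auto intro: homogeneous_1 homogeneous_mult)
  then show "z \<in> homogeneous S \<Longrightarrow> z powi n \<in> homogeneous S"
    by (auto simp: power_int_def intro: homogeneous_inverse)
qed

lemma homogeneous_prod: "(\<And>j. j \<in> A \<Longrightarrow> f j \<in> homogeneous S) \<Longrightarrow> prod f A \<in> homogeneous S"
  by (induction A rule: infinite_finite_induct) (auto intro: homogeneous_1 homogeneous_mult)

lemma homogeneous_var: "cluster S i \<in> homogeneous S"
  using homogeneousI[OF degree_zero_1, of "Poly_Mapping.single i 1"] by (simp add: laurent_monomial_var[OF principal_cluster_nonzero])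

text \<open>
  An element of \<open>\<P>\<close> is a monomial in the \<open>yhat\<^sub>j\<close> up to a Laurent monomial in the cluster.
\<close>

lemma homogeneous_P_elem: "P_elem p \<in> homogeneous S"
proof -
  obtain m where m: "hat_monomial S p = laurent_monomial (cluster S) (p, m)" by (rule hat_monomial_eq)
  have "P_elem p = laurent_monomial (cluster S) ((0, - m) + (p, m))" by (simp add: laurent_monomial_def)
  also have "\<dots> = laurent_monomial (cluster S) (0, - m) * hat_eval S (Poly_Mapping.single p 1)"
    unfolding laurent_monomial_add[OF principal_cluster_nonzero] hat_eval_single m ..
  finally show ?thesis using homogeneousI[OF degree_zero_hat] by simp
qed

text \<open>
  Both terms of an exchange relation have the same degree because their quotient \<open>yhat\<^sub>k\<close> has degree 0.
\<close>

lemma homogeneous_mutation: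
  assumes T: "is_seed T" and hom: "\<And>l. cluster T l \<in> homogeneous S" and y: "\<And>j. yhat T j \<in> degree_zero S"
  shows "cluster (seed_mutation k T) l \<in> homogeneous S" "yhat (seed_mutation k T) j \<in> degree_zero S"
proof -
  note T_nz = is_seed_nonzero[OF T] and sss = is_seed_sss[OF T]
  have y1: "1 + yhat T k \<in> degree_zero S" by (intro degree_zero_add degree_zero_1 y)
  show "cluster (seed_mutation k T) l \<in> homogeneous S"
  proof (cases "l = k")
    case True
    show ?thesis
      unfolding True cluster_seed_mutation_yhat[OF T_nz sss] divide_inverse
      by (intro homogeneous_mult homogeneous_inverse homogeneous_prod homogeneous_powi hom homogeneous_P_elem
          homogeneous_degree_zero[OF y1])
  next
    case False
    then show ?thesis using hom[of l] by (simp add: cluster_seed_mutation_other)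
  qed
  show "yhat (seed_mutation k T) j \<in> degree_zero S"
  proof (cases "j = k")
    case True
    show ?thesis unfolding True yhat_seed_mutation_self[OF T_nz sss] by (intro degree_zero_inverse y)
  next
    case False
    show ?thesis unfolding yhat_seed_mutation_other[OF T_nz sss False]
      by (intro degree_zero_mult degree_zero_powi y y1)
  qed
qed

abbreviation ones_rel :: "('n trop, 'n) ambient \<Rightarrow> 'n trop QP \<Rightarrow> bool" where
  "ones_rel \<equiv> spec_rel (poly_eval scalar (cluster S)) (poly_eval id (\<lambda>_. 1))"

lemma specialization_ones: "specialization (poly_eval scalar (cluster S)) (poly_eval id (\<lambda>_. 1 :: 'n trop QP))"
proof
  show "is_ring_hom (poly_eval scalar (cluster S))" by (rule poly_eval_is_ring_hom[OF is_ring_hom_scalar])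
  show "is_ring_hom (poly_eval id (\<lambda>_ :: 'n. 1 :: 'n trop QP))"
    by (rule poly_eval_is_ring_hom[OF is_ring_hom_id])
  show "f = 0" if "poly_eval scalar (cluster S) f = 0" for f
    using principal_cluster_free that by (simp add: free_generating_def)
qed

lemma ones_scalar: "ones_rel (scalar c) c"
  using specialization.spec_base[OF specialization_ones, of "Poly_Mapping.single 0 c"]
  by (simp add: poly_eval_eq_lin_ext lin_ext_single[OF is_ring_hom_scalar] lin_ext_single[OF is_ring_hom_id])

lemma ones_var: "ones_rel (cluster S i) 1"
proof -
  have "(\<Prod>j\<in>UNIV. cluster S j ^ Poly_Mapping.lookup (Poly_Mapping.single i (1::nat)) j)
      = (\<Prod>j\<in>UNIV. if j = i then cluster S i else 1)"
    by (intro prod.cong) (auto simp: lookup_single when_def)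
  then have "(\<Prod>j\<in>UNIV. cluster S j ^ Poly_Mapping.lookup (Poly_Mapping.single i (1::nat)) j) = cluster S i"
    by simp
  then show ?thesis
    using specialization.spec_base[OF specialization_ones, of "Poly_Mapping.single (Poly_Mapping.single i 1) 1"]
    by (simp add: poly_eval_eq_lin_ext lin_ext_single[OF is_ring_hom_scalar] lin_ext_single[OF is_ring_hom_id]
        is_ring_homD[OF is_ring_hom_scalar])
qed

lemma ones_monomial: "ones_rel (laurent_monomial (cluster S) (p, m)) (QP_of p)"
proof -
  have "ones_rel (P_elem p * (\<Prod>i\<in>UNIV. cluster S i powi Poly_Mapping.lookup m i))
      (QP_of p * (\<Prod>i\<in>UNIV. 1 powi Poly_Mapping.lookup m i))"
    unfolding P_elem_def
    by (intro specialization.spec_mult[OF specialization_ones] specialization.spec_prod[OF specialization_ones]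
        specialization.spec_powi[OF specialization_ones] ones_scalar ones_var) simp
  then show ?thesis by (simp add: laurent_monomial_def)
qed

lemma ones_hat_eval: "ones_rel (hat_eval S a) (to_fract a)"
proof -
  have mono: "ones_rel (of_int c * hat_monomial S p) (to_fract (Poly_Mapping.single p c))" for c p
  proof -
    obtain m where m: "hat_monomial S p = laurent_monomial (cluster S) (p, m)" by (rule hat_monomial_eq)
    have "ones_rel (of_int c) (of_int c)"
      using ones_scalar[of "of_int c"] is_ring_hom_commutes_of_int[OF is_ring_hom_scalar] by metis
    then show ?thesis unfolding to_fract_single m
      by (intro specialization.spec_mult[OF specialization_ones] ones_monomial)
  qed
  have "ones_rel (\<Sum>p\<in>A. of_int (Poly_Mapping.lookup a p) * hat_monomial S p)
      (\<Sum>p\<in>A. to_fract (Poly_Mapping.single p (Poly_Mapping.lookup a p)))" for A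
  proof (induction A rule: infinite_finite_induct)
    case (insert p A)
    show ?case
      unfolding sum.insert[OF insert.hyps]
      by (rule specialization.spec_add[OF specialization_ones mono insert.IH])
  qed (simp_all only: sum.infinite sum.empty specialization.spec_0[OF specialization_ones] not_False_eq_True)
  from this[of "Poly_Mapping.keys a"] show ?thesis
    unfolding hat_eval_def lin_ext_def by (simp only: to_fract_sum[symmetric] sum_of_singles)
qed

text \<open>
  Setting the cluster to 1 undoes the substitution of \<open>yhat\<close> for \<open>y\<close>, so a homogeneous element can be
  recovered from its value there and its degree.
\<close>

lemma at_ones_homogeneous:
  assumes b: "hat_eval S b \<noteq> 0"
  shows "at_ones (cluster S) (laurent_monomial (cluster S) (0, g) * (hat_eval S a / hat_eval S b))
    = to_fract a / to_fract b"
proof -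
  let ?z = "laurent_monomial (cluster S) (0, g) * (hat_eval S a / hat_eval S b)"
  have "b \<noteq> 0" using b hat_eval_0 by auto
  then have "ones_rel ?z (QP_of 0 * (to_fract a / to_fract b))"
    by (intro specialization.spec_mult[OF specialization_ones] specialization.spec_divide[OF specialization_ones]
        ones_monomial ones_hat_eval) simp
  then have z: "ones_rel ?z (to_fract a / to_fract b)" by simp
  have "at_ones (cluster S) ?z = (THE c. ones_rel ?z c)" by (simp add: at_ones_def spec_rel_def)
  also have "\<dots> = to_fract a / to_fract b"
    using z specialization.spec_unique[OF specialization_ones] by blast
  finally show ?thesis .
qed

lemma homogeneous_eq_up_to_monomial:
  assumes "z \<in> homogeneous S" "w \<in> homogeneous S" and eq: "at_ones (cluster S) z = at_ones (cluster S) w"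
  obtains h where "w = laurent_monomial (cluster S) (0, h) * z"
proof -
  obtain g h a b c d where z: "z = laurent_monomial (cluster S) (0, g) * (hat_eval S a / hat_eval S b)"
    and w: "w = laurent_monomial (cluster S) (0, h) * (hat_eval S c / hat_eval S d)"
    and b: "hat_eval S b \<noteq> 0" and d: "hat_eval S d \<noteq> 0"
    using assms(1,2) unfolding homogeneous_def degree_zero_def by blast
  have "b \<noteq> 0" "d \<noteq> 0" using b d hat_eval_0 by auto
  moreover have "to_fract a / to_fract b = to_fract c / to_fract d"
    using eq unfolding z w at_ones_homogeneous[OF b] at_ones_homogeneous[OF d] .
  ultimately have "to_fract (a * d) = to_fract (c * b)" by (simp add: frac_eq_eq)
  then have "a * d = c * b" by (simp only: to_fract_eq_iff)
  then have "hat_eval S a * hat_eval S d = hat_eval S c * hat_eval S b"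
    by (metis is_ring_homD(4)[OF hat_eval_hom])
  then have same: "hat_eval S a / hat_eval S b = hat_eval S c / hat_eval S d"
    using b d by (simp add: frac_eq_eq)
  have "laurent_monomial (cluster S) (0, h) = laurent_monomial (cluster S) ((0, h - g) + (0, g))" by simp
  then have "w = laurent_monomial (cluster S) (0, h - g) * z"
    unfolding z w same laurent_monomial_add[OF principal_cluster_nonzero] by (simp only: mult.assoc)
  then show ?thesis by (rule that)
qed

end

section \<open>Cluster variables that differ by a monomial\<close>

lemma monomial_nonneg_in_neighbour:
  fixes S :: "('p::semifield, 'n::{finite,linorder}) seed"
  assumes X: "\<And>i. cluster S i \<noteq> 0" and g: "0 \<le> Poly_Mapping.lookup (snd g) k"
  shows "laurent_monomial (cluster (seed_mutation k S)) g \<in> laurent_ring (cluster S)"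
  unfolding laurent_monomial_def
proof (intro laurent_ring_mult[OF X] laurent_ring_prod[OF X] laurent_ring_P_elem[OF X])
  fix i
  show "cluster (seed_mutation k S) i powi Poly_Mapping.lookup (snd g) i \<in> laurent_ring (cluster S)"
  proof (cases "i = k")
    case True
    then show ?thesis
      using g laurent_ring_power[of "cluster S", OF X cluster_seed_mutation_in_laurent_ring[of S, OF X]]
      by (simp add: power_int_def)
  next
    case False
    then show ?thesis using laurent_ring_powi[of "cluster S" i, OF X] by (simp add: cluster_seed_mutation_other)
  qed
qed

context
  fixes S :: "'n::{finite,linorder} list \<Rightarrow> ('n trop, 'n) seed" and t0 :: "'n list"
  assumes pattern: "cluster_pattern S" and t0: "t0 \<in> tree_vertices" and principal: "principal_coefficients S t0"
begin

lemma initial_seed: "is_seed (S t0)"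
  using cluster_pattern_seed[OF pattern t0] .

lemma initial_cluster_free: "free_generating (cluster (S t0))"
  using initial_seed by (simp add: is_seed_def)

lemma cluster_variable_homogeneous:
  assumes t: "t \<in> tree_vertices"
  shows "cluster_variable S l t \<in> homogeneous (S t0)"
proof -
  have principal0: "coeffs (S t0) = trop_gen" using principal by (simp add: principal_coefficients_def)
  have "(\<forall>l. cluster (S t) l \<in> homogeneous (S t0)) \<and> (\<forall>j. yhat (S t) j \<in> degree_zero (S t0))"
  proof (rule tree_propagate[of t0 t "\<lambda>t. (\<forall>l. cluster (S t) l \<in> homogeneous (S t0))
      \<and> (\<forall>j. yhat (S t) j \<in> degree_zero (S t0))", OF t0 t])
    show "(\<forall>l. cluster (S t0) l \<in> homogeneous (S t0)) \<and> (\<forall>j. yhat (S t0) j \<in> degree_zero (S t0))"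
      by (intro conjI allI homogeneous_var degree_zero_yhat initial_seed principal0)
    fix k t t' assume edge: "tree_edge k t t'"
      and IH: "(\<forall>l. cluster (S t) l \<in> homogeneous (S t0)) \<and> (\<forall>j. yhat (S t) j \<in> degree_zero (S t0))"
    have T: "is_seed (S t)" by (rule cluster_pattern_seed[OF pattern tree_edge_vertices(1)[OF edge]])
    show "(\<forall>l. cluster (S t') l \<in> homogeneous (S t0)) \<and> (\<forall>j. yhat (S t') j \<in> degree_zero (S t0))"
      unfolding cluster_pattern_edge[OF pattern edge]
      using homogeneous_mutation[OF initial_seed principal0 T] IH by blast
  qed
  then show ?thesis by blast
qed

lemma cluster_variable_bounded:
  assumes t: "t \<in> tree_vertices"
  shows "bounded_near_zero (cluster (S t0)) i (cluster_variable S l t)"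
proof -
  have "\<forall>l. bounded_near_zero (cluster (S t0)) i (cluster (S t) l)"
  proof (rule tree_propagate[of t0 t "\<lambda>t. \<forall>l. bounded_near_zero (cluster (S t0)) i (cluster (S t) l)", OF t0 t])
    show "\<forall>l. bounded_near_zero (cluster (S t0)) i (cluster (S t0) l)"
      using bounded_var[OF initial_cluster_free] by blast
    fix k t t' assume edge: "tree_edge k t t'" and IH: "\<forall>l. bounded_near_zero (cluster (S t0)) i (cluster (S t) l)"
    show "\<forall>l. bounded_near_zero (cluster (S t0)) i (cluster (S t') l)"
      unfolding cluster_pattern_edge[OF pattern edge]
      using bounded_cluster_mutation[OF initial_cluster_free] IH by blast
  qed
  then show ?thesis by blast
qed

text \<open>
  The element \<open>e = x' / x\<^sub>k\<close> is written in two ways: as \<open>x'\<close> times the inverse of \<open>x\<^sub>k\<close>, which is fine wherever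
  \<open>x\<^sub>k\<close> is invertible, and as \<open>X\<^bsup>h - e\<^sub>k\<^esup> x\<close>, which is fine at the neighbour in direction \<open>k\<close>.
\<close>

lemma initial_variable_factor:
  assumes t: "t \<in> tree_vertices" and t': "t' \<in> tree_vertices"
    and eq: "cluster_variable S l' t' = laurent_monomial (cluster (S t0)) (0, h) * cluster_variable S l t"
    and k: "0 < Poly_Mapping.lookup h k"
  shows "cluster_variable S l' t' \<in> range (cluster (S t0))"
proof -
  let ?X = "cluster (S t0)" and ?x = "cluster_variable S l t" and ?x' = "cluster_variable S l' t'"
  have X: "?X i \<noteq> 0" for i by (rule is_seed_nonzero[OF initial_seed])
  note in_upper = cluster_variable_in_upper_bound[OF pattern t0 principal]
  define e where "e = ?x' * inverse (?X k)"
  have e_eq: "e = laurent_monomial ?X (0, h - Poly_Mapping.single k 1) * ?x"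
  proof -
    have "laurent_monomial ?X (0, h) = laurent_monomial ?X ((0, h - Poly_Mapping.single k 1) + (0, Poly_Mapping.single k 1))"
      by simp
    also have "\<dots> = laurent_monomial ?X (0, h - Poly_Mapping.single k 1) * ?X k"
      unfolding laurent_monomial_add[OF X] laurent_monomial_var[OF X] by simp
    finally show ?thesis unfolding e_def eq using X[of k] by simp
  qed
  have "e \<in> upper_bound S t0"
  proof (rule upper_boundI)
    show "e \<in> laurent_ring ?X"
      unfolding e_def by (rule laurent_ring_mult[OF X upper_boundD(1)[OF in_upper[OF t' t0]] laurent_ring_inverse_var[OF X]])
    fix i t1 assume edge: "tree_edge i t0 t1"
    let ?Z = "cluster (S t1)"
    have "is_seed (S t1)" by (rule cluster_pattern_seed[OF pattern tree_edge_vertices(2)[OF edge]])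
    then have Z: "?Z j \<noteq> 0" for j by (rule is_seed_nonzero)
    have St0: "S t0 = seed_mutation i (S t1)" by (rule cluster_pattern_edge[OF pattern tree_edge_sym[OF edge]])
    show "e \<in> laurent_ring ?Z"
    proof (cases "i = k")
      case False
      then have "?X k = ?Z k" unfolding St0 by (intro cluster_seed_mutation_other) simp
      then have "inverse (?X k) \<in> laurent_ring ?Z" using laurent_ring_inverse_var[of ?Z k, OF Z] by simp
      then show ?thesis unfolding e_def by (rule laurent_ring_mult[OF Z upper_boundD(2)[OF in_upper[OF t' t0] edge]])
    next
      case True
      have "laurent_monomial ?X (0, h - Poly_Mapping.single k 1) \<in> laurent_ring ?Z"
        unfolding St0 True by (rule monomial_nonneg_in_neighbour[OF Z]) (use k in \<open>simp add: lookup_minus\<close>)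
      then show ?thesis unfolding e_eq by (rule laurent_ring_mult[OF Z _ upper_boundD(2)[OF in_upper[OF t t0] edge]])
    qed
  qed
  then have e: "e \<in> upper_bound S t'" by (rule upper_bound_invariant[OF pattern t0 principal t0 t'])
  have x'_eq: "?x' = ?X k * e" unfolding e_def using X[of k] by simp
  show ?thesis
  proof (rule cluster_variable_irreducible[OF pattern t0 principal t' in_upper[OF t0 t'] e x'_eq])
    fix p assume "?X k = P_elem p \<or> ?X k = - P_elem p"
    then have "?X k = of_int 1 * P_elem p \<or> ?X k = of_int (- 1) * P_elem p" by simp
    then obtain c :: int where c: "?X k = of_int c * P_elem p" by blast
    let ?m = "(0, Poly_Mapping.single k 1) :: 'n trop \<times> ('n \<Rightarrow>\<^sub>0 int)"
    let ?f = "Poly_Mapping.single ?m 1 - Poly_Mapping.single (p, 0) c"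
    have "laurent ?X ?f = 0"
      using c by (simp add: is_ring_hom_diff[OF laurent_is_ring_hom[OF X]] laurent_single laurent_monomial_var[OF X])
        (simp add: laurent_monomial_def)
    then have "?f = 0" by (rule laurent_inj[OF initial_cluster_free])
    then have "Poly_Mapping.lookup ?f ?m = 0" by simp
    then show ?thesis by (simp add: lookup_minus lookup_single when_def split: if_splits)
  next
    fix p assume "e = P_elem p \<or> e = - P_elem p"
    then have "e = of_int 1 * P_elem p \<or> e = of_int (- 1) * P_elem p" by simp
    then obtain c :: int where c: "c = 1 \<or> c = -1" and e: "e = of_int c * P_elem p" by blast
    have x': "?x' = of_int c * P_elem p * ?X k" unfolding x'_eq e by (simp add: mult_ac)
    have "c = 1 \<and> Poly_Mapping.lookup p i = 0" for i
      using bounded_coefficient_trivial[OF initial_cluster_free cluster_variable_bounded[OF t', of i l', unfolded x'] c] .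
    then have "c = 1" "p = 0" by (auto intro: poly_mapping_eqI)
    then show ?thesis using x' by simp
  qed
qed

end

theorem corollary5p7:
  fixes S :: "'n::{finite,linorder} list \<Rightarrow> ('n trop, 'n) seed"
    and t0 t t' :: "'n list" and l l' :: 'n
  assumes "cluster_pattern S"
    and "t0 \<in> tree_vertices" and "principal_coefficients S t0"
    and "t \<in> tree_vertices" and "t' \<in> tree_vertices"
    and "cluster_variable S l t \<notin> range (cluster (S t0))"
    and "cluster_variable S l' t' \<notin> range (cluster (S t0))"
    and "F_polynomial S t0 l t = F_polynomial S t0 l' t'"
  shows "cluster_variable S l t = cluster_variable S l' t'"
proof -
  note pattern = assms(1-3)
  let ?X = "cluster (S t0)" and ?x = "cluster_variable S l t" and ?x' = "cluster_variable S l' t'"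
  have seed: "is_seed (S t0)" by (rule cluster_pattern_seed[OF assms(1,2)])
  have X: "?X i \<noteq> 0" for i by (rule is_seed_nonzero[OF seed])
  have "coeffs (S t0) = trop_gen" using assms(3) by (simp add: principal_coefficients_def)
  then obtain h where h: "?x' = laurent_monomial ?X (0, h) * ?x"
    using homogeneous_eq_up_to_monomial[OF seed _ cluster_variable_homogeneous[OF pattern assms(4)]
        cluster_variable_homogeneous[OF pattern assms(5)]] assms(8) unfolding F_polynomial_def by blast
  have "\<not> 0 < Poly_Mapping.lookup h k" for k
    using initial_variable_factor[OF pattern assms(4,5) h] assms(7) by blast
  moreover have "\<not> Poly_Mapping.lookup h k < 0" for k
  proof
    assume k: "Poly_Mapping.lookup h k < 0"
    have "?x = laurent_monomial ?X (0, - h) * ?x'"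
      using laurent_monomial_uminus[of ?X "(0, h)", OF X] laurent_monomial_nonzero[of ?X "(0, h)", OF X]
      unfolding h by simp
    then have "?x \<in> range ?X"
      by (rule initial_variable_factor[OF pattern assms(5,4)]) (use k in simp)
    then show False using assms(6) by blast
  qed
  ultimately have "h = 0" by (intro poly_mapping_eqI) (simp add: order.antisym not_less)
  then show ?thesis using h by (simp add: laurent_monomial_def)
qed

end
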